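(* The colored $(q,r)$-Eulerian polynomials satisfy, for all $n\ge0$, $$A_{n+1}^{(l)}(t,r,q)=(r+t[l-1]_tq^n)A_n^{(l)}(t,r,q)+t[l]_t\sum_{k=0}^{n-1}{n\brack k}_{q}q^{k}A_k^{(l)}(t,r,q)A_{n-k}^{(l)}(t,q),$$ with $A_0^{(l)}(t,r,q)=1$.
   Context: $[m]_t=1+t+\dots+t^{m-1}$ ($[0]_t=0$); ${n\brack k}_q=\frac{(q;q)_n}{(q;q)_k(q;q)_{n-k}}$, $(q;q)_m=\prod_{i=1}^m(1-q^i)$. $C_l\wr\mathfrak{S}_n$ is the set of words $\pi=\pi_1\cdots\pi_n$ with $\pi_i=|\pi_i|^{\epsilon_i}$, $\epsilon_i\in\{0,\dots,l-1\}$, $|\pi_1|\cdots|\pi_n|\in\mathfrak{S}_n$. Order colored integers by $u^a<v^b$ iff $a>b$, or $a=b$ and $u<v$. $\mathrm{maj}(\pi)=\sum\{i\in[n-1]:\pi_i>\pi_{i+1}\}$; $\mathrm{exc}(\pi)$ is the number of $i$ with $\epsilon_i=0$ and $|\pi_i|>i$; $\mathrm{fexc}(\pi)=l\,\mathrm{exc}(\pi)+\sum_i\epsilon_i$; $\mathrm{fix}(\pi)=|\{i:\pi_i=i^0\}|$. $A_n^{(l)}(t,r,q)=\sum_{\pi\in C_l\wr\mathfrak{S}_n}t^{\mathrm{fexc}(\pi)}r^{\mathrm{fix}(\pi)}q^{(\mathrm{maj}-\mathrm{exc})\pi}$ and $A_n^{(l)}(t,q)=A_n^{(l)}(t,1,q)$.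 *)

theory Defs
  imports Main "HOL-Computational_Algebra.Polynomial"
begin

text \<open>A colored permutation in C_l wr S_n is a word of colored integers, encoded as a list of
pairs (|pi_i|, epsilon_i).\<close>

definition colored_perms :: "nat \<Rightarrow> nat \<Rightarrow> (nat \<times> nat) list set" where
  "colored_perms l n = {\<pi>. length \<pi> = n \<and> distinct (map fst \<pi>) \<and> set (map fst \<pi>) = {1..n}
                            \<and> (\<forall>x\<in>set \<pi>. snd x < l)}"

definition cless :: "nat \<times> nat \<Rightarrow> nat \<times> nat \<Rightarrow> bool" where
  "cless x y = (snd x > snd y \<or> (snd x = snd y \<and> fst x < fst y))"

text \<open>maj: sum of descent positions i in [n-1] (1-indexed) with pi_i > pi_(i+1).\<close>
definition cmaj :: "(nat \<times> nat) list \<Rightarrow> nat" where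
  "cmaj \<pi> = (\<Sum>i\<in>{1..<length \<pi>}. if cless (\<pi> ! i) (\<pi> ! (i - 1)) then i else 0)"

definition cexc :: "(nat \<times> nat) list \<Rightarrow> nat" where
  "cexc \<pi> = card {i. i < length \<pi> \<and> snd (\<pi> ! i) = 0 \<and> fst (\<pi> ! i) > i + 1}"

definition cfexc :: "nat \<Rightarrow> (nat \<times> nat) list \<Rightarrow> nat" where
  "cfexc l \<pi> = l * cexc \<pi> + sum_list (map snd \<pi>)"

definition cfix :: "(nat \<times> nat) list \<Rightarrow> nat" where
  "cfix \<pi> = card {i. i < length \<pi> \<and> \<pi> ! i = (i + 1, 0)}"

text \<open>A_n^(l)(t,r,q). The exponent maj - exc is always nonnegative, so nat subtraction is exact.\<close>
definition colEulerian :: "nat \<Rightarrow> nat \<Rightarrow> 'a::comm_ring_1 \<Rightarrow> 'a \<Rightarrow> 'a \<Rightarrow> 'a" where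
  "colEulerian l n t r q =
     (\<Sum>\<pi>\<in>colored_perms l n. t ^ cfexc l \<pi> * r ^ cfix \<pi> * q ^ (cmaj \<pi> - cexc \<pi>))"

definition colEulerian1 :: "nat \<Rightarrow> nat \<Rightarrow> 'a::comm_ring_1 \<Rightarrow> 'a \<Rightarrow> 'a" where
  "colEulerian1 l n t q = colEulerian l n t 1 q"

definition qint :: "nat \<Rightarrow> 'a::comm_ring_1 \<Rightarrow> 'a" where
  "qint m t = (\<Sum>i<m. t ^ i)"

definition qpoch_poly :: "nat \<Rightarrow> int poly" where
  "qpoch_poly m = (\<Prod>i\<in>{1..m}. 1 - monom 1 i)"

text \<open>Gaussian binomial coefficient as a polynomial in Z[q] (exact quotient), evaluated at q.\<close>
definition qbinom_poly :: "nat \<Rightarrow> nat \<Rightarrow> int poly" where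
  "qbinom_poly n k = qpoch_poly n div (qpoch_poly k * qpoch_poly (n - k))"

definition qbinom :: "nat \<Rightarrow> nat \<Rightarrow> 'a::comm_ring_1 \<Rightarrow> 'a" where
  "qbinom n k q = poly (map_poly of_int (qbinom_poly n k)) q"

end

theory Submission
  imports Defs "HOL-Library.Product_Lexorder" "HOL-Library.Poly_Mapping"
    "HOL-Computational_Algebra.Polynomial_FPS"
begin

text \<open>Recolour every excedance with an extra colour l, smaller than all others. This turns maj - exc
  into the major index of the recoloured permutation, and the sum of the colours into the flag
  excedance. Adding a weakly decreasing labelling b that drops at every descent replaces q^maj by
  sums of q^|b| (up to the factor (q;q)_n), and sorting identifies a labelled permutation with an
  arbitrary word of pairs (label, colour), the conditions on the recoloured permutation becoming
  local conditions on the word compared with its sorted rearrangement.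

  These words are counted by the coefficient of x^K in a product of powers of linear forms
  row_c = (\<beta> - s) (sum of x_d for d < c) + \<beta> x_c + (\<beta> - 1) (sum of x_d for d > c), where s = t^l and
  \<beta> = 1 + t + ... + t^l, as in MacMahon's Master Theorem. Summing over the exponent of the lowest
  variable is an application of the negative binomial series and yields the same kind of product in
  the remaining variables, with all three coefficients shifted by a common amount. Iterating gives
  a closed form for boundedly many labels, from which the recurrence follows by splitting off the
  label 0 and letting the bound tend to infinity.\<close>

section \<open>Coefficient extraction\<close>

text \<open>Two formal variables are in play: the outer \<open>fps_X\<close> counts letters, and the
  label weights \<open>y c\<close> are later set to q^c. With P, Q, T the products of 1 - a X q^c
  over the labels for a = 1, t^l, r, the closed form reached is (1 - t) P Q / (T (P - t Q)), the
  usual shape of an Eulerian generating function. The elimination closes up because the variable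
  removed takes a value proportional to the sum of the remaining ones and enters every remaining row
  with the same coefficient b - s; hence \<open>row\<close> and \<open>block_sum\<close> carry a
  free parameter b that starts as \<beta>. The obstacle is that the ring is arbitrary: 1 - t, 1 -
  t^l and (q;q)_n may vanish, so no such quotient can be formed. Closed forms are therefore stated
  multiplied out, cancelling only series with constant term 1. The recurrence is first proved with q
  a formal variable, where letting the number of labels grow makes sense coefficientwise; it then
  passes to polynomials in q by injectivity of \<open>fps_of_poly\<close>, and to arbitrary q by
  evaluation.\<close>

abbreviation mcoeff :: "('k multiset \<Rightarrow>\<^sub>0 'c::zero) \<Rightarrow> 'k multiset \<Rightarrow> 'c" where
  "mcoeff \<equiv> Poly_Mapping.lookup"

text \<open>The formal sum of X^i a_i over all i.\<close>

definition fps_total :: "(nat \<Rightarrow> 'b::comm_ring_1 fps) \<Rightarrow> 'b fps" where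
  "fps_total a = Abs_fps (\<lambda>n. \<Sum>i\<le>n. fps_nth (a i) (n - i))"

text \<open>Only the terms with i \<le> n reach the coefficient of X^n, so finite partial sums can
  stand in for the infinite sum.\<close>

lemma fps_total_nth_partial:
  assumes "n \<le> N"
  shows "fps_nth (fps_total a) n = fps_nth (\<Sum>i\<le>N. fps_X ^ i * a i) n"
proof -
  have "fps_nth (\<Sum>i\<le>N. fps_X ^ i * a i) n = (\<Sum>i\<le>N. if i \<le> n then fps_nth (a i) (n - i) else 0)"
    by (auto simp: fps_sum_nth fps_X_power_mult_nth intro!: sum.cong)
  also have "\<dots> = (\<Sum>i\<le>n. fps_nth (a i) (n - i))"
    using assms by (intro sum.mono_neutral_cong_right) auto
  finally show ?thesis by (simp add: fps_total_def)
qed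

lemma fps_total_add: "fps_total (\<lambda>i. a i + b i) = fps_total a + fps_total b"
  by (rule fps_ext) (simp add: fps_total_def sum.distrib)

text \<open>Distributivity over an infinite sum: all coefficients up to n are computed from one
  partial sum, where finite distributivity applies.\<close>

lemma fps_total_mult_left: "fps_total (\<lambda>i. c * a i) = c * fps_total a"
proof (rule fps_ext)
  fix n
  have "fps_nth (c * fps_total a) n = (\<Sum>k=0..n. fps_nth c k * fps_nth (fps_total a) (n - k))"
    by (simp add: fps_mult_nth)
  also have "\<dots> = (\<Sum>k=0..n. fps_nth c k * fps_nth (\<Sum>i\<le>n. fps_X ^ i * a i) (n - k))"
    by (intro sum.cong refl arg_cong2[where f = "(*)"] fps_total_nth_partial) auto
  also have "\<dots> = fps_nth (c * (\<Sum>i\<le>n. fps_X ^ i * a i)) n"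
    by (simp add: fps_mult_nth)
  also have "c * (\<Sum>i\<le>n. fps_X ^ i * a i) = (\<Sum>i\<le>n. fps_X ^ i * (c * a i))"
    by (simp add: sum_distrib_left algebra_simps)
  finally show "fps_nth (fps_total (\<lambda>i. c * a i)) n = fps_nth (c * fps_total a) n"
    by (simp add: fps_total_nth_partial[of n n])
qed

lemma fps_total_Suc: "fps_total a = a 0 + fps_X * fps_total (\<lambda>i. a (Suc i))"
proof (rule fps_ext)
  fix n show "fps_nth (fps_total a) n = fps_nth (a 0 + fps_X * fps_total (\<lambda>i. a (Suc i))) n"
  proof (cases n)
    case 0 then show ?thesis by (simp add: fps_total_def)
  next
    case (Suc n')
    show ?thesis unfolding Suc by (simp only: fps_total_def fps_nth_Abs_fps sum.atMost_Suc_shift) (simp add: fps_total_def)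
  qed
qed

text \<open>Additive induction: coefficient formulas that are linear in f need checking on monomials
  only.\<close>

lemma poly_mapping_induct [case_names single sum]:
  fixes f :: "'k \<Rightarrow>\<^sub>0 'c::monoid_add"
  assumes single: "\<And>k v. P (Poly_Mapping.single k v)"
    and sum: "\<And>f g. P f \<Longrightarrow> P g \<Longrightarrow> P (f + g)"
  shows "P f"
proof (induction f rule: update_induct)
  case const
  then show ?case using single[of undefined 0] by simp
next
  case (update f k v)
  have "Poly_Mapping.update k v f = Poly_Mapping.single k v + f"
    using update(1) by (intro poly_mapping_eqI) (auto simp: lookup_update lookup_add lookup_single when_def in_keys_iff)
  then show ?case using sum[OF single update(3)] by simp
qed

lemma lookup_single_mult_add:
  fixes f :: "'k multiset \<Rightarrow>\<^sub>0 'c::comm_ring_1"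
  shows "mcoeff (Poly_Mapping.single S c * f) (S + K) = c * mcoeff f K"
proof (induction f rule: poly_mapping_induct)
  case (single k v)
  then show ?case by (simp add: mult_single lookup_single when_def)
next
  case (sum f g)
  then show ?case by (simp add: distrib_left lookup_add)
qed

lemma lookup_const_mult:
  fixes f :: "'k multiset \<Rightarrow>\<^sub>0 'c::comm_ring_1"
  shows "mcoeff (Poly_Mapping.single 0 c * f) K = c * mcoeff f K"
  using lookup_single_mult_add[of 0 c f K] by simp

lemma lookup_single_mult_not:
  fixes f :: "'k multiset \<Rightarrow>\<^sub>0 'c::comm_ring_1"
  assumes "\<not> S \<subseteq># K"
  shows "mcoeff (Poly_Mapping.single S c * f) K = 0"
proof (induction f rule: poly_mapping_induct)
  case (single k v)
  then show ?case using assms by (auto simp add: mult_single lookup_single when_def)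
next
  case (sum f g)
  then show ?case by (simp add: distrib_left lookup_add)
qed

section \<open>Isolating one variable\<close>

definition free_of :: "'k \<Rightarrow> ('k multiset \<Rightarrow>\<^sub>0 'c::comm_ring_1) set" where
  "free_of d = {f. \<forall>K. d \<in># K \<longrightarrow> mcoeff f K = 0}"

lemma free_of_keys: "f \<in> free_of d \<longleftrightarrow> (\<forall>K\<in>Poly_Mapping.keys f. d \<notin># K)"
  by (auto simp: free_of_def in_keys_iff)

lemma free_of_add: "f \<in> free_of d \<Longrightarrow> g \<in> free_of d \<Longrightarrow> f + g \<in> free_of d"
  by (auto simp: free_of_def lookup_add)

lemma free_of_diff: "f \<in> free_of d \<Longrightarrow> g \<in> free_of d \<Longrightarrow> f - g \<in> free_of d"
  by (auto simp: free_of_def lookup_minus)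

lemma free_of_mult: "f \<in> free_of d \<Longrightarrow> g \<in> free_of d \<Longrightarrow> f * g \<in> free_of d"
  using keys_mult[of f g] unfolding free_of_keys by fastforce

lemma free_of_single: "d \<notin># K \<Longrightarrow> Poly_Mapping.single K c \<in> free_of d"
  by (auto simp: free_of_def lookup_single when_def)

lemma free_of_sum: "(\<And>i. i \<in> I \<Longrightarrow> f i \<in> free_of d) \<Longrightarrow> sum f I \<in> free_of d"
  by (auto simp: free_of_def lookup_sum)

text \<open>The univariate variable plays the part of the isolated x_d; keeping x_d out of the
  coefficients makes this representation unambiguous.\<close>

definition coeffs_free_of :: "'k \<Rightarrow> ('k multiset \<Rightarrow>\<^sub>0 'c::comm_ring_1) poly set" where
  "coeffs_free_of d = {P. \<forall>i. coeff P i \<in> free_of d}"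

lemma coeffs_free_of_add: "P \<in> coeffs_free_of d \<Longrightarrow> Q \<in> coeffs_free_of d \<Longrightarrow> P + Q \<in> coeffs_free_of d"
  by (auto simp: coeffs_free_of_def free_of_add)

lemma coeffs_free_of_diff: "P \<in> coeffs_free_of d \<Longrightarrow> Q \<in> coeffs_free_of d \<Longrightarrow> P - Q \<in> coeffs_free_of d"
  by (auto simp: coeffs_free_of_def free_of_diff)

lemma coeffs_free_of_mult: "P \<in> coeffs_free_of d \<Longrightarrow> Q \<in> coeffs_free_of d \<Longrightarrow> P * Q \<in> coeffs_free_of d"
  by (auto simp: coeffs_free_of_def coeff_mult intro!: free_of_sum free_of_mult)

lemma zero_free_of: "0 \<in> free_of d"
  by (auto simp: free_of_def)

lemma one_free_of: "1 \<in> free_of d"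
  by (auto simp: free_of_def lookup_one when_def)

lemma coeffs_free_of_pCons: "a \<in> free_of d \<Longrightarrow> P \<in> coeffs_free_of d \<Longrightarrow> pCons a P \<in> coeffs_free_of d"
  by (auto simp: coeffs_free_of_def coeff_pCons split: nat.splits)

lemma coeffs_free_of_0: "0 \<in> coeffs_free_of d"
  by (auto simp: coeffs_free_of_def zero_free_of)

lemma coeffs_free_of_1: "1 \<in> coeffs_free_of d"
  by (auto simp: coeffs_free_of_def one_free_of zero_free_of)

lemma coeffs_free_of_power: "P \<in> coeffs_free_of d \<Longrightarrow> P ^ k \<in> coeffs_free_of d"
  by (induction k) (auto intro: coeffs_free_of_1 coeffs_free_of_mult)

lemma coeffs_free_of_prod: "(\<And>i. i \<in> I \<Longrightarrow> f i \<in> coeffs_free_of d) \<Longrightarrow> prod f I \<in> coeffs_free_of d"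
  by (induction I rule: infinite_finite_induct) (auto intro: coeffs_free_of_1 coeffs_free_of_mult)

text \<open>As the coefficients of P avoid x_d, every factor x_d of a monomial in the value stems
  from the univariate variable. Multivariate coefficients can thus be extracted one variable at a
  time.\<close>

lemma lookup_poly_variable:
  assumes "P \<in> coeffs_free_of d" "d \<notin># K"
  shows "mcoeff (poly P (Poly_Mapping.single {#d#} 1)) (K + replicate_mset k d) = mcoeff (coeff P k) K"
  using assms(1)
proof (induction P arbitrary: k)
  case 0
  then show ?case by simp
next
  case (pCons a P)
  have c: "coeff (pCons a P) i \<in> free_of d" for i
    using pCons.prems unfolding coeffs_free_of_def by blast
  have a: "a \<in> free_of d" using c[of 0] by simp
  have P: "P \<in> coeffs_free_of d"
    unfolding coeffs_free_of_def using c[of "Suc _"] by simp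
  show ?case
  proof (cases k)
    case 0
    then show ?thesis using assms(2) by (simp add: lookup_add lookup_single_mult_not)
  next
    case (Suc k')
    have "mcoeff (Poly_Mapping.single {#d#} 1 * poly P (Poly_Mapping.single {#d#} 1)) ({#d#} + (K + replicate_mset k' d))
        = mcoeff (coeff P k') K"
      by (subst lookup_single_mult_add) (simp add: pCons.IH[OF P])
    moreover have "mcoeff a (K + replicate_mset k d) = 0"
      using a Suc by (auto simp: free_of_def)
    ultimately show ?thesis using Suc by (simp add: lookup_add)
  qed
qed

text \<open>Generating polynomials of the words occupying one level: p is the sum of all admissible letters, x
  the letter of colour 0 of that level and s x its letter of colour l. A maximal final run of x
  stands for fixed points and is weighted by powers of r; block excludes words starting with s x.\<close>

fun rblock :: "'c::comm_ring_1 \<Rightarrow> 'c \<Rightarrow> 'c \<Rightarrow> nat \<Rightarrow> 'c" where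
  "rblock r x p 0 = 1"
| "rblock r x p (Suc k) = r * x * rblock r x p k + (p - x) * p ^ k"

fun block :: "'c::comm_ring_1 \<Rightarrow> 'c \<Rightarrow> 'c \<Rightarrow> 'c \<Rightarrow> nat \<Rightarrow> 'c" where
  "block r s x p 0 = 1"
| "block r s x p (Suc k) = rblock r x p (Suc k) - s * x * rblock r x p k"

lemma poly_rblock: "poly (rblock r x p k) v = rblock (poly r v) (poly x v) (poly p v) k"
  by (induction k) auto

lemma poly_block: "poly (block r s x p k) v = block (poly r v) (poly s v) (poly x v) (poly p v) k"
  by (cases k) (auto simp: poly_rblock)

lemma coeffs_free_of_rblock:
  "r \<in> coeffs_free_of d \<Longrightarrow> x \<in> coeffs_free_of d \<Longrightarrow> p \<in> coeffs_free_of d \<Longrightarrow> rblock r x p k \<in> coeffs_free_of d"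
  by (induction k) (auto intro!: coeffs_free_of_1 coeffs_free_of_mult coeffs_free_of_add coeffs_free_of_diff coeffs_free_of_power)

lemma coeffs_free_of_block:
  "r \<in> coeffs_free_of d \<Longrightarrow> s \<in> coeffs_free_of d \<Longrightarrow> x \<in> coeffs_free_of d \<Longrightarrow> p \<in> coeffs_free_of d \<Longrightarrow> block r s x p k \<in> coeffs_free_of d"
  by (cases k) (auto intro!: coeffs_free_of_1 coeffs_free_of_mult coeffs_free_of_diff coeffs_free_of_rblock simp del: rblock.simps)

section \<open>Diagonal sums and Lagrange inversion\<close>

abbreviation const_mp :: "'c::comm_ring_1 \<Rightarrow> 'k multiset \<Rightarrow>\<^sub>0 'c" where
  "const_mp \<equiv> Poly_Mapping.single 0"

text \<open>The sum over k of (X y)^k times the coefficient of x^k in P k, read off at the monomial K in the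
  remaining variables.\<close>

definition diag_sum :: "'b::comm_ring_1 fps \<Rightarrow> 'k multiset \<Rightarrow> (nat \<Rightarrow> ('k multiset \<Rightarrow>\<^sub>0 'b fps) poly) \<Rightarrow> 'b fps" where
  "diag_sum y K P = fps_total (\<lambda>k. y ^ k * mcoeff (coeff (P k) k) K)"

lemma diag_sum_add: "diag_sum y K (\<lambda>k. P k + Q k) = diag_sum y K P + diag_sum y K Q"
  by (simp add: diag_sum_def lookup_add distrib_left fps_total_add)

lemma diag_sum_const_mult: "diag_sum y K (\<lambda>k. [:const_mp c:] * P k) = c * diag_sum y K P"
proof -
  have "diag_sum y K (\<lambda>k. [:const_mp c:] * P k) = fps_total (\<lambda>k. c * (y ^ k * mcoeff (coeff (P k) k) K))"
    unfolding diag_sum_def by (simp add: lookup_const_mult mult_ac)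
  then show ?thesis by (simp only: fps_total_mult_left diag_sum_def)
qed

lemma diag_sum_Suc:
  "diag_sum y K P = mcoeff (coeff (P 0) 0) K + fps_X * y * fps_total (\<lambda>k. y ^ k * mcoeff (coeff (P (Suc k)) (Suc k)) K)"
proof -
  have "diag_sum y K P = mcoeff (coeff (P 0) 0) K + fps_X * fps_total (\<lambda>k. y * (y ^ k * mcoeff (coeff (P (Suc k)) (Suc k)) K))"
    unfolding diag_sum_def by (subst fps_total_Suc) (simp add: mult_ac)
  then show ?thesis by (simp only: fps_total_mult_left mult.assoc)
qed

lemma diag_sum_minus: "diag_sum y K (\<lambda>k. P k - Q k) = diag_sum y K P - diag_sum y K Q"
  using diag_sum_add[of y K "\<lambda>k. P k - Q k" Q] by (simp add: algebra_simps)

text \<open>A factor x moves the diagonal by one step and costs one factor z = X y; the remainder A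
  does not meet the diagonal.\<close>

lemma diag_sum_shift:
  assumes "\<And>k. Q (Suc k) = A k + [:0, 1:] * P k"
    and "\<And>k. coeff (A k) (Suc k) = 0"
  shows "diag_sum y K Q = mcoeff (coeff (Q 0) 0) K + fps_X * y * diag_sum y K P"
  by (subst diag_sum_Suc) (simp add: assms diag_sum_def)

lemma solve_unit:
  fixes g :: "'c::comm_ring_1"
  assumes "g * u = 1" "u * s = v"
  shows "s = g * v"
  using assms by (metis mult.assoc mult.left_neutral)

text \<open>Summing over the exponent of one variable x amounts to substituting the fixed point
  x = z V / (1 - z b) of x = z (V + b x), where z = X y.\<close>

lemma diag_sum_geometric:
  fixes F :: "('k multiset \<Rightarrow>\<^sub>0 'b::comm_ring_1 fps) poly"
  assumes g: "g * (1 - fps_X * y * b) = 1"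
  shows "diag_sum y K (\<lambda>k. F * [:V, const_mp b:] ^ k)
       = g * mcoeff (poly F (const_mp (fps_X * y * g) * V)) K"
proof -
  let ?B = "[:V, const_mp b:]" and ?z = "fps_X * y"
  have deg: "coeff (?B ^ k) k = const_mp b ^ k" for k
  proof (induction k)
    case (Suc k)
    have "degree (?B ^ k) \<le> k" by (rule order.trans[OF degree_power_le]) auto
    then have "coeff (?B ^ k) (Suc k) = 0" by (intro coeff_eq_0) auto
    then show ?case using Suc by (simp add: mult_pCons_left)
  qed auto
  \<comment> \<open>For F = x G, one factor of \<open>?B\<close> is split off as V + b x. The sum
    for x G is thereby expressed through the sum for V G and through itself, a linear equation with
    coefficient z b.\<close>
  have step: "diag_sum y K (\<lambda>k. pCons 0 G * ?B ^ k) =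
     ?z * (diag_sum y K (\<lambda>k. smult V G * ?B ^ k) + b * diag_sum y K (\<lambda>k. pCons 0 G * ?B ^ k))" for G
  proof -
    have "diag_sum y K (\<lambda>k. pCons 0 G * ?B ^ k)
       = mcoeff (coeff (pCons 0 G * ?B ^ 0) 0) K
         + ?z * diag_sum y K (\<lambda>k. smult V G * ?B ^ k + [:const_mp b:] * (pCons 0 G * ?B ^ k))"
    proof (rule diag_sum_shift[where A = "\<lambda>_. 0"])
      fix k
      show "pCons 0 G * ?B ^ Suc k = 0 + [:0, 1:] * (smult V G * ?B ^ k + [:const_mp b:] * (pCons 0 G * ?B ^ k))"
        by (simp add: algebra_simps mult_pCons_left mult_pCons_right smult_add_right)
    qed auto
    then show ?thesis by (simp only: diag_sum_add diag_sum_const_mult) simp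
  qed
  \<comment> \<open>This is Lagrange inversion for the linear series V + b x: g is both the Jacobian
    factor and the denominator of the fixed point. Each step multiplies by V, so the induction on F
    needs the extra scalar W.\<close>
  have "diag_sum y K (\<lambda>k. smult W F * ?B ^ k)
       = g * mcoeff (W * poly F (const_mp (?z * g) * V)) K" for W
  proof (induction F arbitrary: W)
    case 0
    have "diag_sum y K (\<lambda>k. 0) = fps_total (\<lambda>k. 0 * 0)"
      by (simp add: diag_sum_def)
    also have "\<dots> = 0" by (simp only: fps_total_mult_left) simp
    finally show ?case by simp
  next
    case (pCons a F)
    have const: "diag_sum y K (\<lambda>k. [:c:] * ?B ^ k) = g * mcoeff c K" for c
    proof -
      let ?D = "diag_sum y K (\<lambda>k. [:c:] * ?B ^ k)"
      have pw: "const_mp b ^ k = const_mp (b ^ k)" for k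
        by (induction k) (auto simp: mult_single)
      have "coeff ([:c:] * ?B ^ k) k = const_mp (b ^ k) * c" for k
        by (simp add: deg pw mult.commute)
      then have "y ^ k * mcoeff (coeff ([:c:] * ?B ^ k) k) K = mcoeff c K * (y * b) ^ k" for k
        by (simp only: lookup_const_mult) (simp add: power_mult_distrib mult_ac)
      then have "?D = fps_total (\<lambda>k. mcoeff c K * (y * b) ^ k)"
        by (simp only: diag_sum_def)
      then have D: "?D = mcoeff c K * fps_total (\<lambda>k. (y * b) ^ k)"
        by (simp only: fps_total_mult_left)
      have "fps_total (\<lambda>k. (y * b) ^ k) = 1 + fps_X * fps_total (\<lambda>k. (y * b) * (y * b) ^ k)"
        by (subst fps_total_Suc) simp
      then have "fps_total (\<lambda>k. (y * b) ^ k) = 1 + fps_X * (y * b) * fps_total (\<lambda>k. (y * b) ^ k)"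
        by (simp only: fps_total_mult_left mult.assoc)
      then have "(1 - fps_X * y * b) * fps_total (\<lambda>k. (y * b) ^ k) = 1"
        by (simp add: algebra_simps)
      then have "fps_total (\<lambda>k. (y * b) ^ k) = g"
        using solve_unit[OF g, of "fps_total (\<lambda>k. (y * b) ^ k)" 1] by simp
      then show ?thesis using D by simp
    qed
    let ?v = "const_mp (?z * g) * V"
    let ?D = "diag_sum y K (\<lambda>k. pCons 0 (smult W F) * ?B ^ k)"
    have "?D = ?z * (g * mcoeff (V * W * poly F ?v) K + b * ?D)"
      by (subst step) (simp only: smult_smult pCons.IH)
    then have "(1 - ?z * b) * ?D = ?z * (g * mcoeff (V * W * poly F ?v) K)"
      by (simp add: algebra_simps)
    then have D: "?D = g * (?z * (g * mcoeff (V * W * poly F ?v) K))"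
      by (rule solve_unit[OF g])
    have "mcoeff (W * poly (pCons a F) ?v) K = mcoeff (W * a + const_mp (?z * g) * (V * W * poly F ?v)) K"
      by (simp add: algebra_simps)
    also have "\<dots> = mcoeff (W * a) K + ?z * g * mcoeff (V * W * poly F ?v) K"
      by (simp only: lookup_add lookup_const_mult)
    finally have e: "mcoeff (W * poly (pCons a F) ?v) K = mcoeff (W * a) K + ?z * g * mcoeff (V * W * poly F ?v) K" .
    have "smult W (pCons a F) * ?B ^ k = [:W * a:] * ?B ^ k + pCons 0 (smult W F) * ?B ^ k" for k
      by (simp add: smult_pCons distrib_right[symmetric] del: mult_pCons_left)
    then have "diag_sum y K (\<lambda>k. smult W (pCons a F) * ?B ^ k) = g * mcoeff (W * a) K + ?D"
      by (simp only: diag_sum_add const)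
    then show ?case unfolding e D by (simp add: algebra_simps)
  qed
  from this[of 1] show ?thesis by simp
qed

lemma peel_difference:
  fixes a :: "'c::comm_ring_1"
  shows "(a - u * x * v) * f - a * f = - u * x * (v * f)"
  by (simp add: algebra_simps)

text \<open>Write W, Q, T for the sums with B^k, \<open>rblock\<close> and \<open>block\<close>.
  Each recursion strips one letter x and so shifts the diagonal: Q - W = z (r Q - W) for the final
  run, and T = (1 - s z) Q for the forbidden first letter. Both refinements together cost only the
  factor (1 - z)(1 - s z) / (1 - r z).\<close>

lemma diag_sum_block:
  fixes F B :: "('k multiset \<Rightarrow>\<^sub>0 'b::comm_ring_1 fps) poly"
  shows "(1 - r * (fps_X * y)) * diag_sum y K (\<lambda>k. block [:const_mp r:] [:const_mp s:] [:0, 1:] B k * F)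
       = (1 - fps_X * y) * (1 - s * (fps_X * y)) * diag_sum y K (\<lambda>k. F * B ^ k)"
proof -
  let ?x = "[:0, 1:]" and ?z = "fps_X * y"
  let ?Q = "\<lambda>k. rblock [:const_mp r:] ?x B k * F"
  let ?T = "\<lambda>k. block [:const_mp r:] [:const_mp s:] ?x B k * F"
  let ?W = "diag_sum y K (\<lambda>k. F * B ^ k)"
  have "diag_sum y K (\<lambda>k. ?Q k - F * B ^ k)
      = mcoeff (coeff (?Q 0 - F * B ^ 0) 0) K + ?z * diag_sum y K (\<lambda>k. [:const_mp r:] * ?Q k - F * B ^ k)"
  proof (rule diag_sum_shift[where A = "\<lambda>_. 0"])
    fix k
    have "?Q (Suc k) - F * B ^ Suc k = ?x * ([:const_mp r:] * ?Q k - F * B ^ k)"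
      by (simp only: rblock.simps power_Suc) (simp only: algebra_simps)
    then show "?Q (Suc k) - F * B ^ Suc k = 0 + ?x * ([:const_mp r:] * ?Q k - F * B ^ k)"
      by (simp only: add_0)
  qed simp
  then have Q: "diag_sum y K ?Q - ?W = ?z * (r * diag_sum y K ?Q - ?W)"
    by (simp only: diag_sum_minus diag_sum_const_mult) simp
  have "diag_sum y K (\<lambda>k. ?T k - ?Q k)
      = mcoeff (coeff (?T 0 - ?Q 0) 0) K + ?z * diag_sum y K (\<lambda>k. [:const_mp (- s):] * ?Q k)"
  proof (rule diag_sum_shift[where A = "\<lambda>_. 0"])
    fix k
    have "?T (Suc k) - ?Q (Suc k) = - [:const_mp s:] * ?x * ?Q k"
      by (simp only: block.simps peel_difference)
    also have "- [:const_mp s:] = [:const_mp (- s):]"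
      by (simp add: single_uminus)
    also have "[:const_mp (- s):] * ?x * ?Q k = 0 + ?x * ([:const_mp (- s):] * ?Q k)"
      by (simp only: add_0 mult_ac)
    finally show "?T (Suc k) - ?Q (Suc k) = 0 + ?x * ([:const_mp (- s):] * ?Q k)" .
  qed simp
  then have T: "diag_sum y K ?T - diag_sum y K ?Q = ?z * (- s * diag_sum y K ?Q)"
    by (simp only: diag_sum_minus diag_sum_const_mult) simp
  from T have "diag_sum y K ?T = (1 - s * ?z) * diag_sum y K ?Q"
    by (simp add: algebra_simps)
  moreover from Q have "(1 - r * ?z) * diag_sum y K ?Q = (1 - ?z) * ?W"
    by (simp add: algebra_simps)
  ultimately show ?thesis by (simp only: mult.left_commute[of "1 - r * ?z"]) (simp only: mult_ac)
qed

section \<open>Eliminating the lowest level\<close>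

definition var_mp :: "nat \<Rightarrow> nat multiset \<Rightarrow>\<^sub>0 'c::comm_ring_1" where
  "var_mp d = Poly_Mapping.single {#d#} 1"

definition row :: "'c::comm_ring_1 \<Rightarrow> 'c \<Rightarrow> nat set \<Rightarrow> nat \<Rightarrow> nat multiset \<Rightarrow>\<^sub>0 'c" where
  "row s b S c = (\<Sum>d\<in>S. const_mp (if d < c then b - s else if d = c then b else b - 1) * var_mp d)"

text \<open>The head variable is summed innermost, so the least label of an increasing list is
  eliminated first.\<close>

fun content_sum :: "(nat \<Rightarrow> 'b::comm_ring_1 fps) \<Rightarrow> nat list \<Rightarrow> (nat multiset \<Rightarrow> 'b fps) \<Rightarrow> 'b fps" where
  "content_sum y [] f = f {#}"
| "content_sum y (c # cs) f =
     content_sum y cs (\<lambda>K. fps_total (\<lambda>k. y c ^ k * f (K + replicate_mset k c)))"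

lemma content_sum_cong:
  assumes "\<And>K. set_mset K \<subseteq> set cs \<Longrightarrow> f K = g K"
  shows "content_sum y cs f = content_sum y cs g"
  using assms
proof (induction cs arbitrary: f g)
  case (Cons c cs)
  have "f (K + replicate_mset k c) = g (K + replicate_mset k c)" if "set_mset K \<subseteq> set cs" for K k
    using that by (intro Cons.prems) (auto simp: in_replicate_mset)
  then show ?case by (auto intro!: Cons.IH)
qed simp

lemma content_sum_mult_left: "content_sum y cs (\<lambda>K. c * f K) = c * content_sum y cs f"
proof (induction cs arbitrary: f)
  case (Cons d cs)
  have "fps_total (\<lambda>k. y d ^ k * (c * f (K + replicate_mset k d)))
      = c * fps_total (\<lambda>k. y d ^ k * f (K + replicate_mset k d))" for K
    by (simp only: fps_total_mult_left[symmetric]) (simp only: mult_ac)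
  then show ?case by (simp add: Cons.IH)
qed simp

definition block_sum :: "(nat \<Rightarrow> 'b::comm_ring_1 fps) \<Rightarrow> 'b fps \<Rightarrow> 'b fps \<Rightarrow> 'b fps \<Rightarrow> nat list \<Rightarrow> 'b fps" where
  "block_sum y r s b cs = content_sum y cs (\<lambda>K. mcoeff
     (\<Prod>c\<in>set cs. block (const_mp r) (const_mp s) (var_mp c) (row s b (set cs) c) (count K c)) K)"

lemma row_insert_lower:
  assumes "c0 \<notin> S" "finite S" "\<And>c. c \<in> S \<Longrightarrow> c0 < c" "c \<in> S"
  shows "row s b (insert c0 S) c = row s b S c + const_mp (b - s) * var_mp c0"
  using assms by (simp add: row_def add.commute)

lemma row_insert_self:
  assumes "c0 \<notin> S" "finite S" "\<And>c. c \<in> S \<Longrightarrow> c0 < c"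
  shows "row s b (insert c0 S) c0 = const_mp (b - 1) * (\<Sum>d\<in>S. var_mp d) + const_mp b * var_mp c0"
proof -
  have "(\<Sum>d\<in>S. const_mp (if d < c0 then b - s else if d = c0 then b else b - 1) * var_mp d)
      = (\<Sum>d\<in>S. const_mp (b - 1) * var_mp d)"
    using assms by (intro sum.cong) (auto dest: less_asym)
  then show ?thesis using assms by (simp add: row_def sum_distrib_left add.commute)
qed

lemma row_shift:
  "row s b S c + const_mp e * (\<Sum>d\<in>S. var_mp d) = row s (b + e) S c"
proof -
  have e: "const_mp (if d < c then b - s else if d = c then b else b - 1) + const_mp e
      = const_mp (if d < c then b + e - s else if d = c then b + e else b + e - 1)" for d
    by (auto simp: single_add[symmetric] algebra_simps)
  then show ?thesis
    unfolding row_def sum_distrib_left sum.distrib[symmetric] distrib_right[symmetric]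
    by (simp only: e)
qed

lemma var_mp_free_of: "c \<noteq> d \<Longrightarrow> var_mp c \<in> free_of d"
  by (simp add: var_mp_def free_of_single)

lemma const_mp_free_of: "const_mp c \<in> free_of d"
  by (simp add: free_of_single)

text \<open>The row of c0 is V + b x_c0 with V = (b - 1) times the sum of the other variables.
  Summing over the exponent of x_c0 substitutes z g V for x_c0 in the other rows, where its
  coefficient is b - s because c0 is the lowest label. This adds z g (b - 1)(b - s) to every
  coefficient there.\<close>

lemma block_sum_Cons:
  assumes lower: "\<And>c. c \<in> set cs \<Longrightarrow> c0 < c"
    and g: "g * (1 - fps_X * y c0 * b) = 1"
  defines "z \<equiv> fps_X * y c0"
  shows "(1 - r * z) * block_sum y r s b (c0 # cs)
    = (1 - z) * (1 - s * z) * g * block_sum y r s (b + z * g * (b - 1) * (b - s)) cs"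
proof -
  define S where "S = set cs"
  have c0: "c0 \<notin> S" and fin: "finite S" using lower by (auto simp: S_def)
  define b' where "b' = b + z * g * (b - 1) * (b - s)"
  let ?V = "const_mp (b - 1) * (\<Sum>d\<in>S. var_mp d)"
  define B where "B = [:?V, const_mp b:]"
  define F where "F K = (\<Prod>c\<in>S. block [:const_mp r:] [:const_mp s:] [:var_mp c:]
      [:row s b S c, const_mp (b - s):] (count K c))" for K
  let ?G = "\<lambda>K k. block [:const_mp r:] [:const_mp s:] [:0, 1:] B k * F K"
  have Vfree: "?V \<in> free_of c0"
    using c0 by (intro free_of_mult const_mp_free_of free_of_sum var_mp_free_of) auto
  have rowfree: "row s b S c \<in> free_of c0" for c
    unfolding row_def using c0 by (intro free_of_sum free_of_mult const_mp_free_of var_mp_free_of) auto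
  have Gfree: "?G K k \<in> coeffs_free_of c0" for K k
    unfolding F_def B_def using c0
    by (intro coeffs_free_of_mult coeffs_free_of_prod coeffs_free_of_block coeffs_free_of_pCons
        coeffs_free_of_0 const_mp_free_of var_mp_free_of rowfree Vfree zero_free_of one_free_of) auto
  have inner: "(1 - r * z) * fps_total (\<lambda>k. y c0 ^ k * mcoeff
      (\<Prod>c\<in>set (c0 # cs). block (const_mp r) (const_mp s) (var_mp c) (row s b (set (c0 # cs)) c)
         (count (K + replicate_mset k c0) c)) (K + replicate_mset k c0))
    = (1 - z) * (1 - s * z) * g * mcoeff
      (\<Prod>c\<in>S. block (const_mp r) (const_mp s) (var_mp c) (row s b' S c) (count K c)) K"
    if K: "set_mset K \<subseteq> S" for K
  proof -
    have c0K: "c0 \<notin># K" using K c0 by auto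
    have "mcoeff (\<Prod>c\<in>set (c0 # cs). block (const_mp r) (const_mp s) (var_mp c)
         (row s b (set (c0 # cs)) c) (count (K + replicate_mset k c0) c)) (K + replicate_mset k c0)
        = mcoeff (coeff (?G K k) k) K" for k
    proof -
      have "(\<Prod>c\<in>S. block (const_mp r) (const_mp s) (var_mp c) (row s b (insert c0 S) c)
               (count (K + replicate_mset k c0) c)) = poly (F K) (var_mp c0)"
        unfolding F_def poly_prod
      proof (intro prod.cong refl)
        fix c assume "c \<in> S"
        then show "block (const_mp r) (const_mp s) (var_mp c) (row s b (insert c0 S) c) (count (K + replicate_mset k c0) c)
          = poly (block [:const_mp r:] [:const_mp s:] [:var_mp c:] [:row s b S c, const_mp (b - s):] (count K c)) (var_mp c0)"
          using c0 fin lower by (auto simp: poly_block row_insert_lower S_def mult.commute)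
      qed
      moreover have "count K c0 = 0" using c0K by (simp add: count_eq_zero_iff)
      ultimately have "(\<Prod>c\<in>set (c0 # cs). block (const_mp r) (const_mp s) (var_mp c)
         (row s b (set (c0 # cs)) c) (count (K + replicate_mset k c0) c)) = poly (?G K k) (var_mp c0)"
        using c0 fin lower
        by (simp add: poly_block B_def S_def[symmetric] row_insert_self mult.commute)
      then show ?thesis
        using lookup_poly_variable[OF Gfree c0K] by (simp add: var_mp_def)
    qed
    then have "fps_total (\<lambda>k. y c0 ^ k * mcoeff
      (\<Prod>c\<in>set (c0 # cs). block (const_mp r) (const_mp s) (var_mp c) (row s b (set (c0 # cs)) c)
         (count (K + replicate_mset k c0) c)) (K + replicate_mset k c0)) = diag_sum (y c0) K (?G K)"
      by (simp only: diag_sum_def)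
    moreover have "(1 - r * z) * diag_sum (y c0) K (?G K)
       = (1 - z) * (1 - s * z) * (g * mcoeff (poly (F K) (const_mp (z * g) * ?V)) K)"
      using diag_sum_block[of r "y c0" K s B "F K"] diag_sum_geometric[OF g, of K "F K" ?V]
      by (simp only: z_def B_def)
    moreover have "poly (F K) (const_mp (z * g) * ?V)
      = (\<Prod>c\<in>S. block (const_mp r) (const_mp s) (var_mp c) (row s b' S c) (count K c))"
      unfolding F_def poly_prod
    proof (intro prod.cong refl)
      fix c
      have "row s b S c + const_mp (z * g) * ?V * const_mp (b - s)
        = row s b S c + const_mp (z * g * (b - 1) * (b - s)) * (\<Sum>d\<in>S. var_mp d)"
      proof -
        have "const_mp (z * g * (b - 1) * (b - s)) = const_mp (z * g) * const_mp (b - 1) * (const_mp (b - s) :: nat multiset \<Rightarrow>\<^sub>0 _)"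
          by (simp add: mult_single)
        then show ?thesis by (simp only: mult_ac)
      qed
      also have "\<dots> = row s b' S c" by (simp add: row_shift b'_def)
      finally show "poly (block [:const_mp r:] [:const_mp s:] [:var_mp c:] [:row s b S c, const_mp (b - s):] (count K c)) (const_mp (z * g) * ?V)
         = block (const_mp r) (const_mp s) (var_mp c) (row s b' S c) (count K c)"
        by (simp add: poly_block)
    qed
    ultimately show ?thesis by (simp only: mult.assoc)
  qed
  have "(1 - r * z) * block_sum y r s b (c0 # cs) = content_sum y cs (\<lambda>K. (1 - r * z) * fps_total (\<lambda>k. y c0 ^ k * mcoeff
      (\<Prod>c\<in>set (c0 # cs). block (const_mp r) (const_mp s) (var_mp c) (row s b (set (c0 # cs)) c)
         (count (K + replicate_mset k c0) c)) (K + replicate_mset k c0)))"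
    by (simp only: block_sum_def content_sum.simps content_sum_mult_left)
  also have "\<dots> = content_sum y cs (\<lambda>K. (1 - z) * (1 - s * z) * g * mcoeff
      (\<Prod>c\<in>S. block (const_mp r) (const_mp s) (var_mp c) (row s b' S c) (count K c)) K)"
    by (rule content_sum_cong) (simp only: inner S_def)
  also have "\<dots> = (1 - z) * (1 - s * z) * g * block_sum y r s b' cs"
    by (simp only: block_sum_def content_sum_mult_left S_def)
  finally show ?thesis by (simp only: b'_def)
qed

section \<open>Closed form for finitely many labels\<close>

definition lin_prod :: "(nat \<Rightarrow> 'b::comm_ring_1 fps) \<Rightarrow> 'b fps \<Rightarrow> nat list \<Rightarrow> 'b fps" where
  "lin_prod y a cs = (\<Prod>c\<leftarrow>cs. 1 - a * (fps_X * y c))"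

text \<open>A division-free substitute for (lin_prod y 1 cs - lin_prod y s cs) / (1 - s).\<close>

fun lin_quot :: "(nat \<Rightarrow> 'b::comm_ring_1 fps) \<Rightarrow> 'b fps \<Rightarrow> nat list \<Rightarrow> 'b fps" where
  "lin_quot y s [] = 0"
| "lin_quot y s (c # cs) = (1 - fps_X * y c) * lin_quot y s cs - fps_X * y c * lin_prod y s cs"

lemma lin_quot: "(1 - s) * lin_quot y s cs = lin_prod y 1 cs - lin_prod y s cs"
proof (induction cs)
  case (Cons c cs)
  have cons: "lin_prod y a (c # cs) = (1 - a * (fps_X * y c)) * lin_prod y a cs" for a
    by (simp add: lin_prod_def)
  have "(1 - s) * lin_quot y s (c # cs)
      = (1 - fps_X * y c) * ((1 - s) * lin_quot y s cs) - (1 - s) * (fps_X * y c * lin_prod y s cs)"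
    by (simp add: algebra_simps)
  also have "\<dots> = (1 - fps_X * y c) * lin_prod y 1 cs - (1 - s * (fps_X * y c)) * lin_prod y s cs"
    unfolding Cons.IH by (simp add: algebra_simps)
  finally show ?case unfolding cons by simp
qed (simp add: lin_prod_def)

lemma fps_unit_ex:
  fixes f :: "'b::comm_ring_1 fps"
  shows "\<exists>g. g * (1 - fps_X * f) = 1"
  using fps_right_inverse[of "1 - fps_X * f" 1]
  by (intro exI[of _ "fps_right_inverse (1 - fps_X * f) 1"]) (simp add: mult.commute)

text \<open>One elimination changes b by a Moebius map fixing 1 and s: b' - 1 = (b - 1)(1 - s z) /
  (1 - z b) and b' - s = (b - s)(1 - z) / (1 - z b). This is why the iteration is explicit. Where 1
  - s is invertible, the bracket equals ((b - s) P - (b - 1) Q) / (1 - s), with P and Q the products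
  for a = 1 and a = s.\<close>

lemma block_sum_closed_form:
  assumes "sorted_wrt (<) cs"
  shows "block_sum y r s b cs * lin_prod y r cs * (lin_prod y 1 cs + (b - 1) * lin_quot y s cs)
       = lin_prod y 1 cs * lin_prod y s cs"
  using assms
proof (induction cs arbitrary: b)
  case Nil
  then show ?case by (simp add: block_sum_def lin_prod_def)
next
  case (Cons c cs)
  define z where "z = fps_X * y c"
  obtain g where g: "g * (1 - z * b) = 1"
    using fps_unit_ex[of "y c * b"] by (auto simp: z_def mult.assoc)
  define b' where "b' = b + z * g * (b - 1) * (b - s)"
  define P Q R T where "P = lin_prod y 1 cs" and "Q = lin_prod y s cs" and "R = lin_quot y s cs"
    and "T = lin_prod y r cs"
  have PQ: "P = Q + (1 - s) * R"
    using lin_quot[of s y cs] by (simp add: P_def Q_def R_def algebra_simps)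
  have cons: "lin_prod y a (c # cs) = (1 - a * z) * lin_prod y a cs" for a
    by (simp add: lin_prod_def z_def)
  have quot: "lin_quot y s (c # cs) = (1 - z) * R - z * Q"
    by (simp add: R_def Q_def z_def)
  have step: "(1 - r * z) * block_sum y r s b (c # cs) = (1 - z) * (1 - s * z) * g * block_sum y r s b' cs"
    using Cons.prems g by (simp only: z_def b'_def) (intro block_sum_Cons, auto)
  have IH: "block_sum y r s b' cs * T * (P + (b' - 1) * R) = P * Q"
    using Cons.IH[of b'] Cons.prems by (simp add: P_def Q_def R_def T_def)
  \<comment> \<open>The old and new denominators differ exactly by the factor 1 - z b, which
    \<open>g\<close> from \<open>step\<close> cancels.\<close>
  have den: "(1 - z) * P + (b - 1) * ((1 - z) * R - z * Q) = (1 - z * b) * (P + (b' - 1) * R)"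
  proof -
    have "(1 - z * b) * (b' - 1) = (1 - z * b) * (b - 1) + (g * (1 - z * b)) * (z * (b - 1) * (b - s))"
      by (simp add: b'_def algebra_simps)
    also have "\<dots> = (b - 1) * (1 - s * z)"
      unfolding g by (simp add: algebra_simps)
    finally have "(1 - z * b) * (P + (b' - 1) * R) = (1 - z * b) * P + (b - 1) * (1 - s * z) * R"
      by (simp add: distrib_left mult.assoc[symmetric])
    then show ?thesis unfolding PQ by (simp add: algebra_simps)
  qed
  have "block_sum y r s b (c # cs) * lin_prod y r (c # cs) * (lin_prod y 1 (c # cs) + (b - 1) * lin_quot y s (c # cs))
      = ((1 - r * z) * block_sum y r s b (c # cs)) * T * ((1 - z) * P + (b - 1) * ((1 - z) * R - z * Q))"
    unfolding cons quot P_def[symmetric] T_def[symmetric] by (simp only: mult_ac mult_1_left)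
  also have "\<dots> = (1 - z) * (1 - s * z) * (g * (1 - z * b)) * (block_sum y r s b' cs * T * (P + (b' - 1) * R))"
    unfolding step den by (simp only: mult_ac)
  also have "\<dots> = lin_prod y 1 (c # cs) * lin_prod y s (c # cs)"
    unfolding g IH cons P_def[symmetric] Q_def[symmetric] by (simp only: mult_ac mult_1_left)
  finally show ?case .
qed
section \<open>Words split into blocks\<close>

definition words :: "'x set \<Rightarrow> nat \<Rightarrow> 'x list set" where
  "words A k = {w. set w \<subseteq> A \<and> length w = k}"

lemma finite_words: "finite A \<Longrightarrow> finite (words A k)"
  by (simp add: words_def finite_lists_length_eq)

lemma words_0: "words A 0 = {[]}"
  by (auto simp: words_def)

lemma sum_words_Cons:
  "(\<Sum>w\<in>words A (Suc k). f w) = (\<Sum>x\<in>A. \<Sum>w\<in>words A k. f (x # w))"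
proof -
  have "(\<Sum>w\<in>words A (Suc k). f w) = (\<Sum>(x, w)\<in>A \<times> words A k. f (x # w))"
    by (rule sum.reindex_bij_witness[where j = "\<lambda>w. (hd w, tl w)" and i = "\<lambda>(x, w). x # w"])
       (auto simp: words_def length_Suc_conv)
  then show ?thesis by (simp add: sum.cartesian_product)
qed

lemma sum_words_snoc:
  fixes A :: "'x set"
  shows "(\<Sum>w\<in>words A (Suc k). f w) = (\<Sum>w\<in>words A k. \<Sum>x\<in>A. f (w @ [x]))"
proof -
  have "(\<Sum>w\<in>words A (Suc k). f w) = (\<Sum>(w, x)\<in>words A k \<times> A. f (w @ [x]))"
  proof -
    have id: "butlast a @ [last a] = a" if "length a = Suc k" for a :: "'x list"
      using that by (cases a rule: rev_cases) auto
    show ?thesis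
    proof (rule sum.reindex_bij_witness[where j = "\<lambda>w. (butlast w, last w)" and i = "\<lambda>(w, x). w @ [x]"])
    fix w assume "w \<in> words A (Suc k)"
    then have "w \<noteq> []" "set w \<subseteq> A" "length w = Suc k" by (auto simp: words_def)
    then show "(butlast w, last w) \<in> words A k \<times> A"
      by (auto simp: words_def in_set_butlastD)
    qed (auto simp: words_def id)
  qed
  then show ?thesis by (simp add: sum.cartesian_product)
qed

lemma sum_words_append:
  "(\<Sum>w\<in>words A (j + k). f w) = (\<Sum>u\<in>words A j. \<Sum>v\<in>words A k. f (u @ v))"
proof -
  have "(\<Sum>w\<in>words A (j + k). f w) = (\<Sum>(u, v)\<in>words A j \<times> words A k. f (u @ v))"
  proof (rule sum.reindex_bij_witness[where j = "\<lambda>w. (take j w, drop j w)" and i = "\<lambda>(u, v). u @ v"])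
    fix w assume "w \<in> words A (j + k)"
    then show "(take j w, drop j w) \<in> words A j \<times> words A k"
      using set_take_subset[of j w] set_drop_subset[of j w] by (auto simp: words_def)
  qed (auto simp: words_def)
  then show ?thesis by (simp add: sum.cartesian_product)
qed

lemma sum_words_prod_list:
  fixes f :: "'x \<Rightarrow> 'c::comm_ring_1"
  shows "(\<Sum>w\<in>words A k. \<Prod>x\<leftarrow>w. f x) = (\<Sum>x\<in>A. f x) ^ k"
  by (induction k) (auto simp: words_0 sum_words_Cons sum_distrib_left[symmetric] sum_distrib_right[symmetric])

text \<open>Here c is the label of the block of the sorted word in which the letter x stands. Blocks
  are in decreasing order of labels, so a letter with smaller label stands before its own block: it
  will be sorted to a later place, is no excedance and cannot have colour l. One with larger label
  moves to an earlier place, so colour 0 would be an unmarked excedance.\<close>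

definition allowed :: "nat \<Rightarrow> nat \<Rightarrow> nat \<times> nat \<Rightarrow> bool" where
  "allowed l c x \<longleftrightarrow> \<not> (fst x < c \<and> snd x = l) \<and> \<not> (c < fst x \<and> snd x = 0)"

definition tail_len :: "nat \<Rightarrow> (nat \<times> nat) list \<Rightarrow> nat" where
  "tail_len c ws = length (takeWhile (\<lambda>x. x = (c, 0)) (rev ws))"

definition block_ok :: "nat \<Rightarrow> nat \<Rightarrow> (nat \<times> nat) list \<Rightarrow> bool" where
  "block_ok l c ws \<longleftrightarrow> (\<forall>x\<in>set ws. allowed l c x) \<and> (ws \<noteq> [] \<longrightarrow> hd ws \<noteq> (c, l))"

definition block_weight :: "'c::comm_ring_1 \<Rightarrow> 'c \<Rightarrow> nat \<Rightarrow> nat \<Rightarrow> (nat \<times> nat) list \<Rightarrow> 'c" where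
  "block_weight t r l c ws = (if block_ok l c ws then t ^ sum_list (map snd ws) * r ^ tail_len c ws else 0)"

definition letter_mp :: "'c::comm_ring_1 \<Rightarrow> nat \<Rightarrow> nat \<Rightarrow> nat \<times> nat \<Rightarrow> nat multiset \<Rightarrow>\<^sub>0 'c" where
  "letter_mp t l c x = Poly_Mapping.single {#fst x#} (if allowed l c x then t ^ snd x else 0)"

lemma prod_list_letter_mp:
  "(\<Prod>x\<leftarrow>ws. letter_mp t l c x)
   = Poly_Mapping.single (mset (map fst ws)) (if \<forall>x\<in>set ws. allowed l c x then t ^ sum_list (map snd ws) else 0)"
  by (induction ws) (auto simp: letter_mp_def mult_single power_add)

lemma sum_letter_mp:
  assumes "l \<ge> 1"
  shows "(\<Sum>x\<in>{..<m} \<times> {..l}. letter_mp t l c x) = row (t ^ l) (\<Sum>f\<le>l. t ^ f) {..<m} c"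
proof -
  have "(\<Sum>f\<le>l. letter_mp t l c (d, f)) = const_mp (if d < c then (\<Sum>f\<le>l. t ^ f) - t ^ l
      else if d = c then \<Sum>f\<le>l. t ^ f else (\<Sum>f\<le>l. t ^ f) - 1) * var_mp d" for d
  proof -
    have "(\<Sum>f\<le>l. letter_mp t l c (d, f)) = Poly_Mapping.single {#d#} (\<Sum>f\<le>l. if allowed l c (d, f) then t ^ f else 0)"
    proof -
      have "Poly_Mapping.single K (sum g I) = (\<Sum>i\<in>I. Poly_Mapping.single K (g i))"
        for K :: "nat multiset" and g :: "nat \<Rightarrow> 'a" and I
        by (induction I rule: infinite_finite_induct) (auto simp: single_add)
      then show ?thesis by (simp add: letter_mp_def cong: if_cong)
    qed
    moreover have "(\<Sum>f\<le>l. if allowed l c (d, f) then t ^ f else 0) = (if d < c then (\<Sum>f\<le>l. t ^ f) - t ^ l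
      else if d = c then \<Sum>f\<le>l. t ^ f else (\<Sum>f\<le>l. t ^ f) - 1)"
    proof -
      consider "d < c" | "d = c" | "c < d" by linarith
      then show ?thesis
      proof cases
        case 1
        have "(\<Sum>f\<le>l. if allowed l c (d, f) then t ^ f else 0) = (\<Sum>f\<in>{..l} - {l}. t ^ f)"
          using 1 by (intro sum.mono_neutral_cong_right) (auto simp: allowed_def)
        then show ?thesis using 1 by (simp add: sum_diff)
      next
        case 2 then show ?thesis by (simp add: allowed_def)
      next
        case 3
        have "(\<Sum>f\<le>l. if allowed l c (d, f) then t ^ f else 0) = (\<Sum>f\<in>{..l} - {0}. t ^ f)"
          using 3 by (intro sum.mono_neutral_cong_right) (auto simp: allowed_def)
        then show ?thesis using 3 by (simp add: sum_diff)
      qed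
    qed
    ultimately show ?thesis by (simp add: var_mp_def mult_single)
  qed
  then show ?thesis by (simp add: sum.cartesian_product' row_def)
qed

lemma tail_len_snoc: "tail_len c (ws @ [x]) = (if x = (c, 0) then Suc (tail_len c ws) else 0)"
  by (simp add: tail_len_def)

lemma tail_len_Cons_other: "x \<noteq> (c, 0) \<Longrightarrow> tail_len c (x # ws) = tail_len c ws"
  by (simp add: tail_len_def takeWhile_tail)

text \<open>Induction on the last letter: (c, 0) lengthens the final run, and any other letter
  resets it, leaving a prefix without run weight.\<close>

lemma sum_words_rblock:
  assumes "l \<ge> 1" "c < m"
  shows "(\<Sum>ws\<in>words ({..<m} \<times> {..l}) k. (\<Prod>x\<leftarrow>ws. letter_mp t l c x) * const_mp (r ^ tail_len c ws))
       = rblock (const_mp r) (var_mp c) (row (t ^ l) (\<Sum>f\<le>l. t ^ f) {..<m} c) k"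
proof (induction k)
  case 0
  then show ?case by (simp add: words_0 tail_len_def)
next
  case (Suc k)
  let ?A = "{..<m} \<times> {..l}"
  let ?row = "row (t ^ l) (\<Sum>f\<le>l. t ^ f) {..<m} c"
  have c0: "(c, 0) \<in> ?A" using assms by simp
  have L0: "letter_mp t l c (c, 0) = var_mp c"
    using assms by (simp add: letter_mp_def allowed_def var_mp_def)
  have rest: "(\<Sum>x\<in>?A - {(c, 0)}. letter_mp t l c x) = ?row - var_mp c"
    using c0 by (simp add: sum_diff sum_letter_mp[OF assms(1)] L0)
  have "(\<Sum>ws\<in>words ?A (Suc k). (\<Prod>x\<leftarrow>ws. letter_mp t l c x) * const_mp (r ^ tail_len c ws))
     = (\<Sum>ws\<in>words ?A k. const_mp r * var_mp c * ((\<Prod>x\<leftarrow>ws. letter_mp t l c x) * const_mp (r ^ tail_len c ws))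
          + (\<Prod>x\<leftarrow>ws. letter_mp t l c x) * (?row - var_mp c))"
    unfolding sum_words_snoc
  proof (intro sum.cong refl)
    fix ws
    have "const_mp (r ^ Suc (tail_len c ws)) = const_mp r * (const_mp (r ^ tail_len c ws) :: nat multiset \<Rightarrow>\<^sub>0 _)"
      by (simp add: mult_single)
    moreover have "(\<Sum>x\<in>?A. (\<Prod>x\<leftarrow>ws @ [x]. letter_mp t l c x) * const_mp (r ^ tail_len c (ws @ [x])))
      = (\<Prod>x\<leftarrow>ws. letter_mp t l c x) * var_mp c * const_mp (r ^ Suc (tail_len c ws))
        + (\<Sum>x\<in>?A - {(c, 0)}. (\<Prod>x\<leftarrow>ws. letter_mp t l c x) * letter_mp t l c x)"
      using c0 by (subst sum.remove[of _ "(c, 0)"]) (auto simp: tail_len_snoc L0 intro!: sum.cong)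
    ultimately show "(\<Sum>x\<in>?A. (\<Prod>x\<leftarrow>ws @ [x]. letter_mp t l c x) * const_mp (r ^ tail_len c (ws @ [x])))
      = const_mp r * var_mp c * ((\<Prod>x\<leftarrow>ws. letter_mp t l c x) * const_mp (r ^ tail_len c ws))
          + (\<Prod>x\<leftarrow>ws. letter_mp t l c x) * (?row - var_mp c)"
      by (simp only: sum_distrib_left[symmetric] rest) (simp only: mult_ac)
  qed
  also have "\<dots> = const_mp r * var_mp c * rblock (const_mp r) (var_mp c) ?row k + ?row ^ k * (?row - var_mp c)"
    unfolding sum.distrib sum_distrib_left[symmetric] sum_distrib_right[symmetric] Suc.IH sum_words_prod_list
      sum_letter_mp[OF assms(1)] ..
  finally show ?case by (simp add: mult.commute)
qed

text \<open>Since l \<ge> 1, a leading (c, l) is never part of the final run. The excluded words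
  therefore contribute s x_c times the polynomial of the words shorter by one.\<close>

lemma sum_words_block:
  assumes "l \<ge> 1" "c < m"
  shows "(\<Sum>ws\<in>words ({..<m} \<times> {..l}) k. Poly_Mapping.single (mset (map fst ws)) (block_weight t r l c ws))
       = block (const_mp r) (const_mp (t ^ l)) (var_mp c) (row (t ^ l) (\<Sum>f\<le>l. t ^ f) {..<m} c) k"
proof (cases k)
  case 0
  then show ?thesis by (simp add: words_0 block_weight_def block_ok_def tail_len_def)
next
  case (Suc k')
  let ?A = "{..<m} \<times> {..l}"
  let ?row = "row (t ^ l) (\<Sum>f\<le>l. t ^ f) {..<m} c"
  let ?g = "\<lambda>ws. (\<Prod>x\<leftarrow>ws. letter_mp t l c x) * const_mp (r ^ tail_len c ws)"
  let ?h = "\<lambda>ws. Poly_Mapping.single (mset (map fst ws)) (block_weight t r l c ws)"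
  have cl: "(c, l) \<in> ?A" and ne: "(c, l) \<noteq> (c, 0)" using assms by auto
  have L: "letter_mp t l c (c, l) = const_mp (t ^ l) * var_mp c"
    by (simp add: letter_mp_def allowed_def var_mp_def mult_single)
  have h: "?h (x # ws) = (if x = (c, l) then 0 else ?g (x # ws))" for x ws
    by (auto simp only: prod_list_letter_mp mult_single)
       (auto simp: block_weight_def block_ok_def)
  have g: "?g ((c, l) # ws) = const_mp (t ^ l) * var_mp c * ?g ws" for ws
    by (simp add: tail_len_Cons_other[OF ne] L mult_ac)
  have "(\<Sum>ws\<in>words ?A k. ?h ws) = (\<Sum>x\<in>?A. \<Sum>ws\<in>words ?A k'. if x = (c, l) then 0 else ?g (x # ws))"
    unfolding Suc sum_words_Cons by (simp only: h)
  also have "\<dots> = (\<Sum>x\<in>?A - {(c, l)}. \<Sum>ws\<in>words ?A k'. ?g (x # ws))"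
    by (rule sum.mono_neutral_cong_right) auto
  also have "\<dots> = (\<Sum>ws\<in>words ?A (Suc k'). ?g ws) - (\<Sum>ws\<in>words ?A k'. ?g ((c, l) # ws))"
    unfolding sum_words_Cons using cl by (simp add: sum_diff)
  also have "\<dots> = rblock (const_mp r) (var_mp c) ?row (Suc k')
      - const_mp (t ^ l) * var_mp c * rblock (const_mp r) (var_mp c) ?row k'"
    unfolding sum_words_rblock[OF assms] g sum_distrib_left[symmetric] ..
  finally show ?thesis unfolding Suc block.simps .
qed

text \<open>\<open>N c\<close> is the length of block c. The sorted word begins with the largest
  label, so blocks are cut off from label m - 1 downwards.\<close>

fun level_weight :: "'c::comm_ring_1 \<Rightarrow> 'c \<Rightarrow> nat \<Rightarrow> (nat \<Rightarrow> nat) \<Rightarrow> nat \<Rightarrow> (nat \<times> nat) list \<Rightarrow> 'c" where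
  "level_weight t r l N 0 w = 1"
| "level_weight t r l N (Suc m) w
     = block_weight t r l m (take (N m) w) * level_weight t r l N m (drop (N m) w)"

lemma sum_words_level_weight:
  assumes "l \<ge> 1" "m \<le> M"
  shows "(\<Sum>w\<in>words ({..<M} \<times> {..l}) (\<Sum>c<m. N c). Poly_Mapping.single (mset (map fst w)) (level_weight t r l N m w))
    = (\<Prod>c<m. block (const_mp r) (const_mp (t ^ l)) (var_mp c) (row (t ^ l) (\<Sum>f\<le>l. t ^ f) {..<M} c) (N c))"
  using assms(2)
proof (induction m)
  case 0
  then show ?case by (simp add: words_0)
next
  case (Suc m)
  let ?A = "{..<M} \<times> {..l}"
  let ?S = "\<lambda>w. Poly_Mapping.single (mset (map fst w))"
  have "(\<Sum>w\<in>words ?A (\<Sum>c<Suc m. N c). ?S w (level_weight t r l N (Suc m) w))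
     = (\<Sum>u\<in>words ?A (N m). \<Sum>v\<in>words ?A (\<Sum>c<m. N c). ?S (u @ v) (level_weight t r l N (Suc m) (u @ v)))"
    by (simp only: sum.lessThan_Suc add.commute[of _ "N m"] sum_words_append)
  also have "\<dots> = (\<Sum>u\<in>words ?A (N m). \<Sum>v\<in>words ?A (\<Sum>c<m. N c).
      ?S u (block_weight t r l m u) * ?S v (level_weight t r l N m v))"
    by (intro sum.cong refl) (auto simp: words_def mult_single)
  also have "\<dots> = (\<Sum>u\<in>words ?A (N m). ?S u (block_weight t r l m u))
       * (\<Sum>v\<in>words ?A (\<Sum>c<m. N c). ?S v (level_weight t r l N m v))"
    by (simp only: sum_product)
  also have "(\<Sum>u\<in>words ?A (N m). ?S u (block_weight t r l m u))
     = block (const_mp r) (const_mp (t ^ l)) (var_mp m) (row (t ^ l) (\<Sum>f\<le>l. t ^ f) {..<M} m) (N m)"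
    using Suc.prems by (intro sum_words_block assms(1)) auto
  finally show ?case using Suc by (simp add: mult.commute)
qed

text \<open>The exponents of the rows and of the extracted monomial are the same K, the diagonal
  condition of the Master Theorem: the word rearranges the sorted word whose blocks it is compared
  with.\<close>

lemma mcoeff_block_prod:
  assumes "l \<ge> 1" "set_mset K \<subseteq> {..<m}"
  shows "mcoeff (\<Prod>c<m. block (const_mp r) (const_mp (t ^ l)) (var_mp c)
            (row (t ^ l) (\<Sum>f\<le>l. t ^ f) {..<m} c) (count K c)) K
    = (\<Sum>w | w \<in> words ({..<m} \<times> {..l}) (size K) \<and> mset (map fst w) = K. level_weight t r l (count K) m w)"
proof -
  let ?W = "words ({..<m} \<times> {..l}) (size K)"
  have "size K = (\<Sum>c<m. count K c)"
    unfolding size_multiset_overloaded_eq using assms(2)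
    by (intro sum.mono_neutral_left) (auto simp: count_eq_zero_iff)
  then have "mcoeff (\<Prod>c<m. block (const_mp r) (const_mp (t ^ l)) (var_mp c)
            (row (t ^ l) (\<Sum>f\<le>l. t ^ f) {..<m} c) (count K c)) K
     = (\<Sum>w\<in>?W. mcoeff (Poly_Mapping.single (mset (map fst w)) (level_weight t r l (count K) m w)) K)"
    by (simp add: sum_words_level_weight[OF assms(1) order.refl, symmetric] lookup_sum)
  also have "\<dots> = (\<Sum>w\<in>?W. if mset (map fst w) = K then level_weight t r l (count K) m w else 0)"
    by (intro sum.cong refl) (simp add: lookup_single when_def)
  also have "\<dots> = (\<Sum>w | w \<in> ?W \<and> mset (map fst w) = K. level_weight t r l (count K) m w)"
    by (subst sum.inter_filter[symmetric]) (auto simp: finite_words)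
  finally show ?thesis .
qed

section \<open>From blocks to positions\<close>

definition level_above :: "(nat \<times> nat) list \<Rightarrow> nat \<Rightarrow> nat" where
  "level_above w c = card {v. v < length w \<and> c < fst (w ! v)}"

definition upto_level :: "(nat \<times> nat) list \<Rightarrow> nat \<Rightarrow> nat" where
  "upto_level w c = card {v. v < length w \<and> c \<le> fst (w ! v)}"

text \<open>Translates the condition that letters of colour l are excedances of the associated permutation
  and letters of colour 0 are not.\<close>

definition word_ok :: "nat \<Rightarrow> (nat \<times> nat) list \<Rightarrow> bool" where
  "word_ok l w \<longleftrightarrow> (\<forall>v<length w. (snd (w ! v) = l \<longrightarrow> level_above w (fst (w ! v)) < v)
     \<and> (snd (w ! v) = 0 \<longrightarrow> v < upto_level w (fst (w ! v))))"

definition word_fix :: "(nat \<times> nat) list \<Rightarrow> nat" where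
  "word_fix w = card {v. v < length w \<and> snd (w ! v) = 0
     \<and> (\<forall>u. v \<le> u \<and> u < upto_level w (fst (w ! v)) \<longrightarrow> w ! u = w ! v)}"

definition block_start :: "(nat \<Rightarrow> nat) \<Rightarrow> nat \<Rightarrow> nat \<Rightarrow> nat" where
  "block_start N m c = (\<Sum>d\<in>{c<..<m}. N d)"

definition block_at :: "(nat \<Rightarrow> nat) \<Rightarrow> nat \<Rightarrow> nat \<Rightarrow> 'x list \<Rightarrow> 'x list" where
  "block_at N m c w = take (N c) (drop (block_start N m c) w)"

lemma block_start_Suc: "c < m \<Longrightarrow> block_start N (Suc m) c = N m + block_start N m c"
proof -
  assume "c < m"
  then have "{c<..<Suc m} = insert m {c<..<m}" by auto
  then show ?thesis by (simp add: block_start_def)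
qed

lemma block_start_self: "block_start N (Suc m) m = 0"
  by (simp add: block_start_def)

lemma block_at_Suc: "c < m \<Longrightarrow> block_at N (Suc m) c w = block_at N m c (drop (N m) w)"
  by (simp add: block_at_def block_start_Suc add.commute)

lemma block_at_self: "block_at N (Suc m) m w = take (N m) w"
  by (simp add: block_at_def block_start_self)

lemma level_weight_prod:
  "level_weight t r l N m w = (\<Prod>c<m. block_weight t r l c (block_at N m c w))"
proof (induction m arbitrary: w)
  case (Suc m)
  have "(\<Prod>c<m. block_weight t r l c (block_at N m c (drop (N m) w)))
      = (\<Prod>c<m. block_weight t r l c (block_at N (Suc m) c w))"
    by (intro prod.cong) (auto simp: block_at_Suc)
  then show ?case by (simp add: Suc.IH block_at_self mult.commute)
qed simp

lemma sum_list_blocks: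
  assumes "length w = (\<Sum>c<m. N c)"
  shows "(\<Sum>c<m. sum_list (map f (block_at N m c w))) = (sum_list (map f w) :: nat)"
  using assms
proof (induction m arbitrary: w)
  case (Suc m)
  have "(\<Sum>c<m. sum_list (map f (block_at N (Suc m) c w))) = (\<Sum>c<m. sum_list (map f (block_at N m c (drop (N m) w))))"
    by (intro sum.cong) (auto simp: block_at_Suc)
  also have "\<dots> = sum_list (map f (drop (N m) w))"
    using Suc.prems by (intro Suc.IH) simp
  also have "sum_list (map f (take (N m) w)) + \<dots> = sum_list (map f (take (N m) w @ drop (N m) w))"
    unfolding map_append sum_list_append ..
  finally show ?case by (simp add: block_at_self del: map_append sum_list_append)
qed simp

lemma block_start_le:
  assumes "c < m"
  shows "block_start N m c + N c \<le> (\<Sum>d<m. N d)"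
proof -
  have "{c<..<m} \<subseteq> {..<m} - {c}" by auto
  then have "block_start N m c \<le> (\<Sum>d\<in>{..<m} - {c}. N d)"
    unfolding block_start_def by (intro sum_mono2) auto
  then show ?thesis using assms by (simp add: sum.remove[of "{..<m}" c])
qed

lemma block_start_mono:
  assumes "d < c" "c < m"
  shows "block_start N m c + N c \<le> block_start N m d"
proof -
  have "(\<Sum>e\<in>insert c {c<..<m}. N e) \<le> (\<Sum>e\<in>{d<..<m}. N e)"
    using assms by (intro sum_mono2) auto
  then show ?thesis by (simp add: block_start_def)
qed

lemma block_cover:
  assumes "v < (\<Sum>c<m. N c)"
  shows "\<exists>c<m. block_start N m c \<le> v \<and> v < block_start N m c + N c"
  using assms
proof (induction m arbitrary: v)
  case (Suc m)
  show ?case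
  proof (cases "v < N m")
    case True
    then show ?thesis by (intro exI[of _ m]) (simp add: block_start_self)
  next
    case False
    then obtain c where "c < m" "block_start N m c \<le> v - N m" "v - N m < block_start N m c + N c"
      using Suc.IH[of "v - N m"] Suc.prems by fastforce
    then show ?thesis using False by (intro exI[of _ c]) (auto simp: block_start_Suc)
  qed
qed simp

lemma length_block_at:
  assumes "length w = (\<Sum>c<m. N c)" "c < m"
  shows "length (block_at N m c w) = N c"
  using block_start_le[OF assms(2), of N] assms(1) by (simp add: block_at_def)

lemma nth_block_at:
  assumes "length w = (\<Sum>c<m. N c)" "c < m" "i < N c"
  shows "block_at N m c w ! i = w ! (block_start N m c + i)"
  using block_start_le[OF assms(2), of N] assms by (simp add: block_at_def)

lemma count_mset_levels: "count (mset (map fst w)) c = card {v. v < length w \<and> fst (w ! v) = c}"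
proof -
  have "count (mset (map fst w)) c = length (filter (\<lambda>x. fst x = c) w)"
    by (induction w) auto
  also have "\<dots> = card {v. v < length w \<and> fst (w ! v) = c}"
    by (simp add: length_filter_conv_card)
  finally show ?thesis .
qed

lemma level_above_eq_block_start:
  assumes "set w \<subseteq> {..<m} \<times> F"
  shows "level_above w c = block_start (count (mset (map fst w))) m c"
proof -
  have lt: "fst (w ! v) < m" if "v < length w" for v
    using assms nth_mem[OF that] by auto
  have "{v. v < length w \<and> c < fst (w ! v)} = (\<Union>d\<in>{c<..<m}. {v. v < length w \<and> fst (w ! v) = d})"
    using lt by auto
  also have "card \<dots> = (\<Sum>d\<in>{c<..<m}. card {v. v < length w \<and> fst (w ! v) = d})"
    by (rule card_UN_disjoint) auto
  finally show ?thesis by (simp add: level_above_def block_start_def count_mset_levels del: mset_map)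
qed

lemma upto_level_eq: "upto_level w c = level_above w c + count (mset (map fst w)) c"
proof -
  have "{v. v < length w \<and> c \<le> fst (w ! v)}
      = {v. v < length w \<and> c < fst (w ! v)} \<union> {v. v < length w \<and> fst (w ! v) = c}"
    by auto
  also have "card \<dots> = card {v. v < length w \<and> c < fst (w ! v)} + card {v. v < length w \<and> fst (w ! v) = c}"
    by (rule card_Un_disjoint) auto
  finally show ?thesis by (simp add: upto_level_def level_above_def count_mset_levels del: mset_map)
qed

lemma length_takeWhile_rev:
  "length (takeWhile P (rev ws)) = card {i. i < length ws \<and> (\<forall>j. i \<le> j \<and> j < length ws \<longrightarrow> P (ws ! j))}"
proof (induction ws rule: rev_induct)
  case (snoc x ws)
  let ?n = "length ws"
  let ?S = "{i. i < ?n \<and> (\<forall>j. i \<le> j \<and> j < ?n \<longrightarrow> P (ws ! j))}"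
  have last: "(\<forall>j. i \<le> j \<and> j < Suc ?n \<longrightarrow> P ((ws @ [x]) ! j)) \<longleftrightarrow>
      (\<forall>j. i \<le> j \<and> j < ?n \<longrightarrow> P (ws ! j)) \<and> P x" if "i < Suc ?n" for i
  proof
    assume L: "\<forall>j. i \<le> j \<and> j < Suc ?n \<longrightarrow> P ((ws @ [x]) ! j)"
    have "P (ws ! j)" if "i \<le> j" "j < ?n" for j
      using L[rule_format, of j] that by (simp add: nth_append)
    moreover have "P x" using L[rule_format, of ?n] \<open>i < Suc ?n\<close> by simp
    ultimately show "(\<forall>j. i \<le> j \<and> j < ?n \<longrightarrow> P (ws ! j)) \<and> P x" by blast
  next
    assume R: "(\<forall>j. i \<le> j \<and> j < ?n \<longrightarrow> P (ws ! j)) \<and> P x"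
    show "\<forall>j. i \<le> j \<and> j < Suc ?n \<longrightarrow> P ((ws @ [x]) ! j)"
    proof (intro allI impI)
      fix j assume j: "i \<le> j \<and> j < Suc ?n"
      show "P ((ws @ [x]) ! j)"
        using R j by (cases "j = ?n") (simp_all add: nth_append)
    qed
  qed
  have "{i. i < length (ws @ [x]) \<and> (\<forall>j. i \<le> j \<and> j < length (ws @ [x]) \<longrightarrow> P ((ws @ [x]) ! j))}
     = {i. i < Suc ?n \<and> (\<forall>j. i \<le> j \<and> j < ?n \<longrightarrow> P (ws ! j)) \<and> P x}"
    using last by auto
  also have "\<dots> = (if P x then insert ?n ?S else {})"
    by (auto simp: less_Suc_eq)
  finally have "{i. i < length (ws @ [x]) \<and> (\<forall>j. i \<le> j \<and> j < length (ws @ [x]) \<longrightarrow> P ((ws @ [x]) ! j))}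
     = (if P x then insert ?n ?S else {})" .
  moreover have "finite ?S" "?n \<notin> ?S" by auto
  ultimately show ?case using snoc by simp
qed simp

lemma prod_if_zero:
  fixes f :: "'i \<Rightarrow> 'c::comm_ring_1"
  assumes "finite I"
  shows "(\<Prod>i\<in>I. if P i then f i else 0) = (if \<forall>i\<in>I. P i then prod f I else 0)"
proof (cases "\<forall>i\<in>I. P i")
  case True
  then have "(\<Prod>i\<in>I. if P i then f i else 0) = prod f I"
    by (intro prod.cong) simp_all
  with True show ?thesis by simp
next
  case False
  then obtain i where "i \<in> I" "\<not> P i" by blast
  then have "(\<Prod>i\<in>I. if P i then f i else 0) = 0"
    using assms by (intro prod_zero bexI[of _ i]) simp_all
  then show ?thesis using \<open>i \<in> I\<close> \<open>\<not> P i\<close> by auto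
qed

lemma size_eq_sum_count:
  fixes K :: "nat multiset"
  assumes "set_mset K \<subseteq> {..<m}"
  shows "size K = (\<Sum>c<m. count K c)"
  unfolding size_multiset_overloaded_eq using assms
  by (intro sum.mono_neutral_left) (auto simp: count_eq_zero_iff)

text \<open>Block c occupies the positions from \<open>G c\<close> up to but excluding
  \<open>G c + N c\<close>, and these end points are \<open>level_above\<close> and
  \<open>upto_level\<close>. Hence the conditions imposed block by block can be read off position by
  position.\<close>

lemma level_weight_word:
  assumes l: "l \<ge> 1" and w: "w \<in> words ({..<m} \<times> {..l}) n"
  shows "level_weight t r l (count (mset (map fst w))) m w
       = (if word_ok l w then t ^ sum_list (map snd w) * r ^ word_fix w else 0)"
proof -
  define N where "N = count (mset (map fst w))"
  define G where "G = block_start N m"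
  have sub: "set w \<subseteq> {..<m} \<times> {..l}" using w by (simp add: words_def)
  have lev: "fst (w ! v) < m" if "v < length w" for v
    using subsetD[OF sub nth_mem[OF that]] by (simp add: mem_Times_iff)
  have len: "length w = (\<Sum>c<m. N c)"
  proof -
    have "length w = size (mset (map fst w))" by simp
    also have "\<dots> = (\<Sum>c<m. N c)"
      unfolding N_def using sub by (intro size_eq_sum_count) auto
    finally show ?thesis .
  qed
  have above: "level_above w c = G c" for c
    using level_above_eq_block_start[OF sub] by (simp add: G_def N_def)
  have upto: "upto_level w c = G c + N c" for c
    by (simp add: upto_level_eq above N_def)
  have N: "N c = card {v. v < length w \<and> fst (w ! v) = c}" for c
    unfolding N_def by (rule count_mset_levels)
  have Npos: "0 < N (fst (w ! v))" if "v < length w" for v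
    unfolding N using that by (auto simp: card_gt_0_iff)
  have bound: "G c + N c \<le> length w" if "c < m" for c
    unfolding len G_def by (rule block_start_le[OF that])
  have mono: "G c + N c \<le> G d" if "d < c" "c < m" for c d
    unfolding G_def by (rule block_start_mono[OF that])
  have lenb: "length (block_at N m c w) = N c" if "c < m" for c
    by (rule length_block_at[OF len that])
  have nthb: "block_at N m c w ! i = w ! (G c + i)" if "c < m" "i < N c" for c i
    unfolding G_def by (rule nth_block_at[OF len that])
  have cover: "\<exists>c<m. G c \<le> v \<and> v < G c + N c" if "v < length w" for v
    unfolding G_def using that len by (intro block_cover) simp
  have okb: "block_ok l c (block_at N m c w) \<longleftrightarrow>
      (\<forall>i<N c. allowed l c (w ! (G c + i)) \<and> (i = 0 \<longrightarrow> w ! (G c + i) \<noteq> (c, l)))" if c: "c < m" for c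
  proof -
    have "(\<forall>x\<in>set (block_at N m c w). allowed l c x) \<longleftrightarrow> (\<forall>i<N c. allowed l c (w ! (G c + i)))"
      using c by (simp add: all_set_conv_all_nth lenb nthb)
    moreover have "(block_at N m c w \<noteq> [] \<longrightarrow> hd (block_at N m c w) \<noteq> (c, l)) \<longleftrightarrow> (0 < N c \<longrightarrow> w ! G c \<noteq> (c, l))"
    proof (cases "N c = 0")
      case True
      then show ?thesis using lenb[OF c] by simp
    next
      case False
      then have "block_at N m c w \<noteq> []" using lenb[OF c] by auto
      then show ?thesis using False nthb[OF c, of 0] by (simp add: hd_conv_nth)
    qed
    ultimately show ?thesis unfolding block_ok_def by auto
  qed
  \<comment> \<open>The block of the label d of \<open>w ! v\<close> is nonempty; it lies wholly
    before block c if d > c and wholly after it if d < c. Comparing v with the ends of block d thus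
    only depends on the order of c and d, except for d = c and v = \<open>G c\<close>, where colour
    l fails.\<close>
  have local: "(snd (w ! v) = l \<longrightarrow> G (fst (w ! v)) < v) \<and> (snd (w ! v) = 0 \<longrightarrow> v < G (fst (w ! v)) + N (fst (w ! v)))
      \<longleftrightarrow> allowed l c (w ! v) \<and> (v = G c \<longrightarrow> w ! v \<noteq> (c, l))"
    if c: "c < m" "G c \<le> v" "v < G c + N c" and v: "v < length w" for c v
  proof -
    define d where "d = fst (w ! v)"
    have d: "d < m" "0 < N d" using lev[OF v] Npos[OF v] by (auto simp: d_def)
    have wv: "w ! v = (c, l) \<longleftrightarrow> d = c \<and> snd (w ! v) = l" by (simp add: d_def prod_eq_iff)
    consider "d < c" | "d = c" | "c < d" by linarith
    then show ?thesis
    proof cases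
      case 1
      then show ?thesis
        unfolding wv using mono[OF 1 c(1)] c l by (auto simp: allowed_def d_def[symmetric])
    next
      case 2
      have "G c < v \<longleftrightarrow> v \<noteq> G c" using c(2) by auto
      then show ?thesis
        unfolding wv allowed_def d_def[symmetric] 2 using c(3) l by auto
    next
      case 3
      then show ?thesis
        unfolding wv using mono[OF 3 d(1)] c l d by (auto simp: allowed_def d_def[symmetric])
    qed
  qed
  have ok: "(\<forall>c<m. block_ok l c (block_at N m c w)) \<longleftrightarrow> word_ok l w"
  proof
    assume blocks: "\<forall>c<m. block_ok l c (block_at N m c w)"
    show "word_ok l w"
      unfolding word_ok_def above upto
    proof (intro allI impI)
      fix v assume v: "v < length w"
      from cover[OF v] obtain c where c: "c < m" "G c \<le> v" "v < G c + N c" by blast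
      have "allowed l c (w ! (G c + (v - G c))) \<and> (v - G c = 0 \<longrightarrow> w ! (G c + (v - G c)) \<noteq> (c, l))"
        using blocks[rule_format, OF c(1), unfolded okb[OF c(1)], rule_format, of "v - G c"] c by simp
      then have "allowed l c (w ! v) \<and> (v = G c \<longrightarrow> w ! v \<noteq> (c, l))"
        using c by auto
      then show "(snd (w ! v) = l \<longrightarrow> G (fst (w ! v)) < v) \<and> (snd (w ! v) = 0 \<longrightarrow> v < G (fst (w ! v)) + N (fst (w ! v)))"
        unfolding local[OF c v] .
    qed
  next
    assume wok: "word_ok l w"
    show "\<forall>c<m. block_ok l c (block_at N m c w)"
    proof (intro allI impI)
      fix c assume c: "c < m"
      show "block_ok l c (block_at N m c w)"
        unfolding okb[OF c]
      proof (intro allI impI)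
        fix i assume i: "i < N c"
        then have v: "G c + i < length w" using bound[OF c] by simp
        have "(snd (w ! (G c + i)) = l \<longrightarrow> G (fst (w ! (G c + i))) < G c + i)
            \<and> (snd (w ! (G c + i)) = 0 \<longrightarrow> G c + i < G (fst (w ! (G c + i))) + N (fst (w ! (G c + i))))"
          using wok v unfolding word_ok_def above upto by blast
        then show "allowed l c (w ! (G c + i)) \<and> (i = 0 \<longrightarrow> w ! (G c + i) \<noteq> (c, l))"
          using local[OF c _ _ v] i by simp
      qed
    qed
  qed
  have tails: "(\<Sum>c<m. tail_len c (block_at N m c w)) = word_fix w" if wok: "word_ok l w"
  proof -
    define S where "S c = {v. G c \<le> v \<and> v < G c + N c \<and> (\<forall>u. v \<le> u \<and> u < G c + N c \<longrightarrow> w ! u = (c, 0))}" for c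
    have Sval: "w ! v = (c, 0)" if "v \<in> S c" for v c
    proof -
      have "v \<le> v \<and> v < G c + N c" using that unfolding S_def by blast
      then show ?thesis using that unfolding S_def by blast
    qed
    have fin: "finite (S c)" for c
      by (rule finite_subset[of _ "{..<G c + N c}"]) (auto simp: S_def)
    have "tail_len c (block_at N m c w) = card (S c)" if c: "c < m" for c
    proof -
      have "tail_len c (block_at N m c w)
          = card {i. i < N c \<and> (\<forall>j. i \<le> j \<and> j < N c \<longrightarrow> w ! (G c + j) = (c, 0))}"
        unfolding tail_len_def length_takeWhile_rev lenb[OF c]
        by (intro arg_cong[where f = card] Collect_cong) (auto simp: nthb[OF c])
      also have "\<dots> = card (S c)"
      proof (rule bij_betw_same_card[where f = "\<lambda>i. G c + i"], rule bij_betw_byWitness[where f' = "\<lambda>v. v - G c"])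
        show "(\<lambda>i. G c + i) ` {i. i < N c \<and> (\<forall>j. i \<le> j \<and> j < N c \<longrightarrow> w ! (G c + j) = (c, 0))} \<subseteq> S c"
        proof clarify
          fix i assume i: "i < N c" and all: "\<forall>j. i \<le> j \<and> j < N c \<longrightarrow> w ! (G c + j) = (c, 0)"
          have "w ! u = (c, 0)" if "G c + i \<le> u" "u < G c + N c" for u
          proof -
            have "i \<le> u - G c \<and> u - G c < N c" using that by linarith
            then have "w ! (G c + (u - G c)) = (c, 0)" using all by blast
            then show ?thesis using that by simp
          qed
          then show "G c + i \<in> S c" using i by (auto simp: S_def)
        qed
      qed (auto simp: S_def)
      finally show ?thesis .
    qed
    then have "(\<Sum>c<m. tail_len c (block_at N m c w)) = (\<Sum>c<m. card (S c))" by simp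
    also have "\<dots> = card (\<Union>c<m. S c)"
    proof (rule card_UN_disjoint[symmetric])
      show "\<forall>i\<in>{..<m}. \<forall>j\<in>{..<m}. i \<noteq> j \<longrightarrow> S i \<inter> S j = {}"
        by (auto dest!: Sval)
    qed (use fin in auto)
    also have "(\<Union>c<m. S c) = {v. v < length w \<and> snd (w ! v) = 0
        \<and> (\<forall>u. v \<le> u \<and> u < G (fst (w ! v)) + N (fst (w ! v)) \<longrightarrow> w ! u = w ! v)}" (is "_ = ?F")
    proof (intro equalityI subsetI)
      fix v assume "v \<in> (\<Union>c<m. S c)"
      then obtain c where c: "c < m" and v: "v \<in> S c" by blast
      have wv: "w ! v = (c, 0)" by (rule Sval[OF v])
      have "v < G c + N c" and "\<forall>u. v \<le> u \<and> u < G c + N c \<longrightarrow> w ! u = (c, 0)"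
        using v unfolding S_def by blast+
      then show "v \<in> ?F" using wv bound[OF c] by simp
    next
      fix v assume v: "v \<in> ?F"
      define c where "c = fst (w ! v)"
      have len: "v < length w" and flag: "snd (w ! v) = 0"
        and all: "\<forall>u. v \<le> u \<and> u < G c + N c \<longrightarrow> w ! u = w ! v"
        using v unfolding c_def by blast+
      have wv: "w ! v = (c, 0)" using flag by (simp add: c_def prod_eq_iff)
      note all = all[unfolded wv]
      have c: "c < m" using lev[OF len] by (simp add: c_def)
      have up: "v < G c + N c" using wok[unfolded word_ok_def above upto, rule_format, OF len] wv by simp
      \<comment> \<open>Otherwise the run from v to the end of block c would contain more than
        \<open>N c\<close> letters of label c.\<close>
      have "G c \<le> v"
      proof (rule ccontr)
        assume "\<not> G c \<le> v"
        have "{v..<G c + N c} \<subseteq> {u. u < length w \<and> fst (w ! u) = c}"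
        proof
          fix u assume "u \<in> {v..<G c + N c}"
          then show "u \<in> {u. u < length w \<and> fst (w ! u) = c}"
            using all[rule_format, of u] bound[OF c] by simp
        qed
        then have "card {v..<G c + N c} \<le> N c" unfolding N[of c] by (intro card_mono) auto
        then show False using \<open>\<not> G c \<le> v\<close> by simp
      qed
      then have "v \<in> S c" using up all unfolding S_def by blast
      then show "v \<in> (\<Union>c<m. S c)" using c by blast
    qed
    also have "card ?F = word_fix w" by (simp add: word_fix_def upto)
    finally show ?thesis .
  qed
  have "level_weight t r l N m w = (\<Prod>c<m. if block_ok l c (block_at N m c w)
      then t ^ sum_list (map snd (block_at N m c w)) * r ^ tail_len c (block_at N m c w) else 0)"
    by (simp add: level_weight_prod block_weight_def)
  also have "\<dots> = (if word_ok l w then (\<Prod>c<m. t ^ sum_list (map snd (block_at N m c w)) * r ^ tail_len c (block_at N m c w)) else 0)"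
    unfolding ok[symmetric] by (subst prod_if_zero) (simp_all only: finite_lessThan Ball_def lessThan_iff)
  also have "(\<Prod>c<m. t ^ sum_list (map snd (block_at N m c w)) * r ^ tail_len c (block_at N m c w))
      = t ^ sum_list (map snd w) * r ^ (\<Sum>c<m. tail_len c (block_at N m c w))"
    by (simp only: prod.distrib power_sum[symmetric] sum_list_blocks[OF len])
  finally have eq: "level_weight t r l N m w = (if word_ok l w
      then t ^ sum_list (map snd w) * r ^ (\<Sum>c<m. tail_len c (block_at N m c w)) else 0)" .
  show ?thesis
    unfolding N_def[symmetric] eq
    by (rule if_cong) (simp_all only: tails)
qed

section \<open>Words and labelled permutations\<close>

text \<open>Position v of the word holds the label and colour of the value v + 1. Decreasing label,
  then decreasing colour (larger colours are smaller letters), then increasing value is the order in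
  which a labelled permutation lists its values.\<close>

definition letter_key :: "(nat \<times> nat) list \<Rightarrow> nat \<Rightarrow> int \<times> int \<times> nat" where
  "letter_key w v = (- int (fst (w ! v)), - int (snd (w ! v)), v)"

definition reading_order :: "(nat \<times> nat) list \<Rightarrow> nat list" where
  "reading_order w = sort_key (letter_key w) [0..<length w]"

lemma letter_key_less:
  "letter_key w u < letter_key w v \<longleftrightarrow> fst (w ! v) < fst (w ! u) \<or>
     fst (w ! v) = fst (w ! u) \<and> (snd (w ! v) < snd (w ! u) \<or> snd (w ! v) = snd (w ! u) \<and> u < v)"
  by (simp add: letter_key_def less_prod_simp) linarith

lemma inj_letter_key: "inj (letter_key w)"
  by (rule injI) (simp add: letter_key_def)

lemma set_reading_order: "set (reading_order w) = {..<length w}"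
  by (auto simp: reading_order_def)

lemma length_reading_order: "length (reading_order w) = length w"
  by (simp add: reading_order_def)

lemma distinct_reading_order: "distinct (reading_order w)"
  by (simp add: reading_order_def)

lemma sorted_reading_order: "sorted_wrt (<) (map (letter_key w) (reading_order w))"
  unfolding strict_sorted_iff
  by (simp add: reading_order_def distinct_map inj_on_subset[OF inj_letter_key])

lemma reading_order_unique:
  assumes "set xs = {..<length w}" "sorted_wrt (<) (map (letter_key w) xs)"
  shows "xs = reading_order w"
proof -
  have "map (letter_key w) xs = map (letter_key w) (reading_order w)"
    by (rule strict_sorted_equal) (use assms sorted_reading_order set_reading_order in auto)
  then show ?thesis by (simp add: inj_map_eq_map[OF inj_letter_key])
qed

lemma map_reading_order:
  "mset (map (\<lambda>v. g (w ! v)) (reading_order w)) = mset (map g w)"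
proof -
  have "mset (map (\<lambda>v. g (w ! v)) (reading_order w)) = mset (map (\<lambda>v. g (w ! v)) [0..<length w])"
    by (simp add: reading_order_def)
  also have "map (\<lambda>v. g (w ! v)) [0..<length w] = map g w"
    by (rule nth_equalityI) auto
  finally show ?thesis .
qed

lemma reading_order_index:
  assumes "i < length w"
  shows "card {u. u < length w \<and> letter_key w u < letter_key w (reading_order w ! i)} = i"
proof -
  let ?xs = "reading_order w"
  have len: "length ?xs = length w" by (rule length_reading_order)
  have less: "letter_key w (?xs ! j) < letter_key w (?xs ! i) \<longleftrightarrow> j < i" if "j < length w" for j
  proof (rule linorder_cases[of i j])
    assume "i < j"
    then have "letter_key w (?xs ! i) < letter_key w (?xs ! j)"
      using sorted_wrt_nth_less[OF sorted_reading_order, of i j w] that assms len by simp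
    then show ?thesis using \<open>i < j\<close> by (simp add: less_asym)
  next
    assume "j < i"
    then have "letter_key w (?xs ! j) < letter_key w (?xs ! i)"
      using sorted_wrt_nth_less[OF sorted_reading_order, of j i w] that assms len by simp
    then show ?thesis using \<open>j < i\<close> by simp
  qed simp
  have "{u. u < length w \<and> letter_key w u < letter_key w (?xs ! i)} = (\<lambda>j. ?xs ! j) ` {..<i}"
  proof (intro equalityI subsetI)
    fix u assume u: "u \<in> {u. u < length w \<and> letter_key w u < letter_key w (?xs ! i)}"
    then have "u \<in> set ?xs" by (simp add: set_reading_order)
    then obtain j where j: "j < length w" "?xs ! j = u" unfolding in_set_conv_nth len by blast
    then have "j < i" using less[of j] u by simp
    then show "u \<in> (\<lambda>j. ?xs ! j) ` {..<i}" using j by blast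
  next
    fix u assume "u \<in> (\<lambda>j. ?xs ! j) ` {..<i}"
    then obtain j where j: "j < i" "u = ?xs ! j" by blast
    then have "u \<in> set ?xs" using assms len by simp
    then show "u \<in> {u. u < length w \<and> letter_key w u < letter_key w (?xs ! i)}"
      using j less[of j] assms by (simp add: set_reading_order)
  qed
  moreover have "inj_on (\<lambda>j. ?xs ! j) {..<i}"
    using assms len by (intro inj_on_nth distinct_reading_order) auto
  ultimately show ?thesis by (simp add: card_image)
qed

text \<open>Inverse of \<open>reading_order\<close>: the zero-based place of the value v + 1 in the
  permutation. An excedance is therefore a v with \<open>rank w v\<close> < v.\<close>

definition rank :: "(nat \<times> nat) list \<Rightarrow> nat \<Rightarrow> nat" where
  "rank w v = card {u. u < length w \<and> letter_key w u < letter_key w v}"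

lemma rank_reading_order: "i < length w \<Longrightarrow> rank w (reading_order w ! i) = i"
  unfolding rank_def by (rule reading_order_index)

text \<open>Colour l comes first within its label, so only larger labels and equal letters further
  left precede v.\<close>

lemma rank_top_flag:
  assumes "\<forall>x\<in>set w. snd x \<le> l" "v < length w" "snd (w ! v) = l"
  shows "rank w v = level_above w (fst (w ! v)) + card {u. u < v \<and> w ! u = w ! v}"
proof -
  have lex: "x < y \<or> x = y \<and> (b < a \<or> b = a \<and> u < v) \<longleftrightarrow> x < y \<or> u < v \<and> y = x \<and> a = b"
    if "a \<le> b" for a b x y :: nat and u :: nat
    using that by auto
  have iff: "letter_key w u < letter_key w v \<longleftrightarrow> fst (w ! v) < fst (w ! u) \<or> u < v \<and> w ! u = w ! v"
    if "u < length w" for u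
  proof -
    have "snd (w ! u) \<le> snd (w ! v)" using assms(1,3) that by simp
    then show ?thesis unfolding letter_key_less prod_eq_iff by (rule lex)
  qed
  have "{u. u < length w \<and> letter_key w u < letter_key w v}
      = {u. u < length w \<and> fst (w ! v) < fst (w ! u)} \<union> {u. u < v \<and> w ! u = w ! v}"
  proof (rule set_eqI)
    fix u
    have "u < v \<Longrightarrow> u < length w" using assms(2) by simp
    then show "u \<in> {u. u < length w \<and> letter_key w u < letter_key w v} \<longleftrightarrow>
      u \<in> {u. u < length w \<and> fst (w ! v) < fst (w ! u)} \<union> {u. u < v \<and> w ! u = w ! v}"
      using iff[of u] by blast
  qed
  moreover have "{u. u < length w \<and> fst (w ! v) < fst (w ! u)} \<inter> {u. u < v \<and> w ! u = w ! v} = {}"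
    by auto
  ultimately show ?thesis unfolding rank_def level_above_def
    by (simp add: card_Un_disjoint)
qed

text \<open>Colour 0 comes last within its label, so the letters of at least that label that do not
  precede v are v itself and equal letters to its right.\<close>

lemma rank_zero_flag:
  assumes "v < length w" "snd (w ! v) = 0"
  shows "upto_level w (fst (w ! v)) = rank w v + card {u. v \<le> u \<and> u < length w \<and> w ! u = w ! v}"
proof -
  have lex: "x \<le> y \<longleftrightarrow> (x < y \<or> x = y \<and> (0 < a \<or> 0 = a \<and> u < v)) \<or> v \<le> u \<and> y = x \<and> a = 0"
    for a x y :: nat and u :: nat
    by auto
  have iff: "fst (w ! v) \<le> fst (w ! u) \<longleftrightarrow> letter_key w u < letter_key w v \<or> v \<le> u \<and> w ! u = w ! v" for u
    unfolding letter_key_less prod_eq_iff assms(2) by (rule lex)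
  have "{u. u < length w \<and> fst (w ! v) \<le> fst (w ! u)}
      = {u. u < length w \<and> letter_key w u < letter_key w v} \<union> {u. v \<le> u \<and> u < length w \<and> w ! u = w ! v}"
    unfolding iff by blast
  moreover have "{u. u < length w \<and> letter_key w u < letter_key w v} \<inter> {u. v \<le> u \<and> u < length w \<and> w ! u = w ! v} = {}"
    by (auto simp: letter_key_less)
  ultimately show ?thesis unfolding rank_def upto_level_def
    by (simp add: card_Un_disjoint)
qed

text \<open>\<open>word_ok\<close> compares v with the end of a whole label block, the right-hand
  side with an exact rank. Counting closes the gap: if all copies of a letter of colour l satisfy
  the block bound, those left of v lie strictly between the block start and v, too few to lift the
  rank to v. Colour 0 is dual.\<close>

lemma word_ok_rank:
  assumes flags: "\<forall>x\<in>set w. snd x \<le> l"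
  shows "word_ok l w \<longleftrightarrow> (\<forall>v<length w. (snd (w ! v) = l \<longrightarrow> rank w v < v) \<and> (snd (w ! v) = 0 \<longrightarrow> v \<le> rank w v))"
proof (intro iffI allI impI)
  fix v assume ok: "word_ok l w" and v: "v < length w"
  have "rank w v < v" if top: "snd (w ! v) = l"
  proof -
    let ?a = "level_above w (fst (w ! v))"
    have "?a < v" using ok v top by (simp add: word_ok_def)
    have "{u. u < v \<and> w ! u = w ! v} \<subseteq> {?a<..<v}"
    proof
      fix u assume "u \<in> {u. u < v \<and> w ! u = w ! v}"
      then have u: "u < v" "w ! u = w ! v" by auto
      then have "u < length w" using v by simp
      then have "level_above w (fst (w ! u)) < u"
        using ok[unfolded word_ok_def, rule_format, of u] u top by simp
      then show "u \<in> {?a<..<v}" using u by simp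
    qed
    then have "card {u. u < v \<and> w ! u = w ! v} \<le> card {?a<..<v}" by (intro card_mono) auto
    then show ?thesis using rank_top_flag[OF flags v top] \<open>?a < v\<close> by simp
  qed
  moreover have "v \<le> rank w v" if zero: "snd (w ! v) = 0"
  proof -
    let ?a = "upto_level w (fst (w ! v))"
    have "{u. v \<le> u \<and> u < length w \<and> w ! u = w ! v} \<subseteq> {v..<?a}"
    proof
      fix u assume "u \<in> {u. v \<le> u \<and> u < length w \<and> w ! u = w ! v}"
      then have u: "v \<le> u" "u < length w" "w ! u = w ! v" by auto
      then have "u < upto_level w (fst (w ! u))"
        using ok[unfolded word_ok_def, rule_format, OF u(2)] zero by simp
      then show "u \<in> {v..<?a}" using u by simp
    qed
    then have "card {u. v \<le> u \<and> u < length w \<and> w ! u = w ! v} \<le> card {v..<?a}" by (intro card_mono) auto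
    moreover have "v < ?a" using ok v zero by (simp add: word_ok_def)
    ultimately show ?thesis using rank_zero_flag[OF v zero] by simp
  qed
  ultimately show "(snd (w ! v) = l \<longrightarrow> rank w v < v) \<and> (snd (w ! v) = 0 \<longrightarrow> v \<le> rank w v)" by blast
next
  assume R: "\<forall>v<length w. (snd (w ! v) = l \<longrightarrow> rank w v < v) \<and> (snd (w ! v) = 0 \<longrightarrow> v \<le> rank w v)"
  show "word_ok l w"
    unfolding word_ok_def
  proof (intro allI impI conjI)
    fix v assume v: "v < length w" and top: "snd (w ! v) = l"
    then show "level_above w (fst (w ! v)) < v"
      using R[rule_format, OF v] rank_top_flag[OF flags v top] by simp
  next
    fix v assume v: "v < length w" and zero: "snd (w ! v) = 0"
    have "0 < card {u. v \<le> u \<and> u < length w \<and> w ! u = w ! v}"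
      using v by (auto simp: card_gt_0_iff)
    then show "v < upto_level w (fst (w ! v))"
      using R[rule_format, OF v] zero rank_zero_flag[OF v zero] by simp
  qed
qed

text \<open>The equality case of the counting bound for colour 0: the copies of the letter must fill
  every position from v to the end of its block.\<close>

lemma rank_fixed:
  assumes ok: "word_ok l w" and v: "v < length w" and zero: "snd (w ! v) = 0"
  shows "rank w v = v \<longleftrightarrow> (\<forall>u. v \<le> u \<and> u < upto_level w (fst (w ! v)) \<longrightarrow> w ! u = w ! v)"
proof -
  let ?a = "upto_level w (fst (w ! v))"
  let ?S = "{u. v \<le> u \<and> u < length w \<and> w ! u = w ! v}"
  have sub: "?S \<subseteq> {v..<?a}"
  proof
    fix u assume "u \<in> ?S"
    then have u: "v \<le> u" "u < length w" "w ! u = w ! v" by auto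
    then have "u < upto_level w (fst (w ! u))"
      using ok[unfolded word_ok_def, rule_format, OF u(2)] zero by simp
    then show "u \<in> {v..<?a}" using u by simp
  qed
  have "v < ?a" using ok v zero by (simp add: word_ok_def)
  then have "rank w v = v \<longleftrightarrow> card ?S = card {v..<?a}"
    using rank_zero_flag[OF v zero] unfolding card_atLeastLessThan by arith
  also have "\<dots> \<longleftrightarrow> ?S = {v..<?a}"
    by (rule iffI) (erule card_subset_eq[OF finite_atLeastLessThan sub], erule arg_cong)
  also have "\<dots> \<longleftrightarrow> (\<forall>u. v \<le> u \<and> u < ?a \<longrightarrow> w ! u = w ! v)"
  proof
    assume "?S = {v..<?a}"
    then have "u \<in> ?S" if "v \<le> u" "u < ?a" for u
      using that by (simp only: atLeastLessThan_iff)
    then show "\<forall>u. v \<le> u \<and> u < ?a \<longrightarrow> w ! u = w ! v" by blast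
  next
    assume all: "\<forall>u. v \<le> u \<and> u < ?a \<longrightarrow> w ! u = w ! v"
    have "?a \<le> length w"
      unfolding upto_level_def using card_mono[of "{..<length w}"] by (force simp: subset_eq)
    have "{v..<?a} \<subseteq> ?S"
    proof
      fix u assume "u \<in> {v..<?a}"
      then have "v \<le> u" "u < ?a" by simp_all
      then show "u \<in> ?S" using all \<open>?a \<le> length w\<close> less_le_trans by blast
    qed
    then show "?S = {v..<?a}" using sub by blast
  qed
  finally show ?thesis .
qed

text \<open>Flag l marks the excedances, so flag 0 is left for positions that are not excedances.\<close>

definition flagged_ok :: "nat \<Rightarrow> (nat \<times> nat) list \<Rightarrow> bool" where
  "flagged_ok l p \<longleftrightarrow> (\<forall>i<length p. (snd (p ! i) = l \<longrightarrow> i + 1 < fst (p ! i)) \<and> (snd (p ! i) = 0 \<longrightarrow> fst (p ! i) \<le> i + 1))"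

definition compatible :: "nat \<Rightarrow> (nat \<times> nat) list \<Rightarrow> nat list set" where
  "compatible m p = {b. length b = length p \<and> set b \<subseteq> {..<m} \<and>
     (\<forall>i. Suc i < length p \<longrightarrow> b ! Suc i \<le> b ! i \<and> (cless (p ! Suc i) (p ! i) \<longrightarrow> b ! Suc i < b ! i))}"

definition word_perm :: "(nat \<times> nat) list \<Rightarrow> (nat \<times> nat) list" where
  "word_perm w = map (\<lambda>v. (v + 1, snd (w ! v))) (reading_order w)"

definition word_labels :: "(nat \<times> nat) list \<Rightarrow> nat list" where
  "word_labels w = map (\<lambda>v. fst (w ! v)) (reading_order w)"

lemma word_perm_colored:
  assumes "w \<in> words ({..<m} \<times> {..l}) n"
  shows "word_perm w \<in> colored_perms (Suc l) n"
proof -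
  have w: "length w = n" "\<forall>x\<in>set w. snd x \<le> l" using assms by (auto simp: words_def)
  have fst: "map fst (word_perm w) = map Suc (reading_order w)"
    by (simp add: word_perm_def)
  have "set (map Suc (reading_order w)) = {1..n}"
    using w by (simp add: set_reading_order image_Suc_lessThan)
  moreover have "distinct (map Suc (reading_order w))"
    by (simp add: distinct_map distinct_reading_order)
  moreover have "\<forall>x\<in>set (word_perm w). snd x < Suc l"
    using w by (auto simp: word_perm_def set_reading_order less_Suc_eq_le)
  moreover have "length (word_perm w) = n"
    using w by (simp add: word_perm_def length_reading_order)
  ultimately show ?thesis unfolding colored_perms_def mem_Collect_eq fst by blast
qed

lemma word_labels_compatible:
  assumes "w \<in> words ({..<m} \<times> {..l}) n"
  shows "word_labels w \<in> compatible m (word_perm w)"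
proof -
  have w: "length w = n" and sub: "set w \<subseteq> {..<m} \<times> {..l}" using assms by (auto simp: words_def)
  have lev: "fst (w ! v) < m" if "v < n" for v
    using subsetD[OF sub nth_mem[of v w]] that w by (simp add: mem_Times_iff)
  have step: "word_labels w ! Suc i \<le> word_labels w ! i \<and>
      (cless (word_perm w ! Suc i) (word_perm w ! i) \<longrightarrow> word_labels w ! Suc i < word_labels w ! i)"
    if i: "Suc i < n" for i
  proof -
    have "letter_key w (reading_order w ! i) < letter_key w (reading_order w ! Suc i)"
      using sorted_wrt_nth_less[OF sorted_reading_order, of i "Suc i" w] i w
      by (simp add: length_reading_order)
    then show ?thesis
      using i w unfolding letter_key_less
      by (auto simp: word_labels_def word_perm_def length_reading_order cless_def)
  qed
  show ?thesis
    unfolding compatible_def using step w lev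
    by (auto simp: word_labels_def word_perm_def length_reading_order set_reading_order)
qed

lemma word_perm_flagged_ok:
  assumes "w \<in> words ({..<m} \<times> {..l}) n"
  shows "flagged_ok l (word_perm w) \<longleftrightarrow> word_ok l w"
proof -
  have flags: "\<forall>x\<in>set w. snd x \<le> l" using assms by (auto simp: words_def)
  let ?P = "\<lambda>v i. (snd (w ! v) = l \<longrightarrow> i < v) \<and> (snd (w ! v) = 0 \<longrightarrow> v \<le> i)"
  have "flagged_ok l (word_perm w) \<longleftrightarrow> (\<forall>i<length w. ?P (reading_order w ! i) i)"
    by (simp add: flagged_ok_def word_perm_def length_reading_order)
  also have "\<dots> \<longleftrightarrow> (\<forall>i<length w. ?P (reading_order w ! i) (rank w (reading_order w ! i)))"
    by (simp add: rank_reading_order)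
  also have "\<dots> \<longleftrightarrow> (\<forall>v\<in>set (reading_order w). ?P v (rank w v))"
    by (simp add: all_set_conv_all_nth length_reading_order)
  also have "\<dots> \<longleftrightarrow> word_ok l w"
    by (simp add: word_ok_rank[OF flags] set_reading_order Ball_def)
  finally show ?thesis .
qed

lemma cfix_word_perm:
  assumes "word_ok l w"
  shows "cfix (word_perm w) = word_fix w"
proof -
  let ?R = "reading_order w"
  have "cfix (word_perm w) = card {i. i < length w \<and> snd (w ! (?R ! i)) = 0 \<and> ?R ! i = i}"
    unfolding cfix_def
    by (intro arg_cong[where f = card] Collect_cong) (auto simp: word_perm_def length_reading_order)
  also have "\<dots> = card {v. v < length w \<and> snd (w ! v) = 0 \<and> rank w v = v}"
  proof (rule arg_cong[where f = card], rule Collect_cong, rule conj_cong, rule refl)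
    fix i assume i: "i < length w"
    show "(snd (w ! (?R ! i)) = 0 \<and> ?R ! i = i) = (snd (w ! i) = 0 \<and> rank w i = i)"
    proof
      assume "snd (w ! (?R ! i)) = 0 \<and> ?R ! i = i"
      then have "?R ! i = i" and "snd (w ! (?R ! i)) = 0" by blast+
      then show "snd (w ! i) = 0 \<and> rank w i = i" using rank_reading_order[OF i] by metis
    next
      assume R: "snd (w ! i) = 0 \<and> rank w i = i"
      have "i \<in> set ?R" using i by (simp add: set_reading_order)
      then obtain j where "j < length w" "?R ! j = i"
        unfolding in_set_conv_nth length_reading_order by blast
      moreover from this have "j = i" using rank_reading_order[of j w] R by simp
      ultimately show "snd (w ! (?R ! i)) = 0 \<and> ?R ! i = i" using R by simp
    qed
  qed
  also have "\<dots> = word_fix w"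
    unfolding word_fix_def
    by (intro arg_cong[where f = card] Collect_cong conj_cong refl) (rule rank_fixed[OF assms])
  finally show ?thesis .
qed

text \<open>The word w records, value by value, the label and colour attached to that value in (p,
  b). Equal neighbouring labels exclude a descent, so the values in the order of p have increasing
  keys; uniqueness of the sorted order then recovers p and b.\<close>

lemma word_perm_surj:
  assumes p: "p \<in> colored_perms (Suc l) n" and b: "b \<in> compatible m p"
  obtains w where "w \<in> words ({..<m} \<times> {..l}) n" "word_perm w = p" "word_labels w = b"
proof -
  have len: "length p = n" "length b = n" and dist: "distinct (map fst p)" and set: "set (map fst p) = {1..n}"
    and flags: "\<forall>x\<in>set p. snd x \<le> l" and labels: "set b \<subseteq> {..<m}"
    using p b by (simp_all add: colored_perms_def compatible_def less_Suc_eq_le)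
  have flag: "snd (p ! i) \<le> l" and lab: "b ! i < m" if "i < n" for i
    using flags subsetD[OF labels nth_mem[of i b]] that len by simp_all
  define z where "z = zip (map fst p) (zip b (map snd p))"
  define w where "w = map (\<lambda>v. the (map_of z (v + 1))) [0..<n]"
  have pos: "0 < fst (p ! i) \<and> fst (p ! i) \<le> n" if "i < n" for i
    using set len nth_mem[of i "map fst p"] that by (simp add: set_eq_iff)
  have w_nth: "w ! (fst (p ! i) - 1) = (b ! i, snd (p ! i))" if i: "i < n" for i
  proof -
    have "map_of z (map fst p ! i) = Some (zip b (map snd p) ! i)"
      unfolding z_def using len dist i by (intro map_of_zip_nth) auto
    then have "map_of z (fst (p ! i)) = Some (b ! i, snd (p ! i))"
      using len i by simp
    moreover have "fst (p ! i) - 1 < n" "fst (p ! i) - 1 + 1 = fst (p ! i)" using pos[OF i] by linarith+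
    then have "w ! (fst (p ! i) - 1) = the (map_of z (fst (p ! i)))"
      unfolding w_def by (simp only: nth_map length_upt nth_upt diff_zero add_0)
    ultimately show ?thesis by simp
  qed
  have len_w: "length w = n" by (simp add: w_def)
  define xs where "xs = map (\<lambda>x. fst x - 1) p"
  have "set xs = (\<lambda>k. k - 1) ` {1..n}"
    unfolding set[symmetric] by (simp add: xs_def image_image)
  also have "\<dots> = {..<n}"
  proof (intro equalityI subsetI)
    fix v assume "v \<in> {..<n}"
    then show "v \<in> (\<lambda>k. k - 1) ` {1..n}" by (intro image_eqI[of _ _ "Suc v"]) auto
  qed auto
  finally have set_xs: "set xs = {..<length w}" by (simp add: len_w)
  have "letter_key w (xs ! i) < letter_key w (xs ! Suc i)" if i: "Suc i < n" for i
  proof -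
    have "b ! Suc i \<le> b ! i" "cless (p ! Suc i) (p ! i) \<longrightarrow> b ! Suc i < b ! i"
      using b i len by (auto simp: compatible_def)
    moreover have "fst (p ! i) \<noteq> fst (p ! Suc i)"
      using dist nth_eq_iff_index_eq[of "map fst p" i "Suc i"] i len by simp
    moreover have "xs ! i = fst (p ! i) - 1" "xs ! Suc i = fst (p ! Suc i) - 1"
      using i len by (simp_all add: xs_def)
    moreover have "0 < fst (p ! i)" "0 < fst (p ! Suc i)"
      using pos[of i] pos[of "Suc i"] i by simp_all
    moreover have "w ! (fst (p ! i) - 1) = (b ! i, snd (p ! i))"
      "w ! (fst (p ! Suc i) - 1) = (b ! Suc i, snd (p ! Suc i))"
      using w_nth i by simp_all
    ultimately show ?thesis
      unfolding letter_key_less cless_def by (simp only: fst_conv snd_conv) arith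
  qed
  then have "sorted_wrt (<) (map (letter_key w) xs)"
    unfolding sorted_wrt_iff_nth_Suc_transp[OF transp_on_less] using len by (simp add: xs_def)
  then have xs: "reading_order w = xs" using reading_order_unique[OF set_xs] by simp
  have "word_perm w = p"
    unfolding word_perm_def xs
  proof (rule nth_equalityI)
    fix i assume "i < length (map (\<lambda>v. (v + 1, snd (w ! v))) xs)"
    then have "i < n" by (simp add: xs_def len)
    then show "map (\<lambda>v. (v + 1, snd (w ! v))) xs ! i = p ! i"
      using w_nth[of i] pos[of i] len by (simp add: xs_def prod_eq_iff)
  qed (simp add: xs_def)
  moreover have "word_labels w = b"
    unfolding word_labels_def xs
  proof (rule nth_equalityI)
    fix i assume "i < length (map (\<lambda>v. fst (w ! v)) xs)"
    then have "i < n" by (simp add: xs_def len)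
    then show "map (\<lambda>v. fst (w ! v)) xs ! i = b ! i"
      using w_nth[of i] len by (simp add: xs_def)
  qed (simp add: xs_def len)
  moreover have "w \<in> words ({..<m} \<times> {..l}) n"
  proof -
    have "w ! v \<in> {..<m} \<times> {..l}" if "v < n" for v
    proof -
      have "v \<in> set xs" using that set_xs len_w by simp
      then obtain i where "i < n" "xs ! i = v" unfolding in_set_conv_nth using len by (auto simp: xs_def)
      then show ?thesis using w_nth[of i] flag[of i] lab[of i] len by (auto simp: xs_def)
    qed
    then have "\<forall>v<length w. w ! v \<in> {..<m} \<times> {..l}" using len_w by simp
    then have "\<forall>x\<in>set w. x \<in> {..<m} \<times> {..l}" unfolding all_set_conv_all_nth .
    then show ?thesis using len_w by (simp only: words_def mem_Collect_eq subset_eq)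
  qed
  ultimately show thesis using that by blast
qed

lemma word_perm_inj:
  assumes "length w = length w'" "word_perm w = word_perm w'" "word_labels w = word_labels w'"
  shows "w = w'"
proof -
  have "map fst (word_perm u) = map Suc (reading_order u)" for u
    by (simp add: word_perm_def)
  then have "map Suc (reading_order w) = map Suc (reading_order w')"
    using assms(2) by metis
  then have eq: "reading_order w = reading_order w'"
    by (simp only: inj_map_eq_map[OF inj_Suc])
  show ?thesis
  proof (rule nth_equalityI)
    fix v assume "v < length w"
    then have v: "v \<in> set (reading_order w)" by (simp add: set_reading_order)
    have "fst (w ! v) = fst (w' ! v)"
      using assms(3) v unfolding word_labels_def eq by simp
    moreover have "snd (w ! v) = snd (w' ! v)"
      using assms(2) v unfolding word_perm_def eq by simp
    ultimately show "w ! v = w' ! v" by (simp add: prod_eq_iff)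
  qed (rule assms(1))
qed

lemma sum_flagged_perms:
  fixes t r :: "'c::comm_ring_1" and y :: "nat \<Rightarrow> 'c"
  shows "(\<Sum>p | p \<in> colored_perms (Suc l) n \<and> flagged_ok l p.
        t ^ sum_list (map snd p) * r ^ cfix p * (\<Sum>b\<in>compatible m p. \<Prod>c\<leftarrow>b. y c))
    = (\<Sum>w | w \<in> words ({..<m} \<times> {..l}) n \<and> word_ok l w.
        t ^ sum_list (map snd w) * r ^ word_fix w * (\<Prod>x\<leftarrow>w. y (fst x)))"
proof -
  let ?P = "{p. p \<in> colored_perms (Suc l) n \<and> flagged_ok l p}"
  let ?W = "{w. w \<in> words ({..<m} \<times> {..l}) n \<and> word_ok l w}"
  let ?S = "Sigma ?P (compatible m)"
  have finP: "finite ?P"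
  proof (rule finite_subset)
    show "?P \<subseteq> words ({1..n} \<times> {..<Suc l}) n"
      by (force simp: colored_perms_def words_def)
  qed (intro finite_words, simp)
  have finC: "finite (compatible m p)" for p
    by (rule finite_subset[OF _ finite_words[of "{..<m}" "length p"]]) (auto simp: compatible_def words_def)
  have bij: "bij_betw (\<lambda>w. (word_perm w, word_labels w)) ?W ?S"
  proof (rule bij_betwI')
    fix w w' assume "w \<in> ?W" "w' \<in> ?W"
    then show "((word_perm w, word_labels w) = (word_perm w', word_labels w')) = (w = w')"
      using word_perm_inj[of w w'] by (auto simp: words_def)
  next
    fix w assume "w \<in> ?W"
    then show "(word_perm w, word_labels w) \<in> ?S"
      using word_perm_colored word_labels_compatible word_perm_flagged_ok by blast
  next
    fix s assume "s \<in> ?S"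
    then obtain p b where s: "s = (p, b)" "p \<in> colored_perms (Suc l) n" "flagged_ok l p" "b \<in> compatible m p"
      by blast
    obtain w where "w \<in> words ({..<m} \<times> {..l}) n" "word_perm w = p" "word_labels w = b"
      using word_perm_surj[OF s(2) s(4)] .
    then show "\<exists>w\<in>?W. s = (word_perm w, word_labels w)"
      using s word_perm_flagged_ok by blast
  qed
  have "(\<Sum>p\<in>?P. t ^ sum_list (map snd p) * r ^ cfix p * (\<Sum>b\<in>compatible m p. \<Prod>c\<leftarrow>b. y c))
      = (\<Sum>(p, b)\<in>?S. t ^ sum_list (map snd p) * r ^ cfix p * (\<Prod>c\<leftarrow>b. y c))"
    using finP finC by (simp add: sum_distrib_left sum.Sigma)
  also have "\<dots> = (\<Sum>w\<in>?W. t ^ sum_list (map snd (word_perm w)) * r ^ cfix (word_perm w) * (\<Prod>c\<leftarrow>word_labels w. y c))"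
    by (subst sum.reindex_bij_betw[OF bij, symmetric]) simp
  also have "\<dots> = (\<Sum>w\<in>?W. t ^ sum_list (map snd w) * r ^ word_fix w * (\<Prod>x\<leftarrow>w. y (fst x)))"
  proof (intro sum.cong refl)
    fix w assume "w \<in> ?W"
    then have ok: "word_ok l w" by simp
    have "sum_list (map snd (word_perm w)) = sum_mset (mset (map (\<lambda>v. snd (w ! v)) (reading_order w)))"
      by (simp add: word_perm_def o_def sum_mset_sum_list[symmetric] del: mset_map)
    also have "\<dots> = sum_list (map snd w)"
      unfolding map_reading_order by (rule sum_mset_sum_list)
    finally have 1: "sum_list (map snd (word_perm w)) = sum_list (map snd w)" .
    have "(\<Prod>c\<leftarrow>word_labels w. y c) = prod_mset (mset (map (\<lambda>v. y (fst (w ! v))) (reading_order w)))"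
      by (simp add: word_labels_def o_def prod_mset_prod_list[symmetric] del: mset_map)
    also have "\<dots> = (\<Prod>x\<leftarrow>w. y (fst x))"
      unfolding map_reading_order[of "\<lambda>x. y (fst x)"] by (rule prod_mset_prod_list)
    finally have 2: "(\<Prod>c\<leftarrow>word_labels w. y c) = (\<Prod>x\<leftarrow>w. y (fst x))" .
    show "t ^ sum_list (map snd (word_perm w)) * r ^ cfix (word_perm w) * (\<Prod>c\<leftarrow>word_labels w. y c)
       = t ^ sum_list (map snd w) * r ^ word_fix w * (\<Prod>x\<leftarrow>w. y (fst x))"
      by (simp only: 1 2 cfix_word_perm[OF ok])
  qed
  finally show ?thesis .
qed

section \<open>Labellings and the major index\<close>

text \<open>\<open>compatible\<close> without the bound m on the labels; finiteness comes from
  fixing the label sum instead.\<close>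

definition is_labelling :: "(nat \<times> nat) list \<Rightarrow> nat list \<Rightarrow> bool" where
  "is_labelling p b \<longleftrightarrow> length b = length p \<and>
     (\<forall>i. Suc i < length p \<longrightarrow> b ! Suc i \<le> b ! i \<and> (cless (p ! Suc i) (p ! i) \<longrightarrow> b ! Suc i < b ! i))"

lemma compatible_iff: "b \<in> compatible m p \<longleftrightarrow> is_labelling p b \<and> set b \<subseteq> {..<m}"
  by (auto simp: compatible_def is_labelling_def)

lemma is_labelling_snoc:
  "is_labelling (p @ [x]) (b @ [e]) \<longleftrightarrow>
     is_labelling p b \<and> (p \<noteq> [] \<longrightarrow> e \<le> last b \<and> (cless x (last p) \<longrightarrow> e < last b))"
proof (cases "length b = length p")
  case True
  let ?Q = "\<lambda>p b i. b ! Suc i \<le> b ! i \<and> (cless (p ! Suc i) (p ! i) \<longrightarrow> b ! Suc i < b ! i)"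
  have old: "?Q (p @ [x]) (b @ [e]) i = ?Q p b i" if "Suc i < length p" for i
    using that True by (simp add: nth_append)
  have new: "?Q (p @ [x]) (b @ [e]) i = (e \<le> last b \<and> (cless x (last p) \<longrightarrow> e < last b))" if "Suc i = length p" for i
  proof -
    have "p \<noteq> []" "b \<noteq> []" using that True by auto
    moreover have "length p - 1 = i" "length b - 1 = i" using that True by simp_all
    ultimately have "last p = p ! i" "last b = b ! i"
      using last_conv_nth[of p] last_conv_nth[of b] by metis+
    then show ?thesis using that True by (simp add: nth_append)
  qed
  have "(\<forall>i. Suc i < length (p @ [x]) \<longrightarrow> ?Q (p @ [x]) (b @ [e]) i) \<longleftrightarrow>
      (\<forall>i. Suc i < length p \<longrightarrow> ?Q (p @ [x]) (b @ [e]) i) \<and> (\<forall>i. Suc i = length p \<longrightarrow> ?Q (p @ [x]) (b @ [e]) i)"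
    unfolding length_append_singleton less_Suc_eq by blast
  also have "\<dots> \<longleftrightarrow> (\<forall>i. Suc i < length p \<longrightarrow> ?Q p b i) \<and>
      (\<forall>i. Suc i = length p \<longrightarrow> e \<le> last b \<and> (cless x (last p) \<longrightarrow> e < last b))"
    by (intro arg_cong2[where f = "(\<and>)"] all_cong old new)
  also have "\<dots> \<longleftrightarrow> (\<forall>i. Suc i < length p \<longrightarrow> ?Q p b i) \<and>
      (p \<noteq> [] \<longrightarrow> e \<le> last b \<and> (cless x (last p) \<longrightarrow> e < last b))"
    by (cases p) auto
  finally show ?thesis using True by (simp add: is_labelling_def)
qed (simp add: is_labelling_def)

lemma is_labelling_map_Suc: "is_labelling p (map Suc b) \<longleftrightarrow> is_labelling p b"
  by (auto simp: is_labelling_def)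

lemma is_labelling_last_le:
  "is_labelling p b \<Longrightarrow> c \<in> set b \<Longrightarrow> last b \<le> c"
proof (induction p arbitrary: b c rule: rev_induct)
  case Nil
  then show ?case by (simp add: is_labelling_def)
next
  case (snoc x p)
  have "length b = Suc (length p)" using snoc.prems by (simp add: is_labelling_def)
  then obtain b' e where b: "b = b' @ [e]" by (cases b rule: rev_cases) auto
  have lab: "is_labelling p b'" "p \<noteq> [] \<longrightarrow> e \<le> last b'"
    using snoc.prems(1) unfolding b is_labelling_snoc by blast+
  show ?case
  proof (cases "c \<in> set b'")
    case True
    then have "p \<noteq> []" using lab(1) by (auto simp: is_labelling_def)
    then show ?thesis using snoc.IH[OF lab(1) True] lab(2) b by simp
  next
    case False
    then show ?thesis using snoc.prems(2) b by simp
  qed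
qed

lemma is_labelling_pos:
  assumes "is_labelling p b" "b \<noteq> [] \<longrightarrow> 0 < last b"
  obtains b' where "b = map Suc b'" "is_labelling p b'"
proof -
  have "0 < c" if "c \<in> set b" for c
    using is_labelling_last_le[OF assms(1) that] assms(2) that by (cases b) auto
  then have "b = map Suc (map (\<lambda>c. c - 1) b)"
    by (simp add: o_def) (rule map_idI[symmetric], simp)
  then show thesis using that assms(1) is_labelling_map_Suc by metis
qed

definition labellings :: "(nat \<times> nat) list \<Rightarrow> nat \<Rightarrow> nat list set" where
  "labellings p d = {b. is_labelling p b \<and> sum_list b = d}"

lemma labellings_bounded: "labellings p d \<subseteq> {b. set b \<subseteq> {..d} \<and> length b = length p}"
  by (auto simp: labellings_def is_labelling_def member_le_sum_list)

lemma finite_labellings: "finite (labellings p d)"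
  by (rule finite_subset[OF labellings_bounded]) (simp add: finite_lists_length_eq)

lemma sum_list_map_Suc: "sum_list (map Suc b) = sum_list b + length b"
  by (induction b) auto

text \<open>If the last label is positive, so are all Suc n labels, and each is lowered by one. If
  it is 0, it is removed; a descent just before it forces the other n labels to be positive, and
  lowering those accounts for s.\<close>

lemma card_labellings_snoc:
  fixes p :: "(nat \<times> nat) list" and x :: "nat \<times> nat"
  defines "n \<equiv> length p"
  defines "s \<equiv> (if p \<noteq> [] \<and> cless x (last p) then n else 0)"
  shows "card (labellings (p @ [x]) d) =
    (if Suc n \<le> d then card (labellings (p @ [x]) (d - Suc n)) else 0)
    + (if s \<le> d then card (labellings p (d - s)) else 0)"
proof -
  let ?L = "labellings (p @ [x])"
  have snocE: "\<exists>b' e. b = b' @ [e] \<and> length b' = n" if "is_labelling (p @ [x]) b" for b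
    using that by (cases b rule: rev_cases) (auto simp: is_labelling_def n_def)
  have pos: "{b \<in> ?L d. 0 < last b} = (if Suc n \<le> d then map Suc ` ?L (d - Suc n) else {})"
  proof (intro equalityI subsetI)
    fix b assume b: "b \<in> {b \<in> ?L d. 0 < last b}"
    then have lab: "is_labelling (p @ [x]) b" by (simp add: labellings_def)
    obtain b' where b': "b = map Suc b'" "is_labelling (p @ [x]) b'"
      using is_labelling_pos[OF lab] b by blast
    moreover have "length b' = Suc n" using b'(2) by (simp add: is_labelling_def n_def)
    moreover have "sum_list b = d" using b by (simp add: labellings_def)
    ultimately show "b \<in> (if Suc n \<le> d then map Suc ` ?L (d - Suc n) else {})"
      by (auto simp: labellings_def sum_list_map_Suc)
  next
    fix b assume "b \<in> (if Suc n \<le> d then map Suc ` ?L (d - Suc n) else {})"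
    then obtain b' where b': "b = map Suc b'" "Suc n \<le> d" "b' \<in> ?L (d - Suc n)"
      by (auto split: if_splits)
    moreover have "length b' = Suc n" using b'(3) by (simp add: labellings_def is_labelling_def n_def)
    moreover from this have "b' \<noteq> []" by auto
    ultimately show "b \<in> {b \<in> ?L d. 0 < last b}"
      by (simp add: labellings_def sum_list_map_Suc is_labelling_map_Suc last_map)
  qed
  let ?g = "\<lambda>b. (if s = 0 then b else map Suc b) @ [0]"
  have zero: "{b \<in> ?L d. last b = 0} = (if s \<le> d then ?g ` labellings p (d - s) else {})"
  proof (intro equalityI subsetI)
    fix b assume b: "b \<in> {b \<in> ?L d. last b = 0}"
    then have lab: "is_labelling (p @ [x]) b" and sum: "sum_list b = d" by (simp_all add: labellings_def)
    obtain b' where b': "b = b' @ [0]" "length b' = n" using snocE[OF lab] b by auto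
    have lab': "is_labelling p b'" and last: "p \<noteq> [] \<longrightarrow> cless x (last p) \<longrightarrow> 0 < last b'"
      using lab unfolding b' is_labelling_snoc by blast+
    show "b \<in> (if s \<le> d then ?g ` labellings p (d - s) else {})"
    proof (cases "s = 0")
      case True
      then show ?thesis using b' lab' sum by (auto simp: labellings_def)
    next
      case False
      then have sn: "s = n" and "p \<noteq> []" "cless x (last p)" by (auto simp: s_def split: if_splits)
      then obtain c where c: "b' = map Suc c" "is_labelling p c"
        using is_labelling_pos[OF lab'] last by blast
      moreover have "length c = n" using c(2) by (simp add: is_labelling_def n_def)
      ultimately show ?thesis using b' sum False sn
        by (auto simp: labellings_def sum_list_map_Suc)
    qed
  next
    fix b assume "b \<in> (if s \<le> d then ?g ` labellings p (d - s) else {})"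
    then obtain c where c: "b = ?g c" "s \<le> d" "is_labelling p c" "sum_list c = d - s"
      by (auto simp: labellings_def split: if_splits)
    have len: "length c = n" using c(3) by (simp add: is_labelling_def n_def)
    show "b \<in> {b \<in> ?L d. last b = 0}"
    proof (cases "s = 0")
      case True
      then have "\<not> (p \<noteq> [] \<and> cless x (last p))" by (auto simp: s_def n_def)
      then have "is_labelling (p @ [x]) (c @ [0])" using c(3) unfolding is_labelling_snoc by blast
      then show ?thesis using True c by (simp add: labellings_def)
    next
      case False
      then have sn: "s = n" "p \<noteq> []" by (auto simp: s_def split: if_splits)
      then have "c \<noteq> []" using len by (auto simp: n_def)
      then have "0 < last (map Suc c)" by (simp add: last_map)
      then have "is_labelling (p @ [x]) (map Suc c @ [0])"
        using c(3) unfolding is_labelling_snoc is_labelling_map_Suc by simp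
      then show ?thesis using False c sn len by (simp add: labellings_def sum_list_map_Suc)
    qed
  qed
  have "?L d = {b \<in> ?L d. 0 < last b} \<union> {b \<in> ?L d. last b = 0}" by auto
  then have "card (?L d) = card ({b \<in> ?L d. 0 < last b} \<union> {b \<in> ?L d. last b = 0})" by simp
  also have "\<dots> = card {b \<in> ?L d. 0 < last b} + card {b \<in> ?L d. last b = 0}"
    by (rule card_Un_disjoint) (auto simp: finite_labellings)
  also have "card {b \<in> ?L d. 0 < last b} = (if Suc n \<le> d then card (?L (d - Suc n)) else 0)"
    unfolding pos by (simp add: card_image inj_on_def)
  also have "card {b \<in> ?L d. last b = 0} = (if s \<le> d then card (labellings p (d - s)) else 0)"
    unfolding zero by (simp add: card_image inj_on_def)
  finally show ?thesis .
qed

definition label_series :: "(nat \<times> nat) list \<Rightarrow> 'a::comm_ring_1 fps" where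
  "label_series p = Abs_fps (\<lambda>d. of_nat (card (labellings p d)))"

lemma label_series_snoc:
  "(1 - fps_X ^ Suc (length p)) * label_series (p @ [x])
   = fps_X ^ (if p \<noteq> [] \<and> cless x (last p) then length p else 0) * (label_series p :: 'a::comm_ring_1 fps)"
proof (rule fps_ext)
  fix d
  let ?s = "if p \<noteq> [] \<and> cless x (last p) then length p else 0"
  have "fps_nth ((1 - fps_X ^ Suc (length p)) * label_series (p @ [x])) d
      = (of_nat (card (labellings (p @ [x]) d)) - of_nat (if Suc (length p) \<le> d then card (labellings (p @ [x]) (d - Suc (length p))) else 0) :: 'a)"
    unfolding left_diff_distrib fps_sub_nth fps_X_power_mult_nth mult_1_left by (simp add: label_series_def)
  also have "\<dots> = of_nat (if ?s \<le> d then card (labellings p (d - ?s)) else 0)"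
    by (subst card_labellings_snoc) simp
  also have "\<dots> = fps_nth (fps_X ^ ?s * label_series p) d"
    unfolding fps_X_power_mult_nth by (simp add: label_series_def)
  finally show "fps_nth ((1 - fps_X ^ Suc (length p)) * label_series (p @ [x])) d
     = fps_nth (fps_X ^ ?s * (label_series p :: 'a fps)) d" .
qed

lemma cmaj_snoc: "cmaj (p @ [x]) = cmaj p + (if p \<noteq> [] \<and> cless x (last p) then length p else 0)"
proof (cases p rule: rev_cases)
  case Nil
  then show ?thesis by (simp add: cmaj_def)
next
  case (snoc p' y)
  let ?n = "length p"
  have "{1..<Suc ?n} = insert ?n {1..<?n}" using snoc by auto
  then have "cmaj (p @ [x]) = (if cless ((p @ [x]) ! ?n) ((p @ [x]) ! (?n - 1)) then ?n else 0)
      + (\<Sum>i\<in>{1..<?n}. if cless ((p @ [x]) ! i) ((p @ [x]) ! (i - 1)) then i else 0)"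
    by (simp add: cmaj_def)
  also have "(\<Sum>i\<in>{1..<?n}. if cless ((p @ [x]) ! i) ((p @ [x]) ! (i - 1)) then i else 0) = cmaj p"
    unfolding cmaj_def
  proof (intro sum.cong refl)
    fix i assume "i \<in> {1..<?n}"
    then have "i < ?n" "i - 1 < ?n" by auto
    then show "(if cless ((p @ [x]) ! i) ((p @ [x]) ! (i - 1)) then i else 0)
        = (if cless (p ! i) (p ! (i - 1)) then i else 0)"
      by (simp only: nth_append if_True)
  qed
  also have "(p @ [x]) ! ?n = x" by simp
  also have "(p @ [x]) ! (?n - 1) = last p" using snoc by (simp add: nth_append)
  finally show ?thesis using snoc by simp
qed

definition qfact :: "nat \<Rightarrow> 'a::comm_ring_1 \<Rightarrow> 'a" where
  "qfact n q = (\<Prod>i\<in>{1..n}. 1 - q ^ i)"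

text \<open>MacMahon's identity: the labellings have generating function q^maj / (q;q)_n. A descent
  at position n contributes n to maj and, by \<open>label_series_snoc\<close>, a factor X^n.\<close>

lemma label_series: "qfact (length p) fps_X * label_series p = (fps_X ^ cmaj p :: 'a::comm_ring_1 fps)"
proof (induction p rule: rev_induct)
  case Nil
  have "labellings [] d = (if d = 0 then {[]} else {})" for d
    by (auto simp: labellings_def is_labelling_def)
  then show ?case
    by (intro fps_ext) (simp add: qfact_def label_series_def cmaj_def)
next
  case (snoc x p)
  have "qfact (length (p @ [x])) fps_X * label_series (p @ [x])
     = qfact (length p) fps_X * ((1 - fps_X ^ Suc (length p)) * (label_series (p @ [x]) :: 'a fps))"
    by (simp add: qfact_def mult_ac)
  also have "\<dots> = fps_X ^ (if p \<noteq> [] \<and> cless x (last p) then length p else 0) * fps_X ^ cmaj p"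
    unfolding label_series_snoc snoc.IH[symmetric] by (simp only: mult_ac)
  finally show ?case by (simp add: cmaj_snoc power_add mult_ac)
qed

text \<open>No label exceeds the label sum d, so a bound m > d excludes nothing.\<close>

lemma label_series_truncated:
  assumes "d < m"
  shows "fps_nth (\<Sum>b\<in>compatible m p. fps_X ^ sum_list b) d = fps_nth (label_series p :: 'a::comm_ring_1 fps) d"
proof -
  have fin: "finite (compatible m p)"
    by (rule finite_subset[OF _ finite_lists_length_eq[of "{..<m}" "length p"]]) (auto simp: compatible_def)
  have "{b \<in> compatible m p. sum_list b = d} = labellings p d"
  proof (intro equalityI subsetI)
    fix b assume b: "b \<in> labellings p d"
    have "{..d} \<subseteq> {..<m}" using assms by auto
    then have "set b \<subseteq> {..<m}" using subsetD[OF labellings_bounded b] by blast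
    then show "b \<in> {b \<in> compatible m p. sum_list b = d}"
      using b by (simp add: compatible_iff labellings_def)
  qed (auto simp: compatible_iff labellings_def)
  moreover have "fps_nth (\<Sum>b\<in>compatible m p. fps_X ^ sum_list b) d
      = (\<Sum>b\<in>compatible m p. if sum_list b = d then 1 else 0 :: 'a)"
    by (auto simp: fps_sum_nth fps_X_power_nth intro!: sum.cong)
  ultimately show ?thesis
    using fin by (simp add: sum.If_cases Int_def label_series_def conj_commute)
qed

section \<open>Recolouring excedances\<close>

definition mark_exc :: "nat \<Rightarrow> (nat \<times> nat) list \<Rightarrow> (nat \<times> nat) list" where
  "mark_exc l p = map (\<lambda>i. if snd (p ! i) = 0 \<and> i + 1 < fst (p ! i) then (fst (p ! i), l) else p ! i) [0..<length p]"

definition unmark_exc :: "nat \<Rightarrow> (nat \<times> nat) list \<Rightarrow> (nat \<times> nat) list" where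
  "unmark_exc l p = map (\<lambda>x. if snd x = l then (fst x, 0) else x) p"

lemma length_mark_exc [simp]: "length (mark_exc l p) = length p"
  by (simp add: mark_exc_def)

lemma mark_exc_nth:
  "i < length p \<Longrightarrow> mark_exc l p ! i = (if snd (p ! i) = 0 \<and> i + 1 < fst (p ! i) then (fst (p ! i), l) else p ! i)"
  by (simp add: mark_exc_def)

lemma map_fst_mark_exc: "map fst (mark_exc l p) = map fst p"
  by (rule nth_equalityI) (auto simp: mark_exc_nth)

lemma map_fst_unmark_exc: "map fst (unmark_exc l p) = map fst p"
  by (simp add: unmark_exc_def)

lemma colored_perms_nth:
  assumes "p \<in> colored_perms l n" "i < n"
  shows "snd (p ! i) < l" "1 \<le> fst (p ! i)" "fst (p ! i) \<le> n"
proof -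
  have "p ! i \<in> set p" "map fst p ! i \<in> set (map fst p)" using assms by (auto simp: colored_perms_def)
  then show "snd (p ! i) < l" "1 \<le> fst (p ! i)" "fst (p ! i) \<le> n"
    using assms by (auto simp: colored_perms_def)
qed

lemma colored_permsI:
  assumes "length p = n" "distinct (map fst p)" "set (map fst p) = {1..n}" "\<And>i. i < n \<Longrightarrow> snd (p ! i) < l"
  shows "p \<in> colored_perms l n"
  using assms unfolding colored_perms_def mem_Collect_eq all_set_conv_all_nth by blast

lemma mark_exc_mem:
  assumes "l \<ge> 1" "p \<in> colored_perms l n"
  shows "mark_exc l p \<in> colored_perms (Suc l) n" "flagged_ok l (mark_exc l p)"
proof -
  have len: "length p = n" using assms by (simp add: colored_perms_def)
  show "mark_exc l p \<in> colored_perms (Suc l) n"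
  proof (rule colored_permsI)
    show "snd (mark_exc l p ! i) < Suc l" if "i < n" for i
      using colored_perms_nth(1)[OF assms(2) that] that len by (simp add: mark_exc_nth)
  qed (use assms(2) in \<open>simp_all only: map_fst_mark_exc colored_perms_def mem_Collect_eq length_mark_exc\<close>)
  show "flagged_ok l (mark_exc l p)"
    unfolding flagged_ok_def
  proof (intro allI impI)
    fix i assume "i < length (mark_exc l p)"
    then show "(snd (mark_exc l p ! i) = l \<longrightarrow> i + 1 < fst (mark_exc l p ! i)) \<and>
        (snd (mark_exc l p ! i) = 0 \<longrightarrow> fst (mark_exc l p ! i) \<le> i + 1)"
      using colored_perms_nth(1)[OF assms(2), of i] len assms(1) by (simp add: mark_exc_nth)
  qed
qed

lemma unmark_exc_mem:
  assumes "l \<ge> 1" "p \<in> colored_perms (Suc l) n"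
  shows "unmark_exc l p \<in> colored_perms l n"
proof (rule colored_permsI)
  have len: "length p = n" using assms by (simp add: colored_perms_def)
  then show "length (unmark_exc l p) = n" by (simp add: unmark_exc_def)
  show "snd (unmark_exc l p ! i) < l" if "i < n" for i
    using colored_perms_nth(1)[OF assms(2) that] that len assms(1) by (simp add: unmark_exc_def)
qed (use assms(2) in \<open>simp_all only: map_fst_unmark_exc colored_perms_def mem_Collect_eq\<close>)

lemma unmark_mark_exc:
  assumes "p \<in> colored_perms l n"
  shows "unmark_exc l (mark_exc l p) = p"
proof (rule nth_equalityI)
  fix i assume "i < length (unmark_exc l (mark_exc l p))"
  then have i: "i < length p" "i < n" using assms by (simp_all add: unmark_exc_def colored_perms_def)
  show "unmark_exc l (mark_exc l p) ! i = p ! i"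
    using colored_perms_nth(1)[OF assms i(2)] i(1) by (simp add: unmark_exc_def mark_exc_nth prod_eq_iff)
qed (simp add: unmark_exc_def)

lemma mark_unmark_exc:
  assumes "flagged_ok l p" "l \<ge> 1"
  shows "mark_exc l (unmark_exc l p) = p"
proof (rule nth_equalityI)
  fix i assume "i < length (mark_exc l (unmark_exc l p))"
  then have i: "i < length p" by (simp add: unmark_exc_def)
  show "mark_exc l (unmark_exc l p) ! i = p ! i"
    using assms(1)[unfolded flagged_ok_def, rule_format, OF i] i assms(2)
    by (auto simp: unmark_exc_def mark_exc_nth prod_eq_iff)
qed (simp add: unmark_exc_def)

lemma sum_flags_mark_exc: "sum_list (map snd (mark_exc l p)) = cfexc l p"
proof -
  let ?E = "\<lambda>i. snd (p ! i) = 0 \<and> i + 1 < fst (p ! i)"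
  have "sum_list (map snd (mark_exc l p)) = (\<Sum>i<length p. snd (mark_exc l p ! i))"
    by (simp add: sum_list_sum_nth atLeast0LessThan)
  also have "\<dots> = (\<Sum>i<length p. (if ?E i then l else 0) + snd (p ! i))"
    by (intro sum.cong refl) (simp add: mark_exc_nth)
  also have "\<dots> = (\<Sum>i<length p. if ?E i then l else 0) + sum_list (map snd p)"
    by (simp add: sum.distrib sum_list_sum_nth atLeast0LessThan)
  also have "(\<Sum>i<length p. if ?E i then l else 0) = (\<Sum>i\<in>{i \<in> {..<length p}. ?E i}. l)"
    by (rule sum.inter_filter[symmetric]) simp
  also have "\<dots> = l * cexc p" by (simp add: cexc_def)
  finally show ?thesis by (simp add: cfexc_def)
qed

lemma cfix_mark_exc:
  assumes "l \<ge> 1"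
  shows "cfix (mark_exc l p) = cfix p"
  unfolding cfix_def length_mark_exc
  using assms by (intro arg_cong[where f = card] Collect_cong conj_cong refl) (simp add: mark_exc_nth prod_eq_iff)

text \<open>Marking changes the comparison only if exactly one neighbour is an excedance. An
  excedance following a nonexcedance turns an ascent into a descent, since colour l lies below all
  others; an excedance followed by a nonexcedance turns a descent into an ascent. Distinctness of
  the values decides the boundary case of both lying next to i + 1.\<close>

lemma descent_mark_exc:
  assumes p: "p \<in> colored_perms l n" and i: "1 \<le> i" "i < n"
  defines "E \<equiv> \<lambda>i. if snd (p ! i) = 0 \<and> i + 1 < fst (p ! i) then 1 else (0::nat)"
  shows "(if cless (p ! i) (p ! (i - 1)) then 1 else 0) + E i
       = (if cless (mark_exc l p ! i) (mark_exc l p ! (i - 1)) then 1 else 0) + E (i - 1)"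
proof -
  have len: "length p = n" using p by (simp add: colored_perms_def)
  have "fst (p ! i) \<noteq> fst (p ! (i - 1))"
    using p i nth_eq_iff_index_eq[of "map fst p" i "i - 1"] by (simp add: colored_perms_def)
  moreover have "snd (p ! i) < l" "snd (p ! (i - 1)) < l"
    using colored_perms_nth(1)[OF p] i by simp_all
  moreover obtain v a where "p ! i = (v, a)" by (cases "p ! i")
  moreover obtain u b where "p ! (i - 1) = (u, b)" by (cases "p ! (i - 1)")
  moreover have "mark_exc l p ! i = (if snd (p ! i) = 0 \<and> i + 1 < fst (p ! i) then (fst (p ! i), l) else p ! i)"
    "mark_exc l p ! (i - 1) = (if snd (p ! (i - 1)) = 0 \<and> i < fst (p ! (i - 1)) then (fst (p ! (i - 1)), l) else p ! (i - 1))"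
    using i len by (simp_all add: mark_exc_nth)
  moreover have "i - 1 + 1 = i" using i by simp
  ultimately show ?thesis
    unfolding E_def cless_def by (simp split: if_split) linarith
qed

text \<open>Weight \<open>descent_mark_exc\<close> by i and sum: E j occurs with weight j on one
  side and j + 1 on the other, so each excedance leaves one unit. The last position is never an
  excedance, so no boundary term remains.\<close>

lemma cmaj_mark_exc:
  assumes p: "p \<in> colored_perms l n"
  shows "cmaj p = cmaj (mark_exc l p) + cexc p"
proof (cases n)
  case 0
  then show ?thesis using p by (simp add: colored_perms_def cmaj_def cexc_def mark_exc_def)
next
  case (Suc k)
  have len: "length p = n" using p by (simp add: colored_perms_def)
  define E where "E = (\<lambda>i. if snd (p ! i) = 0 \<and> i + 1 < fst (p ! i) then 1 else (0::nat))"
  have E_last: "E k = 0" using colored_perms_nth(3)[OF p, of k] Suc by (simp add: E_def)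
  have exc: "cexc p = (\<Sum>i<n. E i)"
  proof -
    have "(\<Sum>i<n. E i) = (\<Sum>i\<in>{i \<in> {..<n}. snd (p ! i) = 0 \<and> i + 1 < fst (p ! i)}. 1)"
      unfolding E_def by (rule sum.inter_filter[symmetric]) simp
    then show ?thesis by (simp add: cexc_def len)
  qed
  have shift: "(\<Sum>i\<in>{1..<n}. f i) = (\<Sum>i<k. f (Suc i))" for f :: "nat \<Rightarrow> nat"
    unfolding Suc One_nat_def sum.shift_bounds_Suc_ivl by (simp add: atLeast0LessThan)
  have "cmaj p + (\<Sum>i\<in>{1..<n}. i * E i)
      = (\<Sum>i\<in>{1..<n}. i * ((if cless (p ! i) (p ! (i - 1)) then 1 else 0) + E i))"
    unfolding cmaj_def len sum.distrib[symmetric] by (intro sum.cong refl) simp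
  also have "\<dots> = (\<Sum>i\<in>{1..<n}. i * ((if cless (mark_exc l p ! i) (mark_exc l p ! (i - 1)) then 1 else 0) + E (i - 1)))"
  proof (intro sum.cong refl arg_cong2[where f = "(*)"])
    fix i assume "i \<in> {1..<n}"
    then show "(if cless (p ! i) (p ! (i - 1)) then 1 else 0) + E i
       = (if cless (mark_exc l p ! i) (mark_exc l p ! (i - 1)) then 1 else 0) + E (i - 1)"
      unfolding E_def by (intro descent_mark_exc[OF p]) auto
  qed
  also have "\<dots> = cmaj (mark_exc l p) + (\<Sum>i\<in>{1..<n}. i * E (i - 1))"
    unfolding cmaj_def length_mark_exc len sum.distrib[symmetric] by (intro sum.cong refl) simp
  finally have "cmaj p + (\<Sum>i\<in>{1..<n}. i * E i) = cmaj (mark_exc l p) + (\<Sum>i\<in>{1..<n}. i * E (i - 1))" .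
  moreover have "(\<Sum>i\<in>{1..<n}. i * E (i - 1)) = (\<Sum>i<k. i * E i) + (\<Sum>i<k. E i)"
    unfolding shift by (simp add: sum.distrib add.commute)
  moreover have "(\<Sum>i\<in>{1..<n}. i * E i) = (\<Sum>i<k. i * E i)"
  proof -
    have "(\<Sum>i<k. i * E i) = (\<Sum>i<n. i * E i)" using E_last Suc by simp
    also have "\<dots> = (\<Sum>i\<in>{1..<n}. i * E i)"
      by (rule sum.mono_neutral_right) (auto simp: Suc_le_eq)
    finally show ?thesis ..
  qed
  moreover have "(\<Sum>i<n. E i) = (\<Sum>i<k. E i)" using E_last Suc by simp
  ultimately show ?thesis using exc by simp
qed

lemma colEulerian_flagged:
  assumes "l \<ge> 1"
  shows "colEulerian l n t r q
    = (\<Sum>p | p \<in> colored_perms (Suc l) n \<and> flagged_ok l p. t ^ sum_list (map snd p) * r ^ cfix p * q ^ cmaj p)"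
  unfolding colEulerian_def
proof (rule sum.reindex_bij_witness[where i = "unmark_exc l" and j = "mark_exc l"])
  fix p assume p: "p \<in> colored_perms l n"
  show "unmark_exc l (mark_exc l p) = p" by (rule unmark_mark_exc[OF p])
  show "mark_exc l p \<in> {p. p \<in> colored_perms (Suc l) n \<and> flagged_ok l p}"
    using mark_exc_mem[OF assms p] by simp
  show "t ^ sum_list (map snd (mark_exc l p)) * r ^ cfix (mark_exc l p) * q ^ cmaj (mark_exc l p)
      = t ^ cfexc l p * r ^ cfix p * q ^ (cmaj p - cexc p)"
    using cmaj_mark_exc[OF p] by (simp add: sum_flags_mark_exc cfix_mark_exc[OF assms])
next
  fix p assume p: "p \<in> {p. p \<in> colored_perms (Suc l) n \<and> flagged_ok l p}"
  then show "mark_exc l (unmark_exc l p) = p" using mark_unmark_exc[OF _ assms] by simp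
  show "unmark_exc l p \<in> colored_perms l n" using unmark_exc_mem[OF assms] p by simp
qed

section \<open>The recurrence for labelled permutations\<close>

lemma finite_multisets:
  assumes "finite A"
  shows "finite {K. set_mset K \<subseteq> A \<and> size K \<le> n}"
proof (rule finite_subset)
  show "{K. set_mset K \<subseteq> A \<and> size K \<le> n} \<subseteq> mset ` {w. set w \<subseteq> A \<and> length w \<le> n}"
  proof
    fix K assume K: "K \<in> {K. set_mset K \<subseteq> A \<and> size K \<le> n}"
    obtain w where "mset w = K" using ex_mset by blast
    then show "K \<in> mset ` {w. set w \<subseteq> A \<and> length w \<le> n}" using K by (auto intro!: image_eqI[of _ _ w])
  qed
  show "finite (mset ` {w. set w \<subseteq> A \<and> length w \<le> n})"
    using finite_lists_length_le[OF assms] by simp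
qed

text \<open>The exponents chosen in the nested sums are the multiplicities of one multiset K, and
  every element of K brings a factor X.\<close>

lemma fps_nth_content_sum:
  assumes "distinct cs"
  shows "fps_nth (content_sum (\<lambda>c. fps_const (y c)) cs f) n =
    (\<Sum>K | set_mset K \<subseteq> set cs \<and> size K \<le> n. (\<Prod>c\<in>#K. y c) * fps_nth (f K) (n - size K))"
  using assms
proof (induction cs arbitrary: f)
  case Nil
  have "{K :: nat multiset. set_mset K \<subseteq> set [] \<and> size K \<le> n} = {{#}}" by auto
  then show ?case unfolding content_sum.simps by (simp only:) simp
next
  case (Cons c cs)
  let ?C = "\<lambda>A. {K. set_mset K \<subseteq> A \<and> size K \<le> n}"
  have c: "c \<notin> set cs" using Cons.prems by simp
  have "fps_nth (content_sum (\<lambda>c. fps_const (y c)) (c # cs) f) n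
     = (\<Sum>K\<in>?C (set cs). \<Sum>k\<le>n - size K. (\<Prod>c\<in>#K. y c) * (y c ^ k * fps_nth (f (K + replicate_mset k c)) (n - size K - k)))"
    using Cons by (simp add: fps_total_def fps_const_power sum_distrib_left)
  also have "\<dots> = (\<Sum>(K, k)\<in>Sigma (?C (set cs)) (\<lambda>K. {..n - size K}).
      (\<Prod>c\<in>#K. y c) * (y c ^ k * fps_nth (f (K + replicate_mset k c)) (n - size K - k)))"
    by (rule sum.Sigma) (auto intro: finite_multisets)
  also have "\<dots> = (\<Sum>K\<in>?C (set (c # cs)). (\<Prod>c\<in>#K. y c) * fps_nth (f K) (n - size K))"
  proof (rule sum.reindex_bij_witness[where i = "\<lambda>K. (filter_mset (\<lambda>d. d \<noteq> c) K, count K c)"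
        and j = "\<lambda>(K, k). K + replicate_mset k c"])
    fix s assume "s \<in> Sigma (?C (set cs)) (\<lambda>K. {..n - size K})"
    then obtain K k where s: "s = (K, k)" "set_mset K \<subseteq> set cs" "size K \<le> n" "k \<le> n - size K" by auto
    have cK: "c \<notin># K" using s c by auto
    have "filter_mset (\<lambda>d. d \<noteq> c) K = K" using cK by (intro filter_mset_eq_conv[THEN iffD2]) auto
    moreover have "filter_mset (\<lambda>d. d \<noteq> c) (replicate_mset k c) = {#}"
      by (simp add: filter_mset_eq_conv in_replicate_mset)
    ultimately show "(\<lambda>K. (filter_mset (\<lambda>d. d \<noteq> c) K, count K c)) (case s of (K, k) \<Rightarrow> K + replicate_mset k c) = s"
      using cK by (simp add: s count_eq_zero_iff)
    show "(case s of (K, k) \<Rightarrow> K + replicate_mset k c) \<in> ?C (set (c # cs))"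
      using s by (auto simp: in_replicate_mset)
    show "(\<Prod>d\<in>#(case s of (K, k) \<Rightarrow> K + replicate_mset k c). y d)
        * fps_nth (f (case s of (K, k) \<Rightarrow> K + replicate_mset k c)) (n - size (case s of (K, k) \<Rightarrow> K + replicate_mset k c))
      = (case s of (K, k) \<Rightarrow> (\<Prod>c\<in>#K. y c) * (y c ^ k * fps_nth (f (K + replicate_mset k c)) (n - size K - k)))"
      by (simp add: s mult.assoc)
  next
    fix K assume K: "K \<in> ?C (set (c # cs))"
    have split: "filter_mset (\<lambda>d. d \<noteq> c) K + replicate_mset (count K c) c = K"
      by (rule multiset_eqI) simp
    then show "(case (filter_mset (\<lambda>d. d \<noteq> c) K, count K c) of (K, k) \<Rightarrow> K + replicate_mset k c) = K" by simp
    have "size (filter_mset (\<lambda>d. d \<noteq> c) K) + count K c = size K"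
      using arg_cong[OF split, of size] by simp
    then show "(filter_mset (\<lambda>d. d \<noteq> c) K, count K c) \<in> Sigma (?C (set cs)) (\<lambda>K. {..n - size K})"
      using K by auto
  qed
  finally show ?case .
qed

definition label_sum :: "nat \<Rightarrow> (nat \<Rightarrow> 'b::comm_ring_1) \<Rightarrow> 'b \<Rightarrow> 'b \<Rightarrow> nat \<Rightarrow> nat \<Rightarrow> 'b" where
  "label_sum l y t r m n = (\<Sum>p | p \<in> colored_perms (Suc l) n \<and> flagged_ok l p.
     t ^ sum_list (map snd p) * r ^ cfix p * (\<Sum>b\<in>compatible m p. \<Prod>c\<leftarrow>b. y c))"

text \<open>As t, r and y enter as constants, the coefficient \<open>B K\<close> is a constant
  series; only multisets of size exactly n reach X^n.\<close>

lemma label_sum_series: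
  assumes "l \<ge> 1"
  shows "Abs_fps (label_sum l y t r m)
    = block_sum (\<lambda>c. fps_const (y c)) (fps_const r) (fps_const t ^ l) (\<Sum>f\<le>l. fps_const t ^ f) [0..<m]"
proof (rule fps_ext)
  fix n
  let ?A = "{..<m} \<times> {..l}"
  let ?C = "{K. set_mset K \<subseteq> {..<m} \<and> size K = n}"
  let ?lev = "\<lambda>w. mset (map fst w)"
  define g where "g w = t ^ sum_list (map snd w) * r ^ word_fix w * (\<Prod>x\<leftarrow>w. y (fst x))" for w
  define B where "B K = mcoeff (\<Prod>c<m. block (const_mp (fps_const r)) (const_mp (fps_const t ^ l)) (var_mp c)
      (row (fps_const t ^ l) (\<Sum>f\<le>l. fps_const t ^ f) {..<m} c) (count K c)) K" for K
  have B: "B K = (\<Sum>w | w \<in> words ?A (size K) \<and> ?lev w = K.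
      fps_const (if word_ok l w then t ^ sum_list (map snd w) * r ^ word_fix w else 0))"
    if "set_mset K \<subseteq> {..<m}" for K
    unfolding B_def mcoeff_block_prod[OF assms that]
  proof (intro sum.cong refl)
    fix w assume "w \<in> {w. w \<in> words ?A (size K) \<and> ?lev w = K}"
    then have w: "w \<in> words ?A (size K)" and K: "count K = count (?lev w)" by auto
    show "level_weight (fps_const t) (fps_const r) l (count K) m w
      = fps_const (if word_ok l w then t ^ sum_list (map snd w) * r ^ word_fix w else 0)"
      unfolding K level_weight_word[OF assms w] by (simp add: fps_const_power)
  qed
  have "fps_nth (block_sum (\<lambda>c. fps_const (y c)) (fps_const r) (fps_const t ^ l) (\<Sum>f\<le>l. fps_const t ^ f) [0..<m]) n
      = (\<Sum>K | set_mset K \<subseteq> {..<m} \<and> size K \<le> n. (\<Prod>c\<in>#K. y c) * fps_nth (B K) (n - size K))"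
    unfolding block_sum_def by (subst fps_nth_content_sum) (simp_all add: B_def atLeast0LessThan)
  also have "\<dots> = (\<Sum>K\<in>?C. (\<Prod>c\<in>#K. y c) * fps_nth (B K) (n - size K))"
  proof (rule sum.mono_neutral_right)
    show "\<forall>K\<in>{K. set_mset K \<subseteq> {..<m} \<and> size K \<le> n} - ?C. (\<Prod>c\<in>#K. y c) * fps_nth (B K) (n - size K) = 0"
    proof
      fix K assume K: "K \<in> {K. set_mset K \<subseteq> {..<m} \<and> size K \<le> n} - ?C"
      then have "set_mset K \<subseteq> {..<m}" "n - size K \<noteq> 0" by auto
      then have "fps_nth (B K) (n - size K) = 0"
        unfolding B[OF \<open>set_mset K \<subseteq> {..<m}\<close>] fps_sum_nth by (intro sum.neutral) simp
      then show "(\<Prod>c\<in>#K. y c) * fps_nth (B K) (n - size K) = 0" by simp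
    qed
  qed (auto intro: finite_multisets)
  also have "\<dots> = (\<Sum>K\<in>?C. \<Sum>w | w \<in> {w. w \<in> words ?A n \<and> word_ok l w} \<and> ?lev w = K. g w)"
  proof (intro sum.cong refl)
    fix K assume K: "K \<in> ?C"
    let ?W = "{w. w \<in> words ?A n \<and> ?lev w = K}"
    have "finite (words ?A n)" by (rule finite_words) simp
    then have fin: "finite ?W" by simp
    have "(\<Prod>c\<in>#K. y c) * fps_nth (B K) (n - size K)
        = (\<Sum>w\<in>?W. (\<Prod>c\<in>#K. y c) * (if word_ok l w then t ^ sum_list (map snd w) * r ^ word_fix w else 0))"
      using K by (simp add: B fps_sum_nth sum_distrib_left)
    also have "\<dots> = (\<Sum>w\<in>?W. if word_ok l w then g w else 0)"
    proof (intro sum.cong refl)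
      fix w assume "w \<in> ?W"
      then have "K = mset (map fst w)" by simp
      then have "(\<Prod>c\<in>#K. y c) = prod_mset (mset (map y (map fst w)))" by (simp only: mset_map)
      also have "\<dots> = (\<Prod>x\<leftarrow>w. y (fst x))" unfolding prod_mset_prod_list by (simp add: o_def)
      finally show "(\<Prod>c\<in>#K. y c) * (if word_ok l w then t ^ sum_list (map snd w) * r ^ word_fix w else 0)
          = (if word_ok l w then g w else 0)" by (simp add: g_def mult_ac)
    qed
    also have "\<dots> = (\<Sum>w\<in>{w \<in> ?W. word_ok l w}. g w)"
      using fin by (rule sum.inter_filter[symmetric])
    also have "{w \<in> ?W. word_ok l w} = {w. w \<in> {w. w \<in> words ?A n \<and> word_ok l w} \<and> ?lev w = K}" by blast
    finally show "(\<Prod>c\<in>#K. y c) * fps_nth (B K) (n - size K)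
        = (\<Sum>w | w \<in> {w. w \<in> words ?A n \<and> word_ok l w} \<and> ?lev w = K. g w)" .
  qed
  also have "\<dots> = (\<Sum>w | w \<in> words ?A n \<and> word_ok l w. g w)"
  proof (rule sum.group)
    show "finite {w. w \<in> words ?A n \<and> word_ok l w}" using finite_words[of ?A n] by simp
    show "finite ?C" by (rule finite_subset[OF _ finite_multisets[of "{..<m}" n]]) auto
    show "?lev ` {w. w \<in> words ?A n \<and> word_ok l w} \<subseteq> ?C" by (fastforce simp: words_def)
  qed
  also have "\<dots> = label_sum l y t r m n"
    unfolding g_def label_sum_def by (rule sum_flagged_perms[symmetric])
  finally show "fps_nth (Abs_fps (label_sum l y t r m)) n = fps_nth (block_sum (\<lambda>c. fps_const (y c)) (fps_const r)
      (fps_const t ^ l) (\<Sum>f\<le>l. fps_const t ^ f) [0..<m]) n" by simp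
qed

section \<open>Splitting off the label 0\<close>

lemma lin_prod_shift: "lin_prod y a (map Suc cs) = lin_prod (\<lambda>c. y (Suc c)) a cs"
  by (simp add: lin_prod_def o_def)

lemma lin_quot_shift: "lin_quot y a (map Suc cs) = lin_quot (\<lambda>c. y (Suc c)) a cs"
  by (induction cs) (simp_all add: lin_prod_shift)

lemma lin_prod_unit:
  fixes y :: "nat \<Rightarrow> 'b::comm_ring_1 fps"
  shows "\<exists>g. g * lin_prod y a cs = 1"
proof (induction cs)
  case Nil
  then show ?case by (simp add: lin_prod_def)
next
  case (Cons c cs)
  then obtain g where g: "g * lin_prod y a cs = 1" by blast
  obtain h where h: "h * (1 - fps_X * (a * y c)) = 1" using fps_unit_ex by blast
  have "(g * h) * lin_prod y a (c # cs) = (g * lin_prod y a cs) * (h * (1 - fps_X * (a * y c)))"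
    by (simp add: lin_prod_def mult_ac)
  then show ?case using g h by (intro exI[of _ "g * h"]) simp
qed

text \<open>The denominators D without and E with the label 0 satisfy E = (1 - z) D - (b - 1) z P s.
  For r = 1 the closed form collapses to F 1 * E = (1 - s z) P s, so the correction term is a
  multiple of \<open>F 1\<close>. This is the origin of the factor with r = 1 in the
  recurrence.\<close>

lemma block_sum_peel:
  fixes y :: "nat \<Rightarrow> 'b::comm_ring_1 fps"
  defines "z \<equiv> fps_X * y 0"
  shows "(1 - r * z) * block_sum y r s b [0..<Suc m]
    = block_sum (\<lambda>c. y (Suc c)) r s b [0..<m] * (1 - s * z + (b - 1) * z * block_sum y 1 s b [0..<Suc m])"
proof -
  let ?y = "\<lambda>c. y (Suc c)"
  define P where "P a = lin_prod ?y a [0..<m]" for a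
  define R where "R = lin_quot ?y s [0..<m]"
  define D where "D = P 1 + (b - 1) * R"
  define E where "E = (1 - z) * P 1 + (b - 1) * ((1 - z) * R - z * P s)"
  define F where "F a = block_sum y a s b [0..<Suc m]" for a
  define G where "G = block_sum ?y r s b [0..<m]"
  have cs: "[0..<Suc m] = 0 # map Suc [0..<m]"
    by (simp add: map_Suc_upt upt_conv_Cons del: upt_Suc)
  have cons: "lin_prod y a [0..<Suc m] = (1 - a * z) * P a" for a
    unfolding cs P_def lin_prod_shift[symmetric] by (simp add: lin_prod_def z_def)
  have quot: "lin_quot y s [0..<Suc m] = (1 - z) * R - z * P s"
    unfolding cs lin_quot.simps lin_quot_shift lin_prod_shift by (simp add: P_def R_def z_def)
  have sorted: "sorted_wrt (<) [0..<k]" for k :: nat by simp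
  have F: "F a * ((1 - a * z) * P a) * E = (1 - z) * P 1 * ((1 - s * z) * P s)" for a
    using block_sum_closed_form[OF sorted, of y a s b "Suc m"]
    unfolding cons quot F_def E_def by (simp only: mult_1_left)
  have G: "G * P r * D = P 1 * P s"
    using block_sum_closed_form[OF sorted, of ?y r s b m] unfolding G_def P_def D_def R_def .
  obtain u where u: "u * P r = 1" using lin_prod_unit unfolding P_def by blast
  obtain p where p: "p * ((1 - z) * P 1) = 1" using lin_prod_unit[of y 1 "[0..<Suc m]"] unfolding cons by auto
  have F1: "F 1 * E = (1 - s * z) * P s"
  proof -
    have "(p * ((1 - z) * P 1)) * (F 1 * E) = (p * ((1 - z) * P 1)) * ((1 - s * z) * P s)"
      using arg_cong[OF F[of 1], of "(*) p"] by (simp add: mult_ac)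
    then show ?thesis unfolding p by simp
  qed
  \<comment> \<open>E divides (1 - s z) P s, which is a unit.\<close>
  have E_unit: "\<exists>e. e * E = 1"
  proof -
    obtain v where v: "v * ((1 - s * z) * P s) = 1"
      using lin_prod_unit[of y s "[0..<Suc m]"] unfolding cons by auto
    then show ?thesis unfolding F1[symmetric] by (metis mult.assoc)
  qed
  then obtain e where e: "e * E = 1" by blast
  have ED: "(1 - s * z) * E + (b - 1) * z * ((1 - s * z) * P s) = (1 - s * z) * (1 - z) * D"
    by (simp add: E_def D_def algebra_simps)
  have "P r * E * ((1 - r * z) * F r) = F r * ((1 - r * z) * P r) * E" by (simp only: mult_ac)
  also have "\<dots> = (1 - z) * (1 - s * z) * (P 1 * P s)" unfolding F by (simp only: mult_ac)
  also have "\<dots> = P r * G * ((1 - s * z) * (1 - z) * D)" unfolding G[symmetric] by (simp only: mult_ac)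
  also have "\<dots> = P r * G * ((1 - s * z) * E + (b - 1) * z * (F 1 * E))" unfolding F1 ED ..
  also have "\<dots> = P r * E * (G * (1 - s * z + (b - 1) * z * F 1))" by (simp add: algebra_simps)
  finally have "(u * P r) * (e * E) * ((1 - r * z) * F r) = (u * P r) * (e * E) * (G * (1 - s * z + (b - 1) * z * F 1))"
    by (metis (no_types, lifting) mult.assoc mult.left_commute)
  then show ?thesis unfolding u e F_def G_def by simp
qed

text \<open>Coefficient of X^(n + 1) in \<open>block_sum_peel\<close>, where \<beta> - 1 = t [l]_t
  becomes the factor of the convolution and s = t^l that of the subtracted term.\<close>

lemma label_sum_Suc:
  assumes "l \<ge> 1" "y 0 = 1"
  shows "label_sum l y t r (Suc m) (Suc n) = r * label_sum l y t r (Suc m) n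
    + label_sum l (\<lambda>c. y (Suc c)) t r m (Suc n) - t ^ l * label_sum l (\<lambda>c. y (Suc c)) t r m n
    + t * qint l t * (\<Sum>k\<le>n. label_sum l (\<lambda>c. y (Suc c)) t r m k * label_sum l y t 1 (Suc m) (n - k))"
proof -
  let ?F = "Abs_fps (label_sum l y t r (Suc m))" and ?H = "Abs_fps (label_sum l y t 1 (Suc m))"
    and ?G = "Abs_fps (label_sum l (\<lambda>c. y (Suc c)) t r m)"
  have b: "(\<Sum>f\<le>l. fps_const t ^ f) - 1 = fps_const (t * qint l t)"
  proof -
    have "(\<Sum>f\<le>l. fps_const t ^ f) = fps_const (\<Sum>f\<le>l. t ^ f)"
      by (rule fps_ext) (simp add: fps_sum_nth fps_const_power)
    moreover have "(\<Sum>f\<le>l. t ^ f) = 1 + t * qint l t"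
      using sum.atMost_shift[of "\<lambda>f. t ^ f" l] by (simp add: qint_def sum_distrib_left)
    ultimately show ?thesis by simp
  qed
  have "(1 - fps_const r * (fps_X * fps_const (y 0))) * ?F = ?G * (1 - fps_const t ^ l * (fps_X * fps_const (y 0))
      + ((\<Sum>f\<le>l. fps_const t ^ f) - 1) * (fps_X * fps_const (y 0)) * ?H)"
    unfolding label_sum_series[OF assms(1)] fps_const_1_eq_1 by (rule block_sum_peel)
  then have "?F = fps_const r * (fps_X * ?F) + ?G - fps_const (t ^ l) * (fps_X * ?G) + fps_const (t * qint l t) * (fps_X * (?G * ?H))"
    unfolding b assms(2) by (simp add: fps_const_power algebra_simps)
  then have "fps_nth ?F (Suc n) = fps_nth (fps_const r * (fps_X * ?F) + ?G - fps_const (t ^ l) * (fps_X * ?G)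
      + fps_const (t * qint l t) * (fps_X * (?G * ?H))) (Suc n)" by (rule arg_cong)
  moreover have "fps_nth (?G * ?H) n
      = (\<Sum>k\<le>n. label_sum l (\<lambda>c. y (Suc c)) t r m k * label_sum l y t 1 (Suc m) (n - k))"
    by (simp add: fps_mult_nth atMost_atLeast0)
  ultimately show ?thesis
    by (simp only: fps_add_nth fps_sub_nth fps_mult_left_const_nth fps_X_mult_nth fps_nth_Abs_fps
        diff_Suc_1 nat.distinct if_False)
qed

section \<open>Unboundedly many labels\<close>

definition perm_series :: "nat \<Rightarrow> 'a::comm_ring_1 \<Rightarrow> 'a \<Rightarrow> nat \<Rightarrow> 'a fps" where
  "perm_series l t r n = (\<Sum>p | p \<in> colored_perms (Suc l) n \<and> flagged_ok l p.
     fps_const t ^ sum_list (map snd p) * fps_const r ^ cfix p * label_series p)"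

lemma qfact_perm_series:
  fixes t r :: "'a::comm_ring_1"
  assumes "l \<ge> 1"
  shows "qfact n fps_X * perm_series l t r n = colEulerian l n (fps_const t) (fps_const r) fps_X"
  unfolding perm_series_def colEulerian_flagged[OF assms] sum_distrib_left
proof (intro sum.cong refl)
  fix p assume "p \<in> {p. p \<in> colored_perms (Suc l) n \<and> flagged_ok l p}"
  then have "length p = n" by (simp add: colored_perms_def)
  then have "qfact n fps_X * label_series p = (fps_X ^ cmaj p :: 'a fps)"
    using label_series[of p] by simp
  then show "qfact n fps_X * (fps_const t ^ sum_list (map snd p) * fps_const r ^ cfix p * label_series p)
      = fps_const t ^ sum_list (map snd p) * fps_const r ^ cfix p * fps_X ^ cmaj p"
    by (simp only: mult.left_commute[of "qfact n fps_X"])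
qed

lemma prod_list_power: "(\<Prod>c\<leftarrow>b. q ^ c) = (q :: 'b::comm_ring_1) ^ sum_list b"
  by (induction b) (simp_all add: power_add)

lemma label_sum_truncated:
  assumes "d < m"
  shows "fps_nth (label_sum l (\<lambda>c. fps_X ^ c) (fps_const t) (fps_const r) m n) d = fps_nth (perm_series l t r n) d"
proof -
  have mult: "fps_nth (f * g) d = fps_nth (f * h) d" if "\<And>i. i \<le> d \<Longrightarrow> fps_nth g i = fps_nth h i" for f g h :: "'a fps"
    using that by (simp add: fps_mult_nth)
  show ?thesis
    unfolding label_sum_def perm_series_def fps_sum_nth prod_list_power
    by (intro sum.cong refl mult label_series_truncated) (use assms in simp)
qed

text \<open>Raising each of the n labels by one multiplies the weight by q^n; applied to words
  without the label 0, this gives the q^k of the recurrence.\<close>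

lemma label_sum_shift:
  "label_sum l (\<lambda>c. q ^ Suc c) t r m n = q ^ n * label_sum l (\<lambda>c. q ^ c) t r m n"
  unfolding label_sum_def
proof (subst sum_distrib_left, rule sum.cong[OF refl])
  fix p assume p: "p \<in> {p. p \<in> colored_perms (Suc l) n \<and> flagged_ok l p}"
  have "(\<Sum>b\<in>compatible m p. \<Prod>c\<leftarrow>b. q ^ Suc c) = (\<Sum>b\<in>compatible m p. q ^ n * (\<Prod>c\<leftarrow>b. q ^ c))"
  proof (intro sum.cong refl)
    fix b assume "b \<in> compatible m p"
    then have "length b = n" using p by (simp add: compatible_def colored_perms_def)
    moreover have "(\<Prod>c\<leftarrow>b. q ^ Suc c) = q ^ length b * (\<Prod>c\<leftarrow>b. q ^ c)"
      by (induction b) (simp_all add: mult_ac)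
    ultimately show "(\<Prod>c\<leftarrow>b. q ^ Suc c) = q ^ n * (\<Prod>c\<leftarrow>b. q ^ c)" by simp
  qed
  then have "(\<Sum>b\<in>compatible m p. \<Prod>c\<leftarrow>b. q ^ Suc c) = q ^ n * (\<Sum>b\<in>compatible m p. \<Prod>c\<leftarrow>b. q ^ c)"
    by (simp only: sum_distrib_left)
  then show "t ^ sum_list (map snd p) * r ^ cfix p * (\<Sum>b\<in>compatible m p. \<Prod>c\<leftarrow>b. q ^ Suc c)
      = q ^ n * (t ^ sum_list (map snd p) * r ^ cfix p * (\<Sum>b\<in>compatible m p. \<Prod>c\<leftarrow>b. q ^ c))"
    by (simp only: mult_ac)
qed

definition agree_upto :: "nat \<Rightarrow> 'a::comm_ring_1 fps \<Rightarrow> 'a fps \<Rightarrow> bool" where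
  "agree_upto d f g \<longleftrightarrow> (\<forall>i\<le>d. fps_nth f i = fps_nth g i)"

lemma agree_upto_refl: "agree_upto d f f"
  by (simp add: agree_upto_def)

lemma agree_upto_add: "agree_upto d f f' \<Longrightarrow> agree_upto d g g' \<Longrightarrow> agree_upto d (f + g) (f' + g')"
  by (simp add: agree_upto_def)

lemma agree_upto_diff: "agree_upto d f f' \<Longrightarrow> agree_upto d g g' \<Longrightarrow> agree_upto d (f - g) (f' - g')"
  by (simp add: agree_upto_def)

lemma agree_upto_mult: "agree_upto d f f' \<Longrightarrow> agree_upto d g g' \<Longrightarrow> agree_upto d (f * g) (f' * g')"
  by (simp add: agree_upto_def fps_mult_nth)

lemma agree_upto_sum: "(\<And>i. i \<in> I \<Longrightarrow> agree_upto d (f i) (g i)) \<Longrightarrow> agree_upto d (sum f I) (sum g I)"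
  by (simp add: agree_upto_def fps_sum_nth)

text \<open>At the coefficient of q^d the choice m = d + 1 makes m and m + 1 labels both
  indistinguishable from infinitely many, so the finite recurrence passes to the limit. The term of
  degree n + 1 coming from all labels being positive is moved to the left.\<close>

lemma perm_series_Suc:
  assumes "l \<ge> 1"
  shows "(1 - fps_X ^ Suc n) * perm_series l t r (Suc n)
    = (fps_const r - fps_const t ^ l * fps_X ^ n) * perm_series l t r n
      + fps_const t * qint l (fps_const t) * (\<Sum>k\<le>n. fps_X ^ k * perm_series l t r k * perm_series l t 1 (n - k))"
proof -
  let ?S = "perm_series l t r" and ?S1 = "perm_series l t 1" and ?t = "fps_const t" and ?r = "fps_const r"
  have "?S (Suc n) = ?r * ?S n + fps_X ^ Suc n * ?S (Suc n) - ?t ^ l * (fps_X ^ n * ?S n)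
      + ?t * qint l ?t * (\<Sum>k\<le>n. fps_X ^ k * ?S k * ?S1 (n - k))" (is "_ = ?rhs")
  proof (rule fps_ext)
    fix d
    define m where "m = Suc d"
    let ?L = "label_sum l (\<lambda>c. fps_X ^ c) ?t ?r" and ?L1 = "label_sum l (\<lambda>c. fps_X ^ c) ?t 1"
    have agree: "agree_upto d (?L m k) (?S k)" "agree_upto d (?L (Suc m) k) (?S k)" "agree_upto d (?L1 (Suc m) k) (?S1 k)" for k
      using label_sum_truncated[where t = t and r = r] label_sum_truncated[where t = t and r = 1]
      by (simp_all add: agree_upto_def m_def fps_const_1_eq_1[symmetric] del: fps_const_1_eq_1)
    have rec: "?L (Suc m) (Suc n) = ?r * ?L (Suc m) n + fps_X ^ Suc n * ?L m (Suc n) - ?t ^ l * (fps_X ^ n * ?L m n)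
       + ?t * qint l ?t * (\<Sum>k\<le>n. fps_X ^ k * ?L m k * ?L1 (Suc m) (n - k))"
      using label_sum_Suc[OF assms, of "\<lambda>c. fps_X ^ c" ?t ?r m n] unfolding label_sum_shift by simp
    have "fps_nth (?S (Suc n)) d = fps_nth (?L (Suc m) (Suc n)) d"
      using agree(2)[of "Suc n"] by (simp add: agree_upto_def)
    also have "agree_upto d (?L (Suc m) (Suc n)) ?rhs"
      unfolding rec by (intro agree_upto_add agree_upto_diff agree_upto_mult agree_upto_sum agree_upto_refl agree)
    then have "fps_nth (?L (Suc m) (Suc n)) d = fps_nth ?rhs d" by (simp add: agree_upto_def)
    finally show "fps_nth (?S (Suc n)) d = fps_nth ?rhs d" .
  qed
  then show ?thesis by (simp add: algebra_simps)
qed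

section \<open>Gaussian binomials and transfer to arbitrary rings\<close>

lemma qpoch_poly_nonzero: "qpoch_poly n \<noteq> 0"
proof -
  \<comment> \<open>No factor 1 - 2^i with i \<ge> 1 vanishes.\<close>
  have "poly (qpoch_poly n) 2 \<noteq> 0"
    unfolding qpoch_poly_def poly_prod
    by (auto simp: poly_monom)
  then show ?thesis by auto
qed

lemma qpoch_poly_Suc: "qpoch_poly (Suc n) = qpoch_poly n * (1 - monom 1 (Suc n))"
  by (simp add: qpoch_poly_def)

text \<open>The q-Pascal argument: 1 - q^(n + 1) = (1 - q^k) + q^k (1 - q^(n + 1 - k)) splits the
  product into two summands, each divisible by induction. This makes the \<open>div\<close> in
  \<open>qbinom_poly\<close> exact.\<close>

lemma qpoch_poly_dvd: "k \<le> n \<Longrightarrow> qpoch_poly k * qpoch_poly (n - k) dvd qpoch_poly n"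
proof (induction n arbitrary: k)
  case 0
  then show ?case by (simp add: qpoch_poly_def)
next
  case (Suc n)
  show ?case
  proof (cases "k = 0 \<or> k = Suc n")
    case True
    then show ?thesis by (auto simp: qpoch_poly_def)
  next
    case False
    then obtain j where j: "k = Suc j" "j < n" using Suc.prems by (cases k) auto
    have k: "qpoch_poly k = qpoch_poly j * (1 - monom 1 k)"
      by (simp add: j qpoch_poly_Suc)
    have "Suc n - k = Suc (n - k)" using j by simp
    then have nk: "qpoch_poly (Suc n - k) = qpoch_poly (n - k) * (1 - monom 1 (Suc n - k))"
      by (simp only: qpoch_poly_Suc)
    have "(1 - monom 1 k :: int poly) + monom 1 k * (1 - monom 1 (Suc n - k)) = 1 - monom 1 (Suc n)"
      using Suc.prems by (simp add: right_diff_distrib mult_monom)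
    then have "qpoch_poly (Suc n) = qpoch_poly n * ((1 - monom 1 k) + monom 1 k * (1 - monom 1 (Suc n - k)))"
      by (simp only: qpoch_poly_Suc)
    also have "\<dots> = qpoch_poly n * (1 - monom 1 k) + qpoch_poly n * (1 - monom 1 (Suc n - k)) * monom 1 k"
      by (simp only: distrib_left mult_ac)
    finally have split: "qpoch_poly (Suc n) = qpoch_poly n * (1 - monom 1 k) + qpoch_poly n * (1 - monom 1 (Suc n - k)) * monom 1 k" .
    have "qpoch_poly j * qpoch_poly (n - j) * (1 - monom 1 k) dvd qpoch_poly n * (1 - monom 1 k)"
      using Suc.IH[of j] j by (intro mult_dvd_mono) auto
    moreover have "n - j = Suc n - k" using j by simp
    ultimately have "qpoch_poly k * qpoch_poly (Suc n - k) dvd qpoch_poly n * (1 - monom 1 k)"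
      unfolding k by (simp add: mult_ac)
    moreover have "qpoch_poly k * qpoch_poly (n - k) * (1 - monom 1 (Suc n - k)) dvd qpoch_poly n * (1 - monom 1 (Suc n - k))"
      using Suc.IH[of k] j by (intro mult_dvd_mono) auto
    then have "qpoch_poly k * qpoch_poly (Suc n - k) dvd qpoch_poly n * (1 - monom 1 (Suc n - k)) * monom 1 k"
      unfolding nk mult.assoc[symmetric] by (rule dvd_mult2)
    ultimately show ?thesis unfolding split by (rule dvd_add)
  qed
qed

lemma qpoch_poly_qbinom:
  assumes "k \<le> n"
  shows "qpoch_poly n = qbinom_poly n k * (qpoch_poly k * qpoch_poly (n - k))"
  unfolding qbinom_poly_def using qpoch_poly_dvd[OF assms] by simp

lemma qbinom_poly_self: "qbinom_poly n n = 1"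
proof -
  have "qpoch_poly 0 = 1" by (simp add: qpoch_poly_def)
  then show ?thesis unfolding qbinom_poly_def using qpoch_poly_nonzero[of n] by simp
qed

section \<open>Transport along ring homomorphisms\<close>

locale unital_hom =
  fixes h :: "'a::comm_ring_1 \<Rightarrow> 'b::comm_ring_1"
  assumes one: "h 1 = 1" and add: "h (x + y) = h x + h y" and mult: "h (x * y) = h x * h y"
begin

lemma zero: "h 0 = 0"
  using add[of 0 0] by simp

lemma power: "h (x ^ n) = h x ^ n"
  by (induction n) (simp_all add: one mult)

lemma sum: "h (sum f I) = (\<Sum>i\<in>I. h (f i))"
  by (induction I rule: infinite_finite_induct) (simp_all add: zero add)

lemma prod: "h (prod f I) = (\<Prod>i\<in>I. h (f i))"
  by (induction I rule: infinite_finite_induct) (simp_all add: one mult)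

lemma diff: "h (x - y) = h x - h y"
  using add[of "x - y" y] by simp

lemma of_nat: "h (of_nat n) = of_nat n"
  by (induction n) (simp_all add: zero one add)

lemma of_int: "h (of_int n) = of_int n"
  by (cases n rule: int_cases2) (use diff[of 0] in \<open>simp_all add: of_nat zero\<close>)

lemma poly_of_int: "h (poly (map_poly of_int p) x) = poly (map_poly of_int p) (h x)"
  by (induction p) (simp_all add: map_poly_pCons add mult of_int zero)

lemma colEulerian: "h (colEulerian l n t r q) = colEulerian l n (h t) (h r) (h q)"
  by (simp add: colEulerian_def sum mult power)

lemma qint: "h (qint l t) = qint l (h t)"
  by (simp add: qint_def sum power)

lemma qbinom: "h (qbinom n k q) = qbinom n k (h q)"
  unfolding qbinom_def by (rule poly_of_int)

end

text \<open>Carries the factorisation of (q;q)_n from Z[q], where exact division is available, into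
  any commutative ring.\<close>

interpretation int_poly_eval: unital_hom "\<lambda>p. poly (map_poly of_int p) (x :: 'a::comm_ring_1)"
proof
  show add: "poly (map_poly of_int (p + q)) x = poly (map_poly of_int p) x + poly (map_poly of_int q) x" for p q
  proof -
    have "map_poly of_int (p + q) = map_poly of_int p + (map_poly of_int q :: 'a poly)"
      by (rule poly_eqI) (simp add: coeff_map_poly)
    then show ?thesis by simp
  qed
  have smult: "poly (map_poly of_int (smult c p)) x = of_int c * poly (map_poly of_int p) x" for c p
  proof -
    have "map_poly of_int (smult c p) = smult (of_int c) (map_poly of_int p :: 'a poly)"
      by (rule poly_eqI) (simp add: coeff_map_poly)
    then show ?thesis by simp
  qed
  show "poly (map_poly of_int (p * q)) x = poly (map_poly of_int p) x * poly (map_poly of_int q) x" for p q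
  proof (induction p)
    case (pCons a p)
    have "poly (map_poly of_int (pCons a p * q)) x = of_int a * poly (map_poly of_int q) x
        + x * poly (map_poly of_int (p * q)) x"
      by (simp add: add smult map_poly_pCons)
    then show ?case by (simp add: pCons.IH map_poly_pCons algebra_simps)
  qed simp
qed simp

lemma qfact_qbinom:
  assumes "k \<le> n"
  shows "qfact n q = qbinom n k q * (qfact k q * qfact (n - k) q)"
proof -
  have monom: "poly (map_poly of_int (monom 1 i)) q = q ^ i" for i
    by (simp add: map_poly_monom poly_monom)
  have "poly (map_poly of_int (qpoch_poly n)) q = qfact n q" for n
    unfolding qpoch_poly_def qfact_def int_poly_eval.prod int_poly_eval.diff monom int_poly_eval.one ..
  then show ?thesis
    using arg_cong[OF qpoch_poly_qbinom[OF assms], of "\<lambda>p. poly (map_poly of_int p) q"]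
    unfolding int_poly_eval.mult qbinom_def by simp
qed

lemma qbinom_self: "qbinom n n q = 1"
  unfolding qbinom_def qbinom_poly_self by (rule int_poly_eval.one)

lemma colEulerian_0: "colEulerian l 0 t r q = 1"
proof -
  have "colored_perms l 0 = {[]}" by (auto simp: colored_perms_def)
  then show ?thesis by (simp add: colEulerian_def cfexc_def cexc_def cfix_def cmaj_def)
qed

definition eulerian_rhs :: "nat \<Rightarrow> nat \<Rightarrow> 'a::comm_ring_1 \<Rightarrow> 'a \<Rightarrow> 'a \<Rightarrow> 'a" where
  "eulerian_rhs l n t r q = (r + t * qint (l - 1) t * q ^ n) * colEulerian l n t r q
     + t * qint l t * (\<Sum>k = 0..<n. qbinom n k q * q ^ k * colEulerian l k t r q * colEulerian1 l (n - k) t q)"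

lemma (in unital_hom) eulerian_rhs: "h (eulerian_rhs l n t r q) = eulerian_rhs l n (h t) (h r) (h q)"
  by (simp add: eulerian_rhs_def colEulerian1_def add mult power qint qbinom colEulerian sum one)

text \<open>Multiplying \<open>perm_series_Suc\<close> by (q;q)_n turns the series into Eulerian
  polynomials and the products into Gaussian binomial terms. The summand k = n contributes t [l]_t
  q^n A_n, which together with - t^l q^n A_n gives t [l-1]_t q^n A_n.\<close>

lemma colEulerian_Suc_fps:
  assumes "l \<ge> 1"
  shows "colEulerian l (Suc n) (fps_const t) (fps_const r) fps_X = eulerian_rhs l n (fps_const t) (fps_const r) (fps_X :: 'a::comm_ring_1 fps)"
proof -
  let ?t = "fps_const t" and ?r = "fps_const r" and ?q = "fps_X :: 'a fps"
  let ?S = "perm_series l t r" and ?S1 = "perm_series l t 1"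
  let ?A = "\<lambda>k. colEulerian l k ?t ?r ?q" and ?A1 = "\<lambda>k. colEulerian1 l k ?t ?q"
  have A: "qfact k ?q * ?S k = ?A k" for k by (rule qfact_perm_series[OF assms])
  have A1: "qfact k ?q * ?S1 k = ?A1 k" for k
    using qfact_perm_series[OF assms, of k t 1] by (simp add: colEulerian1_def)
  have "?A (Suc n) = qfact n ?q * ((1 - ?q ^ Suc n) * ?S (Suc n))"
    unfolding A[symmetric] by (simp add: qfact_def mult_ac)
  also have "\<dots> = (?r - ?t ^ l * ?q ^ n) * (qfact n ?q * ?S n)
      + ?t * qint l ?t * (\<Sum>k\<le>n. qfact n ?q * (?q ^ k * ?S k * ?S1 (n - k)))"
    unfolding perm_series_Suc[OF assms] sum_distrib_left[symmetric] by (simp add: algebra_simps)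
  also have "(\<Sum>k\<le>n. qfact n ?q * (?q ^ k * ?S k * ?S1 (n - k)))
      = (\<Sum>k\<le>n. qbinom n k ?q * ?q ^ k * ?A k * ?A1 (n - k))"
  proof (intro sum.cong refl)
    fix k assume "k \<in> {..n}"
    then have "qfact n ?q = qbinom n k ?q * (qfact k ?q * qfact (n - k) ?q)"
      by (intro qfact_qbinom) simp
    then show "qfact n ?q * (?q ^ k * ?S k * ?S1 (n - k)) = qbinom n k ?q * ?q ^ k * ?A k * ?A1 (n - k)"
      unfolding A[symmetric] A1[symmetric] by (simp only: mult_ac)
  qed
  also have "\<dots> = (\<Sum>k = 0..<n. qbinom n k ?q * ?q ^ k * ?A k * ?A1 (n - k)) + ?q ^ n * ?A n"
    by (simp add: lessThan_Suc_atMost[symmetric] atLeast0LessThan colEulerian1_def colEulerian_0 qbinom_self)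
  finally have "?A (Suc n) = (?r + (?t * qint l ?t - ?t ^ l) * ?q ^ n) * ?A n
      + ?t * qint l ?t * (\<Sum>k = 0..<n. qbinom n k ?q * ?q ^ k * ?A k * ?A1 (n - k))"
    unfolding A by (simp add: algebra_simps)
  moreover have "?t * qint l ?t - ?t ^ l = ?t * qint (l - 1) ?t"
    using assms by (cases l) (simp_all add: qint_def distrib_left)
  ultimately show ?thesis by (simp only: eulerian_rhs_def)
qed

lemma colEulerian_Suc:
  assumes "l \<ge> 1"
  shows "colEulerian l (Suc n) t r q = eulerian_rhs l n t r q"
proof -
  interpret F: unital_hom "fps_of_poly :: 'a poly \<Rightarrow> 'a fps"
    by standard (simp_all add: fps_of_poly_add fps_of_poly_mult)
  interpret E: unital_hom "\<lambda>p. poly p q"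
    by standard simp_all
  have X: "fps_of_poly [:0, 1:] = fps_X" by (simp add: fps_of_poly_fps_X)
  have "fps_of_poly (colEulerian l (Suc n) [:t:] [:r:] [:0, 1:]) = fps_of_poly (eulerian_rhs l n [:t:] [:r:] [:0, 1:])"
    unfolding F.colEulerian F.eulerian_rhs fps_of_poly_const X by (rule colEulerian_Suc_fps[OF assms])
  then have "colEulerian l (Suc n) [:t:] [:r:] [:0, 1:] = eulerian_rhs l n [:t:] [:r:] [:0, 1:]"
    by (simp only: fps_of_poly_eq_iff)
  then have "poly (colEulerian l (Suc n) [:t:] [:r:] [:0, 1:]) q = poly (eulerian_rhs l n [:t:] [:r:] [:0, 1:]) q"
    by (rule arg_cong)
  then show ?thesis unfolding E.colEulerian E.eulerian_rhs by simp
qed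

theorem theorem4p22:
  fixes t r q :: "'a::comm_ring_1" and l n :: nat
  assumes "l \<ge> 1"
  shows "colEulerian l 0 t r q = 1 \<and>
         colEulerian l (Suc n) t r q =
           (r + t * qint (l - 1) t * q ^ n) * colEulerian l n t r q
           + t * qint l t * (\<Sum>k = 0..<n. qbinom n k q * q ^ k * colEulerian l k t r q
                                              * colEulerian1 l (n - k) t q)"
  using colEulerian_0 colEulerian_Suc[OF assms] unfolding eulerian_rhs_def by blast

end
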